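(* Let $H$ be a left or right Noetherian Hopf algebra over a field $\Bbbk$. Suppose that the Hopf coradical $H_{[0]}$ is locally affine and faithfully flat over all its Hopf subalgebras. Then $H_{[0]}$ is affine, and hence $H$ is affine.
   Context: A $\Bbbk$-algebra is called affine if it is finitely generated as a $\Bbbk$-algebra. The coradical $H_{(0)}$ of a Hopf algebra $H$ is the sum of all simple subcoalgebras of $H$. The Hopf coradical $H_{[0]}$ is the subalgebra of $H$ generated by $H_{(0)}$. A Hopf algebra is called locally affine if each finite subset of it is contained in an affine Hopf subalgebra. The field $\Bbbk$ is arbitrary. (By a theorem of Skryabin, the antipode of a left or right Noetherian Hopf algebra is injective, and hence $H_{[0]}$ is a Hopf subalgebra of $H$.) *)

theory Defs
  imports "HOL-Algebra.Algebra"
begin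

section \<open>Modules over noncommutative rings\<close>

text \<open>
  The library's locale \<^locale>\<open>module\<close> requires a commutative base ring. Both one-sided notions below
  are carried by the same record type; for a right module, \<open>r \<odot> x\<close> is to be read as \<open>x r\<close>.
\<close>

locale left_module = R?: ring R + M?: abelian_group M
  for R :: "('r, 'x) ring_scheme" (structure) and M :: "('r, 'm, 'y) module_scheme" (structure) +
  assumes act_closed: "\<lbrakk>r \<in> carrier R; x \<in> carrier M\<rbrakk> \<Longrightarrow> r \<odot>\<^bsub>M\<^esub> x \<in> carrier M"
    and act_l_distr: "\<lbrakk>r \<in> carrier R; s \<in> carrier R; x \<in> carrier M\<rbrakk> \<Longrightarrow>
      (r \<oplus>\<^bsub>R\<^esub> s) \<odot>\<^bsub>M\<^esub> x = r \<odot>\<^bsub>M\<^esub> x \<oplus>\<^bsub>M\<^esub> s \<odot>\<^bsub>M\<^esub> x"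
    and act_r_distr: "\<lbrakk>r \<in> carrier R; x \<in> carrier M; y \<in> carrier M\<rbrakk> \<Longrightarrow>
      r \<odot>\<^bsub>M\<^esub> (x \<oplus>\<^bsub>M\<^esub> y) = r \<odot>\<^bsub>M\<^esub> x \<oplus>\<^bsub>M\<^esub> r \<odot>\<^bsub>M\<^esub> y"
    and act_assoc: "\<lbrakk>r \<in> carrier R; s \<in> carrier R; x \<in> carrier M\<rbrakk> \<Longrightarrow>
      (r \<otimes>\<^bsub>R\<^esub> s) \<odot>\<^bsub>M\<^esub> x = r \<odot>\<^bsub>M\<^esub> (s \<odot>\<^bsub>M\<^esub> x)"
    and act_one: "x \<in> carrier M \<Longrightarrow> \<one>\<^bsub>R\<^esub> \<odot>\<^bsub>M\<^esub> x = x"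

locale right_module = R?: ring R + M?: abelian_group M
  for R :: "('r, 'x) ring_scheme" (structure) and M :: "('r, 'm, 'y) module_scheme" (structure) +
  assumes act_closed: "\<lbrakk>r \<in> carrier R; x \<in> carrier M\<rbrakk> \<Longrightarrow> r \<odot>\<^bsub>M\<^esub> x \<in> carrier M"
    and act_l_distr: "\<lbrakk>r \<in> carrier R; s \<in> carrier R; x \<in> carrier M\<rbrakk> \<Longrightarrow>
      (r \<oplus>\<^bsub>R\<^esub> s) \<odot>\<^bsub>M\<^esub> x = r \<odot>\<^bsub>M\<^esub> x \<oplus>\<^bsub>M\<^esub> s \<odot>\<^bsub>M\<^esub> x"
    and act_r_distr: "\<lbrakk>r \<in> carrier R; x \<in> carrier M; y \<in> carrier M\<rbrakk> \<Longrightarrow>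
      r \<odot>\<^bsub>M\<^esub> (x \<oplus>\<^bsub>M\<^esub> y) = r \<odot>\<^bsub>M\<^esub> x \<oplus>\<^bsub>M\<^esub> r \<odot>\<^bsub>M\<^esub> y"
    and act_assoc: "\<lbrakk>r \<in> carrier R; s \<in> carrier R; x \<in> carrier M\<rbrakk> \<Longrightarrow>
      (r \<otimes>\<^bsub>R\<^esub> s) \<odot>\<^bsub>M\<^esub> x = s \<odot>\<^bsub>M\<^esub> (r \<odot>\<^bsub>M\<^esub> x)"
    and act_one: "x \<in> carrier M \<Longrightarrow> \<one>\<^bsub>R\<^esub> \<odot>\<^bsub>M\<^esub> x = x"

definition module_hom ::
    "('r, 'x) ring_scheme \<Rightarrow> ('r, 'a, 'y) module_scheme \<Rightarrow> ('r, 'b, 'z) module_scheme \<Rightarrow> ('a \<Rightarrow> 'b) set"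
  where "module_hom R M N = {f \<in> hom (add_monoid M) (add_monoid N).
    \<forall>r \<in> carrier R. \<forall>x \<in> carrier M. f (r \<odot>\<^bsub>M\<^esub> x) = r \<odot>\<^bsub>N\<^esub> f x}"


section \<open>Tensor products\<close>

text \<open>
  For a right module \<open>M\<close> and a left module \<open>N\<close> over \<open>R\<close>, the abelian group \<open>M \<otimes>\<^sub>R N\<close> is the free
  abelian group on pairs modulo the biadditivity and balancing relations. The group is written
  multiplicatively, as is every \<^const>\<open>free_Abelian_group\<close>.
\<close>

definition tensor_relations ::
    "('r, 'x) ring_scheme \<Rightarrow> ('r, 'm, 'y) module_scheme \<Rightarrow> ('r, 'n, 'z) module_scheme
      \<Rightarrow> ('m \<times> 'n \<Rightarrow>\<^sub>0 int) set"
  where "tensor_relations R M N =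
      {frag_of (x \<oplus>\<^bsub>M\<^esub> x', y) - frag_of (x, y) - frag_of (x', y) | x x' y.
        x \<in> carrier M \<and> x' \<in> carrier M \<and> y \<in> carrier N}
    \<union> {frag_of (x, y \<oplus>\<^bsub>N\<^esub> y') - frag_of (x, y) - frag_of (x, y') | x y y'.
        x \<in> carrier M \<and> y \<in> carrier N \<and> y' \<in> carrier N}
    \<union> {frag_of (r \<odot>\<^bsub>M\<^esub> x, y) - frag_of (x, r \<odot>\<^bsub>N\<^esub> y) | r x y.
        r \<in> carrier R \<and> x \<in> carrier M \<and> y \<in> carrier N}"

definition tensor_null ::
    "('r, 'x) ring_scheme \<Rightarrow> ('r, 'm, 'y) module_scheme \<Rightarrow> ('r, 'n, 'z) module_scheme
      \<Rightarrow> ('m \<times> 'n \<Rightarrow>\<^sub>0 int) set"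
  where "tensor_null R M N =
    generate (free_Abelian_group (carrier M \<times> carrier N)) (tensor_relations R M N)"

definition tensor ::
    "('r, 'x) ring_scheme \<Rightarrow> ('r, 'm, 'y) module_scheme \<Rightarrow> ('r, 'n, 'z) module_scheme
      \<Rightarrow> ('m \<times> 'n \<Rightarrow>\<^sub>0 int) set monoid"
  where "tensor R M N = free_Abelian_group (carrier M \<times> carrier N) Mod tensor_null R M N"

definition pure_tensor ::
    "('r, 'x) ring_scheme \<Rightarrow> ('r, 'm, 'y) module_scheme \<Rightarrow> ('r, 'n, 'z) module_scheme
      \<Rightarrow> 'm \<Rightarrow> 'n \<Rightarrow> ('m \<times> 'n \<Rightarrow>\<^sub>0 int) set"
  where "pure_tensor R M N x y =
    tensor_null R M N #>\<^bsub>free_Abelian_group (carrier M \<times> carrier N)\<^esub> frag_of (x, y)"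

text \<open>
  The homomorphism \<open>M \<otimes>\<^sub>R N \<rightarrow> G\<close> into an abelian group induced by \<open>b\<close>. It is used only for balanced
  biadditive \<open>b\<close>, where the value does not depend on the chosen representative;
  see \<open>tensor_lift_pure\<close> and \<open>tensor_lift_hom\<close>.
\<close>

definition tensor_lift ::
    "('g, 'z) monoid_scheme \<Rightarrow> ('m \<Rightarrow> 'n \<Rightarrow> 'g) \<Rightarrow> ('m \<times> 'n \<Rightarrow>\<^sub>0 int) set \<Rightarrow> 'g"
  where "tensor_lift G b t = (let c = SOME c. c \<in> t in
    \<Otimes>\<^bsub>G\<^esub>p \<in> Poly_Mapping.keys c. case_prod b p [^]\<^bsub>G\<^esub> Poly_Mapping.lookup c p)"

definition balanced ::
    "('r, 'x) ring_scheme \<Rightarrow> ('r, 'm, 'y) module_scheme \<Rightarrow> ('r, 'n, 'z) module_scheme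
      \<Rightarrow> ('g, 'w) monoid_scheme \<Rightarrow> ('m \<Rightarrow> 'n \<Rightarrow> 'g) \<Rightarrow> bool"
  where "balanced R M N G b \<longleftrightarrow>
    (\<forall>x \<in> carrier M. \<forall>y \<in> carrier N. b x y \<in> carrier G) \<and>
    (\<forall>x \<in> carrier M. \<forall>x' \<in> carrier M. \<forall>y \<in> carrier N. b (x \<oplus>\<^bsub>M\<^esub> x') y = b x y \<otimes>\<^bsub>G\<^esub> b x' y) \<and>
    (\<forall>x \<in> carrier M. \<forall>y \<in> carrier N. \<forall>y' \<in> carrier N. b x (y \<oplus>\<^bsub>N\<^esub> y') = b x y \<otimes>\<^bsub>G\<^esub> b x y') \<and>
    (\<forall>r \<in> carrier R. \<forall>x \<in> carrier M. \<forall>y \<in> carrier N. b (r \<odot>\<^bsub>M\<^esub> x) y = b x (r \<odot>\<^bsub>N\<^esub> y))"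

lemma free_eval:
  assumes "comm_group G" "f \<in> S \<rightarrow> carrier G"
  defines "h \<equiv> \<lambda>c. \<Otimes>\<^bsub>G\<^esub>p \<in> Poly_Mapping.keys c. f p [^]\<^bsub>G\<^esub> Poly_Mapping.lookup c p"
  shows "h \<in> hom (free_Abelian_group S) G" "\<And>p. p \<in> S \<Longrightarrow> h (frag_of p) = f p"
proof -
  interpret comm_group G by fact
  have f: "f p \<in> carrier G" if "p \<in> S" for p using assms(2) that by auto
  have eq: "h c = (\<Otimes>\<^bsub>G\<^esub>p \<in> T. f p [^]\<^bsub>G\<^esub> Poly_Mapping.lookup c p)"
    if "finite T" "Poly_Mapping.keys c \<subseteq> T" "T \<subseteq> S" for c T
    unfolding h_def using that f
    by (intro finprod_mono_neutral_cong_left) (auto simp: in_keys_iff)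
  show "h \<in> hom (free_Abelian_group S) G"
  proof (rule homI)
    fix c assume "c \<in> carrier (free_Abelian_group S)"
    then show "h c \<in> carrier G"
      unfolding h_def using f by (intro finprod_closed) auto
  next
    fix c d
    assume c: "c \<in> carrier (free_Abelian_group S)" and d: "d \<in> carrier (free_Abelian_group S)"
    let ?T = "Poly_Mapping.keys c \<union> Poly_Mapping.keys d"
    have "h (c + d) = (\<Otimes>\<^bsub>G\<^esub>p \<in> ?T. f p [^]\<^bsub>G\<^esub> Poly_Mapping.lookup (c + d) p)"
      using c d keys_add[of c d] by (intro eq) auto
    also have "\<dots> = (\<Otimes>\<^bsub>G\<^esub>p \<in> ?T. f p [^]\<^bsub>G\<^esub> Poly_Mapping.lookup c p \<otimes>\<^bsub>G\<^esub> f p [^]\<^bsub>G\<^esub> Poly_Mapping.lookup d p)"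
      using c d f by (intro finprod_cong') (auto simp: lookup_add int_pow_mult subset_iff)
    also have "\<dots> = h c \<otimes>\<^bsub>G\<^esub> h d"
      using c d f eq[of ?T c] eq[of ?T d] by (subst finprod_multf) (auto simp: subset_iff)
    finally show "h (c \<otimes>\<^bsub>free_Abelian_group S\<^esub> d) = h c \<otimes>\<^bsub>G\<^esub> h d" by simp
  qed
  show "h (frag_of p) = f p" if "p \<in> S" for p
    using f[OF that] by (simp add: h_def)
qed

context
  fixes R :: "('r, 'x) ring_scheme" and M :: "('r, 'm, 'y) module_scheme"
    and N :: "('r, 'n, 'z) module_scheme" and G :: "('g, 'w) monoid_scheme" and b
  assumes G: "comm_group G" and b: "balanced R M N G b"
    and M: "abelian_group M" and N: "abelian_group N"
    and Mc: "\<And>r x. r \<in> carrier R \<Longrightarrow> x \<in> carrier M \<Longrightarrow> r \<odot>\<^bsub>M\<^esub> x \<in> carrier M"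
    and Nc: "\<And>r y. r \<in> carrier R \<Longrightarrow> y \<in> carrier N \<Longrightarrow> r \<odot>\<^bsub>N\<^esub> y \<in> carrier N"
begin

private abbreviation "F \<equiv> free_Abelian_group (carrier M \<times> carrier N)"

private definition "ev c =
  (\<Otimes>\<^bsub>G\<^esub>p \<in> Poly_Mapping.keys c. case_prod b p [^]\<^bsub>G\<^esub> Poly_Mapping.lookup c p)"

private lemma b_closed: "case_prod b \<in> carrier M \<times> carrier N \<rightarrow> carrier G"
  using b by (auto simp: balanced_def)

private lemma ev_hom: "group_hom F G ev"
  using free_eval(1)[OF G b_closed] G
  by (simp add: group_hom_def group_hom_axioms_def ev_def[abs_def] comm_group.axioms)

private lemma ev_frag_of: "x \<in> carrier M \<Longrightarrow> y \<in> carrier N \<Longrightarrow> ev (frag_of (x, y)) = b x y"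
  using free_eval(2)[OF G b_closed, of "(x, y)"] by (simp add: ev_def)

private lemma ev_diff:
  assumes "c \<in> carrier F" "d \<in> carrier F"
  shows "ev (c - d) = ev c \<otimes>\<^bsub>G\<^esub> inv\<^bsub>G\<^esub> ev d"
proof -
  interpret group_hom F G ev by (rule ev_hom)
  have "ev (c \<otimes>\<^bsub>F\<^esub> inv\<^bsub>F\<^esub> d) = ev c \<otimes>\<^bsub>G\<^esub> inv\<^bsub>G\<^esub> ev d"
    using assms by (metis G.inv_closed hom_inv hom_mult)
  then show ?thesis using assms by simp
qed

private lemma relations_carrier: "tensor_relations R M N \<subseteq> carrier F"
proof -
  interpret M: abelian_group M by (rule M)
  interpret N: abelian_group N by (rule N)
  have diff: "c - d \<in> carrier F" if "c \<in> carrier F" "d \<in> carrier F" for c d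
    using that keys_diff[of c d] by auto
  show ?thesis unfolding tensor_relations_def
    by (intro Un_least subsetI; clarify; intro diff) (simp_all add: Mc Nc)
qed

private lemma null_subgroup: "subgroup (tensor_null R M N) F"
  unfolding tensor_null_def using relations_carrier
  by (intro group.generate_is_subgroup) auto

private lemma ev_null:
  assumes "c \<in> tensor_null R M N" shows "ev c = \<one>\<^bsub>G\<^esub>"
proof -
  interpret group_hom F G ev by (rule ev_hom)
  interpret C: comm_group G by (rule G)
  interpret M: abelian_group M by (rule M)
  interpret N: abelian_group N by (rule N)
  have cl: "b x y \<in> carrier G" if "x \<in> carrier M" "y \<in> carrier N" for x y
    using b that by (auto simp: balanced_def)
  have diff: "c - d \<in> carrier F" if "c \<in> carrier F" "d \<in> carrier F" for c d
    using that keys_diff[of c d] by auto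
  have cancel: "u \<otimes>\<^bsub>G\<^esub> v \<otimes>\<^bsub>G\<^esub> inv\<^bsub>G\<^esub> u \<otimes>\<^bsub>G\<^esub> inv\<^bsub>G\<^esub> v = \<one>\<^bsub>G\<^esub>"
    if "u \<in> carrier G" "v \<in> carrier G" for u v
    using that by (simp add: C.m_comm[of u v] H.m_assoc)
  have rel: "ev c = \<one>\<^bsub>G\<^esub>" if "c \<in> tensor_relations R M N" for c
    using that unfolding tensor_relations_def
  proof (elim UnE CollectE exE conjE)
    fix x x' y assume "c = frag_of (x \<oplus>\<^bsub>M\<^esub> x', y) - frag_of (x, y) - frag_of (x', y)"
      and *: "x \<in> carrier M" "x' \<in> carrier M" "y \<in> carrier N"
    then show ?thesis using cancel[OF cl[of x y] cl[of x' y]] b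
      by (simp add: ev_diff diff ev_frag_of balanced_def del: carrier_free_Abelian_group_iff)
  next
    fix x y y' assume "c = frag_of (x, y \<oplus>\<^bsub>N\<^esub> y') - frag_of (x, y) - frag_of (x, y')"
      and *: "x \<in> carrier M" "y \<in> carrier N" "y' \<in> carrier N"
    then show ?thesis using cancel[OF cl[of x y] cl[of x y']] b
      by (simp add: ev_diff diff ev_frag_of balanced_def del: carrier_free_Abelian_group_iff)
  next
    fix r x y assume "c = frag_of (r \<odot>\<^bsub>M\<^esub> x, y) - frag_of (x, r \<odot>\<^bsub>N\<^esub> y)"
      and *: "r \<in> carrier R" "x \<in> carrier M" "y \<in> carrier N"
    then show ?thesis using cl[of x "r \<odot>\<^bsub>N\<^esub> y"] b
      by (simp add: ev_diff ev_frag_of balanced_def Mc Nc)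
  qed
  have "tensor_relations R M N \<subseteq> kernel F G ev"
    using rel relations_carrier
    by (auto simp: kernel_def simp del: carrier_free_Abelian_group_iff)
  then have "tensor_null R M N \<subseteq> kernel F G ev"
    unfolding tensor_null_def
    by (rule group.generate_subgroup_incl[OF group_free_Abelian_group _ subgroup_kernel])
  then show ?thesis using assms by (auto simp: kernel_def)
qed

private lemma lift_coset:
  assumes "c \<in> carrier F"
  shows "tensor_lift G b (tensor_null R M N #>\<^bsub>F\<^esub> c) = ev c"
proof -
  interpret group_hom F G ev by (rule ev_hom)
  let ?t = "tensor_null R M N #>\<^bsub>F\<^esub> c"
  have "c \<in> ?t"
    by (rule group.rcos_self[OF group_free_Abelian_group assms null_subgroup])
  then have "(SOME d. d \<in> ?t) \<in> ?t" by (rule someI)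
  then obtain n where n: "n \<in> tensor_null R M N" "(SOME d. d \<in> ?t) = n \<otimes>\<^bsub>F\<^esub> c"
    unfolding r_coset_def by blast
  have "n \<in> carrier F" using subgroup.mem_carrier[OF null_subgroup n(1)] .
  then have "ev (SOME d. d \<in> ?t) = ev c"
    unfolding n(2) using hom_mult[OF _ assms] ev_null[OF n(1)] H.l_one[OF hom_closed[OF assms]]
    by simp
  then show ?thesis by (simp add: tensor_lift_def Let_def ev_def)
qed

lemma tensor_lift_pure:
  assumes "x \<in> carrier M" "y \<in> carrier N"
  shows "tensor_lift G b (pure_tensor R M N x y) = b x y"
  using assms by (simp add: pure_tensor_def lift_coset ev_frag_of)

lemma tensor_lift_hom: "tensor_lift G b \<in> hom (tensor R M N) G"
proof -
  interpret group_hom F G ev by (rule ev_hom)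
  have norm: "tensor_null R M N \<lhd> F"
    by (rule comm_group.normal_iff_subgroup[THEN iffD2, OF abelian_free_Abelian_group null_subgroup])
  show ?thesis
  proof (rule homI)
    fix s t assume "s \<in> carrier (tensor R M N)" "t \<in> carrier (tensor R M N)"
    then obtain c d where c: "c \<in> carrier F" "s = tensor_null R M N #>\<^bsub>F\<^esub> c"
      and d: "d \<in> carrier F" "t = tensor_null R M N #>\<^bsub>F\<^esub> d"
      by (auto simp: tensor_def carrier_FactGroup simp del: carrier_free_Abelian_group_iff)
    have "s \<otimes>\<^bsub>tensor R M N\<^esub> t = tensor_null R M N #>\<^bsub>F\<^esub> (c \<otimes>\<^bsub>F\<^esub> d)"
      using c d normal.rcos_sum[OF norm] by (simp add: tensor_def del: mult_free_Abelian_group)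
    then show "tensor_lift G b (s \<otimes>\<^bsub>tensor R M N\<^esub> t) = tensor_lift G b s \<otimes>\<^bsub>G\<^esub> tensor_lift G b t"
      using c(1) d(1) G.m_closed[OF c(1) d(1)] hom_mult[OF c(1) d(1)]
      unfolding c(2) d(2) by (simp only: lift_coset)
  qed (auto simp: tensor_def carrier_FactGroup lift_coset simp del: carrier_free_Abelian_group_iff)
qed

end

text \<open>The map \<open>f \<otimes> g : M \<otimes>\<^sub>R N \<rightarrow> M' \<otimes>\<^sub>R N'\<close>.\<close>

definition tensor_map ::
    "('r, 'x) ring_scheme \<Rightarrow> ('r, 'm, 'y) module_scheme \<Rightarrow> ('r, 'n, 'z) module_scheme
      \<Rightarrow> ('a \<Rightarrow> 'm) \<Rightarrow> ('b \<Rightarrow> 'n) \<Rightarrow> ('a \<times> 'b \<Rightarrow>\<^sub>0 int) set \<Rightarrow> ('m \<times> 'n \<Rightarrow>\<^sub>0 int) set"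
  where "tensor_map R M' N' f g =
    tensor_lift (tensor R M' N') (\<lambda>x y. pure_tensor R M' N' (f x) (g y))"

text \<open>The tensor product of two algebras over a commutative ring \<open>k\<close>.\<close>

definition tensor_algebra ::
    "('k, 'x) ring_scheme \<Rightarrow> ('k, 'a, 'y) module_scheme \<Rightarrow> ('k, 'b, 'z) module_scheme
      \<Rightarrow> ('k, ('a \<times> 'b \<Rightarrow>\<^sub>0 int) set) module"
  where "tensor_algebra k A B =
    \<lparr> carrier = carrier (tensor k A B),
      monoid.mult = (\<lambda>t u. tensor_lift (tensor k A B) (\<lambda>a b. tensor_lift (tensor k A B)
        (\<lambda>a' b'. pure_tensor k A B (a \<otimes>\<^bsub>A\<^esub> a') (b \<otimes>\<^bsub>B\<^esub> b')) u) t),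
      monoid.one = pure_tensor k A B \<one>\<^bsub>A\<^esub> \<one>\<^bsub>B\<^esub>,
      ring.zero = \<one>\<^bsub>tensor k A B\<^esub>,
      ring.add = monoid.mult (tensor k A B),
      smult = (\<lambda>c. tensor_lift (tensor k A B) (\<lambda>a b. pure_tensor k A B (c \<odot>\<^bsub>A\<^esub> a) b)) \<rparr>"


section \<open>Faithful flatness\<close>

definition exact_at ::
    "('a, 'x) monoid_scheme \<Rightarrow> ('a \<Rightarrow> 'b) \<Rightarrow> ('b, 'y) monoid_scheme \<Rightarrow> ('b \<Rightarrow> 'c)
      \<Rightarrow> ('c, 'z) monoid_scheme \<Rightarrow> bool"
  where "exact_at A f B g C \<longleftrightarrow> f ` carrier A = kernel B C g"

text \<open>
  \<open>M\<close> is faithfully flat if a sequence \<open>N\<^sub>1 \<rightarrow> N\<^sub>2 \<rightarrow> N\<^sub>3\<close> is exact precisely when its tensor product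
  with \<open>M\<close> is. HOL cannot quantify over modules on all types, so the type \<open>'t\<close> carrying the test
  modules is a parameter. If \<open>'t\<close> has room for all one-sided ideals of \<open>R\<close> and all cyclic
  \<open>R\<close>-modules, for instance if \<open>'t = 'r set\<close> (singletons, cosets), the notion is the usual one:
  flatness needs only the inclusions \<open>I \<rightarrow> R\<close> of one-sided ideals, faithfulness only the modules
  \<open>R / I\<close>.
\<close>

definition faithfully_flat_right ::
    "'t itself \<Rightarrow> ('r, 'x) ring_scheme \<Rightarrow> ('r, 'm, 'y) module_scheme \<Rightarrow> bool"
  where "faithfully_flat_right _ R M \<longleftrightarrow> right_module R M \<and>
    (\<forall>(N1 :: ('r, 't) module) (N2 :: ('r, 't) module) (N3 :: ('r, 't) module) f g.
      left_module R N1 \<and> left_module R N2 \<and> left_module R N3 \<and>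
      f \<in> module_hom R N1 N2 \<and> g \<in> module_hom R N2 N3 \<longrightarrow>
      (exact_at (add_monoid N1) f (add_monoid N2) g (add_monoid N3) \<longleftrightarrow>
       exact_at (tensor R M N1) (tensor_map R M N2 id f) (tensor R M N2)
         (tensor_map R M N3 id g) (tensor R M N3)))"

definition faithfully_flat_left ::
    "'t itself \<Rightarrow> ('r, 'x) ring_scheme \<Rightarrow> ('r, 'm, 'y) module_scheme \<Rightarrow> bool"
  where "faithfully_flat_left _ R M \<longleftrightarrow> left_module R M \<and>
    (\<forall>(N1 :: ('r, 't) module) (N2 :: ('r, 't) module) (N3 :: ('r, 't) module) f g.
      right_module R N1 \<and> right_module R N2 \<and> right_module R N3 \<and>
      f \<in> module_hom R N1 N2 \<and> g \<in> module_hom R N2 N3 \<longrightarrow>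
      (exact_at (add_monoid N1) f (add_monoid N2) g (add_monoid N3) \<longleftrightarrow>
       exact_at (tensor R N1 M) (tensor_map R N2 M f id) (tensor R N2 M)
         (tensor_map R N3 M g id) (tensor R N3 M)))"

text \<open>A set \<open>A\<close> of ring elements as a left or right module over a subring of \<open>H\<close>.\<close>

definition left_regular :: "('h, 'x) ring_scheme \<Rightarrow> 'h set \<Rightarrow> ('h, 'h) module"
  where "left_regular H A =
    \<lparr> carrier = A, monoid.mult = monoid.mult H, monoid.one = monoid.one H, ring.zero = ring.zero H, ring.add = ring.add H,
      smult = (\<lambda>r x. r \<otimes>\<^bsub>H\<^esub> x) \<rparr>"

definition right_regular :: "('h, 'x) ring_scheme \<Rightarrow> 'h set \<Rightarrow> ('h, 'h) module"
  where "right_regular H A =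
    \<lparr> carrier = A, monoid.mult = monoid.mult H, monoid.one = monoid.one H, ring.zero = ring.zero H, ring.add = ring.add H,
      smult = (\<lambda>r x. x \<otimes>\<^bsub>H\<^esub> r) \<rparr>"


section \<open>Noetherian conditions\<close>

definition left_ideal :: "'h set \<Rightarrow> ('h, 'x) ring_scheme \<Rightarrow> bool"
  where "left_ideal I R \<longleftrightarrow> additive_subgroup I R \<and> (\<forall>r \<in> carrier R. \<forall>x \<in> I. r \<otimes>\<^bsub>R\<^esub> x \<in> I)"

definition right_ideal :: "'h set \<Rightarrow> ('h, 'x) ring_scheme \<Rightarrow> bool"
  where "right_ideal I R \<longleftrightarrow> additive_subgroup I R \<and> (\<forall>r \<in> carrier R. \<forall>x \<in> I. x \<otimes>\<^bsub>R\<^esub> r \<in> I)"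

definition left_noetherian :: "('h, 'x) ring_scheme \<Rightarrow> bool"
  where "left_noetherian R \<longleftrightarrow>
    (\<forall>I :: nat \<Rightarrow> 'h set. (\<forall>n. left_ideal (I n) R \<and> I n \<subseteq> I (Suc n)) \<longrightarrow> (\<exists>n. \<forall>m\<ge>n. I m = I n))"

definition right_noetherian :: "('h, 'x) ring_scheme \<Rightarrow> bool"
  where "right_noetherian R \<longleftrightarrow>
    (\<forall>I :: nat \<Rightarrow> 'h set. (\<forall>n. right_ideal (I n) R \<and> I n \<subseteq> I (Suc n)) \<longrightarrow> (\<exists>n. \<forall>m\<ge>n. I m = I n))"


section \<open>Hopf algebras\<close>

record ('k, 'h) hopf_algebra = "('k, 'h) module" +
  comult :: "'h \<Rightarrow> ('h \<times> 'h \<Rightarrow>\<^sub>0 int) set"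
  counit :: "'h \<Rightarrow> 'k"
  antipode :: "'h \<Rightarrow> 'h"

text \<open>
  Coassociativity is stated in \<open>H \<otimes> (H \<otimes> H)\<close>: with \<open>\<Delta> x = \<Sum> a \<otimes> b\<close> and \<open>\<Delta> a = \<Sum> c \<otimes> d\<close> it reads
  \<open>\<Sum> c \<otimes> (d \<otimes> b) = \<Sum> a \<otimes> \<Delta> b\<close>.
\<close>

locale hopf_algebra = k: field k + H: ring H + module k H
  for k :: "('k, 'x) ring_scheme" (structure)
    and H :: "('k, 'h, 'y) hopf_algebra_scheme" (structure) +
  assumes smult_mult_left: "\<lbrakk>c \<in> carrier k; x \<in> carrier H; y \<in> carrier H\<rbrakk> \<Longrightarrow>
      (c \<odot>\<^bsub>H\<^esub> x) \<otimes>\<^bsub>H\<^esub> y = c \<odot>\<^bsub>H\<^esub> (x \<otimes>\<^bsub>H\<^esub> y)"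
    and smult_mult_right: "\<lbrakk>c \<in> carrier k; x \<in> carrier H; y \<in> carrier H\<rbrakk> \<Longrightarrow>
      x \<otimes>\<^bsub>H\<^esub> (c \<odot>\<^bsub>H\<^esub> y) = c \<odot>\<^bsub>H\<^esub> (x \<otimes>\<^bsub>H\<^esub> y)"
    and comult_hom: "comult H \<in> ring_hom H (tensor_algebra k H H)"
    and comult_smult: "\<lbrakk>c \<in> carrier k; x \<in> carrier H\<rbrakk> \<Longrightarrow>
      comult H (c \<odot>\<^bsub>H\<^esub> x) = c \<odot>\<^bsub>tensor_algebra k H H\<^esub> comult H x"
    and counit_hom: "counit H \<in> ring_hom H k"
    and counit_smult: "\<lbrakk>c \<in> carrier k; x \<in> carrier H\<rbrakk> \<Longrightarrow>
      counit H (c \<odot>\<^bsub>H\<^esub> x) = c \<otimes>\<^bsub>k\<^esub> counit H x"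
    and antipode_hom: "antipode H \<in> module_hom k H H"
    and coassoc: "x \<in> carrier H \<Longrightarrow>
      tensor_lift (tensor k H (tensor_algebra k H H))
        (\<lambda>a b. tensor_lift (tensor k H (tensor_algebra k H H))
          (\<lambda>c d. pure_tensor k H (tensor_algebra k H H) c (pure_tensor k H H d b)) (comult H a))
        (comult H x)
      = tensor_map k H (tensor_algebra k H H) id (comult H) (comult H x)"
    and counit_left: "x \<in> carrier H \<Longrightarrow>
      tensor_lift (add_monoid H) (\<lambda>a b. counit H a \<odot>\<^bsub>H\<^esub> b) (comult H x) = x"
    and counit_right: "x \<in> carrier H \<Longrightarrow>
      tensor_lift (add_monoid H) (\<lambda>a b. counit H b \<odot>\<^bsub>H\<^esub> a) (comult H x) = x"
    and antipode_left: "x \<in> carrier H \<Longrightarrow>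
      tensor_lift (add_monoid H) (\<lambda>a b. antipode H a \<otimes>\<^bsub>H\<^esub> b) (comult H x) = counit H x \<odot>\<^bsub>H\<^esub> \<one>\<^bsub>H\<^esub>"
    and antipode_right: "x \<in> carrier H \<Longrightarrow>
      tensor_lift (add_monoid H) (\<lambda>a b. a \<otimes>\<^bsub>H\<^esub> antipode H b) (comult H x) = counit H x \<odot>\<^bsub>H\<^esub> \<one>\<^bsub>H\<^esub>"

text \<open>
  The image of \<open>C \<otimes> D\<close> in \<open>H \<otimes> H\<close>. Over a field this is a copy of \<open>C \<otimes> D\<close> whenever \<open>C\<close> and \<open>D\<close> are
  subspaces.
\<close>

definition tensor_span ::
    "('k, 'x) ring_scheme \<Rightarrow> ('k, 'h, 'y) module_scheme \<Rightarrow> 'h set \<Rightarrow> 'h set \<Rightarrow> ('h \<times> 'h \<Rightarrow>\<^sub>0 int) set set"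
  where "tensor_span k H C D =
    generate (tensor k H H) {pure_tensor k H H x y | x y. x \<in> C \<and> y \<in> D}"

definition subcoalgebra ::
    "('k, 'x) ring_scheme \<Rightarrow> ('k, 'h, 'y) hopf_algebra_scheme \<Rightarrow> 'h set \<Rightarrow> bool"
  where "subcoalgebra k H C \<longleftrightarrow>
    submodule C k H \<and> (\<forall>x \<in> C. comult H x \<in> tensor_span k H C C)"

definition simple_subcoalgebra ::
    "('k, 'x) ring_scheme \<Rightarrow> ('k, 'h, 'y) hopf_algebra_scheme \<Rightarrow> 'h set \<Rightarrow> bool"
  where "simple_subcoalgebra k H C \<longleftrightarrow>
    subcoalgebra k H C \<and> C \<noteq> {\<zero>\<^bsub>H\<^esub>} \<and>
    (\<forall>D. subcoalgebra k H D \<and> D \<subseteq> C \<longrightarrow> D = {\<zero>\<^bsub>H\<^esub>} \<or> D = C)"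

definition unital_subalgebra ::
    "('k, 'x) ring_scheme \<Rightarrow> ('k, 'h, 'y) module_scheme \<Rightarrow> 'h set \<Rightarrow> bool"
  where "unital_subalgebra k H B \<longleftrightarrow> subring B H \<and> submodule B k H"

definition generated_subalgebra ::
    "('k, 'x) ring_scheme \<Rightarrow> ('k, 'h, 'y) module_scheme \<Rightarrow> 'h set \<Rightarrow> 'h set"
  where "generated_subalgebra k H S = \<Inter>{B. unital_subalgebra k H B \<and> S \<subseteq> B}"

definition affine_subalgebra ::
    "('k, 'x) ring_scheme \<Rightarrow> ('k, 'h, 'y) module_scheme \<Rightarrow> 'h set \<Rightarrow> bool"
  where "affine_subalgebra k H B \<longleftrightarrow>
    unital_subalgebra k H B \<and> (\<exists>S. finite S \<and> S \<subseteq> B \<and> generated_subalgebra k H S = B)"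

definition hopf_subalgebra ::
    "('k, 'x) ring_scheme \<Rightarrow> ('k, 'h, 'y) hopf_algebra_scheme \<Rightarrow> 'h set \<Rightarrow> bool"
  where "hopf_subalgebra k H K \<longleftrightarrow>
    unital_subalgebra k H K \<and> subcoalgebra k H K \<and> antipode H ` K \<subseteq> K"

text \<open>The sum of a family of additive subgroups is the additive subgroup generated by its union.\<close>

definition coradical ::
    "('k, 'x) ring_scheme \<Rightarrow> ('k, 'h, 'y) hopf_algebra_scheme \<Rightarrow> 'h set"
  where "coradical k H = generate (add_monoid H) (\<Union>{C. simple_subcoalgebra k H C})"

definition hopf_coradical ::
    "('k, 'x) ring_scheme \<Rightarrow> ('k, 'h, 'y) hopf_algebra_scheme \<Rightarrow> 'h set"
  where "hopf_coradical k H = generated_subalgebra k H (coradical k H)"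

text \<open>
  For a Hopf subalgebra \<open>A\<close> of \<open>H\<close>, the Hopf subalgebras of \<open>A\<close> are the Hopf subalgebras of \<open>H\<close>
  contained in \<open>A\<close>.
\<close>

definition locally_affine ::
    "('k, 'x) ring_scheme \<Rightarrow> ('k, 'h, 'y) hopf_algebra_scheme \<Rightarrow> 'h set \<Rightarrow> bool"
  where "locally_affine k H A \<longleftrightarrow>
    (\<forall>F. finite F \<and> F \<subseteq> A \<longrightarrow>
      (\<exists>K. hopf_subalgebra k H K \<and> affine_subalgebra k H K \<and> F \<subseteq> K \<and> K \<subseteq> A))"

definition right_faithfully_flat_over_hopf_subalgebras ::
    "('k, 'x) ring_scheme \<Rightarrow> ('k, 'h, 'y) hopf_algebra_scheme \<Rightarrow> 'h set \<Rightarrow> bool"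
  where "right_faithfully_flat_over_hopf_subalgebras k H A \<longleftrightarrow>
    (\<forall>K. hopf_subalgebra k H K \<and> K \<subseteq> A \<longrightarrow>
      faithfully_flat_right TYPE('h set) (H\<lparr>carrier := K\<rparr>) (right_regular H A))"

definition left_faithfully_flat_over_hopf_subalgebras ::
    "('k, 'x) ring_scheme \<Rightarrow> ('k, 'h, 'y) hopf_algebra_scheme \<Rightarrow> 'h set \<Rightarrow> bool"
  where "left_faithfully_flat_over_hopf_subalgebras k H A \<longleftrightarrow>
    (\<forall>K. hopf_subalgebra k H K \<and> K \<subseteq> A \<longrightarrow>
      faithfully_flat_left TYPE('h set) (H\<lparr>carrier := K\<rparr>) (left_regular H A))"

end

theory Submission
  imports Defs
begin

text \<open>
  Let \<open>A\<close> be the Hopf coradical, a directed union of affine Hopf subalgebras, and assume that \<open>H\<close> is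
  left Noetherian. Filter \<open>H\<close> by the wedge powers of \<open>A\<close>. The factors are Hopf modules over \<open>A\<close>, hence
  free, so every step splits over \<open>A\<close> and \<open>H I \<inter> A = I\<close> for left ideals \<open>I\<close> of \<open>A\<close>. As \<open>H A\<^sup>+\<close> is
  finitely generated, it equals \<open>H K\<^sup>+\<close> for an affine Hopf subalgebra \<open>K\<close>, and so \<open>A\<^sup>+ = A K\<^sup>+\<close>.
  Then \<open>A \<otimes>\<^sub>K A \<cong> A / A K\<^sup>+ \<otimes> A = A\<close>, which makes \<open>K \<rightarrow> A\<close> an epimorphism of rings. A one-sided
  faithfully flat epimorphism is an isomorphism, so \<open>A = K\<close>.

  For the second claim, \<open>H H\<^sup>+ = H B\<^sup>+\<close> for some affine Hopf subalgebra \<open>B\<close> containing \<open>A\<close>. Freeness of the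
  factors of the filtration by the wedge powers of \<open>B\<close> forces \<open>B = H\<close>. The right Noetherian case is the
  left one for the algebra with opposite multiplication and comultiplication.
\<close>

section \<open>Tensor products over a ring\<close>

text \<open>The hypotheses leave a gap: the Noetherian condition concerns ideals of
  \<open>H\<close>, faithful flatness concerns \<open>A\<close> over its Hopf subalgebras, and
  neither describes \<open>H\<close> as an \<open>A\<close>-module. The wedge filtration bridges it.
  It exhausts \<open>H\<close> since \<open>A\<close> contains the coradical, and the splitting of
  its steps uses only the antipode of \<open>A\<close>. Tensors are classes in a quotient of a free
  abelian group, without coordinates. They are reached through balanced maps, which give Sweedler
  sums, and through functionals, which separate points over a field. A coaction becomes an action of
  the dual algebra, and membership of a coproduct in \<open>C \<otimes> D\<close> is read off from
  slices. That \<open>A\<close> is a Hopf subalgebra comes from local affineness: each of its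
  elements lies in a Hopf subalgebra inside \<open>A\<close>. An epimorphism
  \<open>K \<rightarrow> A\<close> kills both \<open>A \<otimes>\<^sub>K A / K\<close> and
  \<open>A / K \<otimes>\<^sub>K A\<close>, so the side of flatness is independent of the side of
  the Noetherian condition.\<close>

locale tensor_factors =
  fixes R :: "('r, 'x) ring_scheme" and M :: "('r, 'm, 'y) module_scheme"
    and N :: "('r, 'n, 'z) module_scheme"
  assumes M: "abelian_group M" and N: "abelian_group N"
    and Mc: "\<And>r x. r \<in> carrier R \<Longrightarrow> x \<in> carrier M \<Longrightarrow> r \<odot>\<^bsub>M\<^esub> x \<in> carrier M"
    and Nc: "\<And>r y. r \<in> carrier R \<Longrightarrow> y \<in> carrier N \<Longrightarrow> r \<odot>\<^bsub>N\<^esub> y \<in> carrier N"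
begin

abbreviation "F \<equiv> free_Abelian_group (carrier M \<times> carrier N)"

lemma relations_carrier: "tensor_relations R M N \<subseteq> carrier F"
proof -
  interpret M: abelian_group M by (rule M)
  interpret N: abelian_group N by (rule N)
  have diff: "c - d \<in> carrier F" if "c \<in> carrier F" "d \<in> carrier F" for c d
    using that keys_diff[of c d] by auto
  show ?thesis unfolding tensor_relations_def
    by (intro Un_least subsetI; clarify; intro diff) (simp_all add: Mc Nc)
qed

lemma null_subgroup: "subgroup (tensor_null R M N) F"
  unfolding tensor_null_def using relations_carrier
  by (intro group.generate_is_subgroup) auto

lemma null_normal: "tensor_null R M N \<lhd> F"
  by (rule comm_group.normal_iff_subgroup[THEN iffD2, OF abelian_free_Abelian_group null_subgroup])

lemma tensor_comm_group: "comm_group (tensor R M N)"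
  unfolding tensor_def
  by (rule comm_group.abelian_FactGroup[OF abelian_free_Abelian_group null_subgroup])

definition "proj c = tensor_null R M N #>\<^bsub>F\<^esub> c"

lemma proj_hom: "group_hom F (tensor R M N) proj"
  unfolding group_hom_def group_hom_axioms_def proj_def[abs_def] tensor_def
  using normal.r_coset_hom_Mod[OF null_normal] normal.factorgroup_is_group[OF null_normal]
  by simp

lemma proj_relation:
  assumes "c \<in> tensor_relations R M N" shows "proj c = \<one>\<^bsub>tensor R M N\<^esub>"
proof -
  have "c \<in> tensor_null R M N" unfolding tensor_null_def by (rule generate.incl[OF assms])
  then have "proj c = tensor_null R M N"
    unfolding proj_def by (metis group.coset_join2 group_free_Abelian_group null_subgroup subgroup.mem_carrier)
  then show ?thesis by (simp add: tensor_def FactGroup_def)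
qed

lemma proj_frag_of: "proj (frag_of (x, y)) = pure_tensor R M N x y"
  by (simp add: proj_def pure_tensor_def)

lemma proj_diff:
  assumes "c \<in> carrier F" "d \<in> carrier F"
  shows "proj (c - d) = proj c \<otimes>\<^bsub>tensor R M N\<^esub> inv\<^bsub>tensor R M N\<^esub> proj d"
proof -
  interpret group_hom F "tensor R M N" proj by (rule proj_hom)
  have "proj (c \<otimes>\<^bsub>F\<^esub> inv\<^bsub>F\<^esub> d) = proj c \<otimes>\<^bsub>tensor R M N\<^esub> inv\<^bsub>tensor R M N\<^esub> proj d"
    using assms by (metis G.inv_closed hom_inv hom_mult)
  then show ?thesis using assms by simp
qed

lemma proj_cong:
  assumes "c - d \<in> tensor_relations R M N" "c \<in> carrier F" "d \<in> carrier F"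
  shows "proj c = proj d"
proof -
  interpret group_hom F "tensor R M N" proj by (rule proj_hom)
  have "proj c \<otimes>\<^bsub>tensor R M N\<^esub> inv\<^bsub>tensor R M N\<^esub> proj d = \<one>\<^bsub>tensor R M N\<^esub>"
    using proj_relation[OF assms(1)] proj_diff[OF assms(2,3)] by simp
  then show ?thesis using assms hom_closed
    by (metis H.inv_equality H.inv_closed H.inv_inv)
qed

lemma pure_closed [simp, intro]:
  assumes "x \<in> carrier M" "y \<in> carrier N"
  shows "pure_tensor R M N x y \<in> carrier (tensor R M N)"
proof -
  interpret group_hom F "tensor R M N" proj by (rule proj_hom)
  show ?thesis using hom_closed[of "frag_of (x, y)"] assms by (simp add: proj_frag_of)
qed

lemma pure_balanced: "balanced R M N (tensor R M N) (pure_tensor R M N)"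
proof -
  interpret group_hom F "tensor R M N" proj by (rule proj_hom)
  interpret M: abelian_group M by (rule M)
  interpret N: abelian_group N by (rule N)
  have sum: "proj (frag_of p) = proj (frag_of q) \<otimes>\<^bsub>tensor R M N\<^esub> proj (frag_of r)"
    if "frag_of p - frag_of q - frag_of r \<in> tensor_relations R M N"
      "p \<in> carrier M \<times> carrier N" "q \<in> carrier M \<times> carrier N" "r \<in> carrier M \<times> carrier N" for p q r
  proof -
    have *: "frag_of q + frag_of r \<in> carrier F"
      using that G.m_closed[of "frag_of q" "frag_of r"] by simp
    have "proj (frag_of p) = proj (frag_of q + frag_of r)"
      using that * by (intro proj_cong) (auto simp: diff_diff_eq)
    also have "\<dots> = proj (frag_of q) \<otimes>\<^bsub>tensor R M N\<^esub> proj (frag_of r)"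
      using hom_mult[of "frag_of q" "frag_of r"] that by simp
    finally show ?thesis .
  qed
  have "pure_tensor R M N (x \<oplus>\<^bsub>M\<^esub> x') y =
      pure_tensor R M N x y \<otimes>\<^bsub>tensor R M N\<^esub> pure_tensor R M N x' y"
    if "x \<in> carrier M" "x' \<in> carrier M" "y \<in> carrier N" for x x' y
    using that unfolding proj_frag_of[symmetric]
    by (intro sum) (auto simp: tensor_relations_def)
  moreover have "pure_tensor R M N x (y \<oplus>\<^bsub>N\<^esub> y') =
      pure_tensor R M N x y \<otimes>\<^bsub>tensor R M N\<^esub> pure_tensor R M N x y'"
    if "x \<in> carrier M" "y \<in> carrier N" "y' \<in> carrier N" for x y y'
    using that unfolding proj_frag_of[symmetric]
    by (intro sum) (auto simp: tensor_relations_def)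
  moreover have "pure_tensor R M N (r \<odot>\<^bsub>M\<^esub> x) y = pure_tensor R M N x (r \<odot>\<^bsub>N\<^esub> y)"
    if "r \<in> carrier R" "x \<in> carrier M" "y \<in> carrier N" for r x y
    using that unfolding proj_frag_of[symmetric]
    by (intro proj_cong) (auto simp: tensor_relations_def Mc Nc)
  ultimately show ?thesis by (auto simp: balanced_def)
qed

lemma tensor_generated:
  "carrier (tensor R M N) = generate (tensor R M N) {pure_tensor R M N x y | x y. x \<in> carrier M \<and> y \<in> carrier N}"
    (is "_ = generate ?T ?P")
proof
  interpret T: comm_group ?T by (rule tensor_comm_group)
  interpret group_hom F ?T proj by (rule proj_hom)
  have P: "?P \<subseteq> carrier ?T" by auto
  have sub: "subgroup (generate ?T ?P) ?T" by (rule T.generate_is_subgroup[OF P])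
  then show "generate ?T ?P \<subseteq> carrier ?T" by (rule subgroup.subset)
  show "carrier ?T \<subseteq> generate ?T ?P"
  proof
    fix t assume "t \<in> carrier ?T"
    then obtain c where c: "c \<in> carrier F" "t = proj c"
      by (auto simp: tensor_def carrier_FactGroup proj_def simp del: carrier_free_Abelian_group_iff)
    have "proj c \<in> generate ?T ?P \<and> Poly_Mapping.keys c \<subseteq> carrier M \<times> carrier N" using c(1)
      unfolding carrier_free_Abelian_group_iff
    proof (induction c rule: frag_induction)
      case zero
      then show ?case using hom_one generate.one by auto
    next
      case (one p)
      then show ?case by (cases p) (auto simp: proj_frag_of intro!: generate.incl)
    next
      case (diff a b)
      then show ?case using keys_diff[of a b]
        by (auto simp: proj_diff intro!: generate.eng T.generate_m_inv_closed[OF P])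
    qed
    then show "t \<in> generate ?T ?P" using c by simp
  qed
qed

lemma tensor_induct [consumes 1, case_names pure mult inv]:
  assumes "t \<in> carrier (tensor R M N)"
    and pure: "\<And>x y. x \<in> carrier M \<Longrightarrow> y \<in> carrier N \<Longrightarrow> P (pure_tensor R M N x y)"
    and mult: "\<And>s t. s \<in> carrier (tensor R M N) \<Longrightarrow> t \<in> carrier (tensor R M N) \<Longrightarrow> P s \<Longrightarrow> P t \<Longrightarrow>
      P (s \<otimes>\<^bsub>tensor R M N\<^esub> t)"
    and inv: "\<And>s. s \<in> carrier (tensor R M N) \<Longrightarrow> P s \<Longrightarrow> P (inv\<^bsub>tensor R M N\<^esub> s)"
  shows "P t"
proof -
  interpret T: comm_group "tensor R M N" by (rule tensor_comm_group)
  interpret M: abelian_group M by (rule M)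
  interpret N: abelian_group N by (rule N)
  let ?z = "pure_tensor R M N \<zero>\<^bsub>M\<^esub> \<zero>\<^bsub>N\<^esub>"
  \<comment> \<open>The rule has no case for the unit, which is a pure tensor multiplied by its
    inverse.\<close>
  have z: "P \<one>\<^bsub>tensor R M N\<^esub>"
    using mult[of ?z "inv\<^bsub>tensor R M N\<^esub> ?z"] pure[of "\<zero>\<^bsub>M\<^esub>" "\<zero>\<^bsub>N\<^esub>"] inv[of ?z] T.r_inv[of ?z]
    by auto
  have "t \<in> generate (tensor R M N) {pure_tensor R M N x y | x y. x \<in> carrier M \<and> y \<in> carrier N}"
    using assms(1) tensor_generated by blast
  then have "P t \<and> t \<in> carrier (tensor R M N)"
    by induction (auto intro: pure mult inv z)
  then show ?thesis by simp
qed

lemma tensor_hom_eq: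
  assumes G: "group G"
    and f: "f \<in> hom (tensor R M N) G" and g: "g \<in> hom (tensor R M N) G"
    and eq: "\<And>x y. x \<in> carrier M \<Longrightarrow> y \<in> carrier N \<Longrightarrow>
      f (pure_tensor R M N x y) = g (pure_tensor R M N x y)"
    and t: "t \<in> carrier (tensor R M N)"
  shows "f t = g t"
proof -
  interpret T: comm_group "tensor R M N" by (rule tensor_comm_group)
  interpret f: group_hom "tensor R M N" G f using f G T.is_group by (simp add: group_hom_def group_hom_axioms_def)
  interpret g: group_hom "tensor R M N" G g using g G T.is_group by (simp add: group_hom_def group_hom_axioms_def)
  show ?thesis using t by (induction t rule: tensor_induct) (auto simp: eq)
qed

lemma lift_pure:
  assumes "comm_group G" "balanced R M N G b" "x \<in> carrier M" "y \<in> carrier N"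
  shows "tensor_lift G b (pure_tensor R M N x y) = b x y"
  using assms by (intro tensor_lift_pure[where R = R]) (auto intro: M N Mc Nc)

lemma lift_hom:
  assumes "comm_group G" "balanced R M N G b"
  shows "tensor_lift G b \<in> hom (tensor R M N) G"
  using assms by (intro tensor_lift_hom) (auto intro: M N Mc Nc)

lemma lift_closed:
  assumes "comm_group G" "balanced R M N G b" "t \<in> carrier (tensor R M N)"
  shows "tensor_lift G b t \<in> carrier G"
  using lift_hom[OF assms(1,2)] assms(3) by (auto simp: hom_def)

text \<open>The uniqueness half of the universal property. It is the means of computing with
  \<open>tensor_lift\<close>, whose definition picks an unspecified representative.\<close>

lemma lift_unique:
  assumes G: "comm_group G" and b: "balanced R M N G b"
    and f: "f \<in> hom (tensor R M N) G"
    and eq: "\<And>x y. x \<in> carrier M \<Longrightarrow> y \<in> carrier N \<Longrightarrow> f (pure_tensor R M N x y) = b x y"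
    and t: "t \<in> carrier (tensor R M N)"
  shows "f t = tensor_lift G b t"
  by (rule tensor_hom_eq[OF comm_group.axioms(2)[OF G] f lift_hom[OF G b] _ t])
    (simp_all add: eq lift_pure[OF G b])

lemma lift_hom_comp:
  assumes G: "comm_group G" and G': "comm_group G'" and b: "balanced R M N G b"
    and f: "f \<in> hom G G'"
    and t: "t \<in> carrier (tensor R M N)"
  shows "f (tensor_lift G b t) = tensor_lift G' (\<lambda>x y. f (b x y)) t" "balanced R M N G' (\<lambda>x y. f (b x y))"
proof -
  interpret f: group_hom G G' f using f G G'
    by (simp add: group_hom_def group_hom_axioms_def comm_group.axioms)
  show b': "balanced R M N G' (\<lambda>x y. f (b x y))"
    using b by (auto simp: balanced_def)
  have "f \<circ> tensor_lift G b \<in> hom (tensor R M N) G'"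
    using lift_hom[OF G b] f by (rule hom_compose)
  then show "f (tensor_lift G b t) = tensor_lift G' (\<lambda>x y. f (b x y)) t"
    using lift_unique[OF G' b' _ _ t, of "f \<circ> tensor_lift G b"] lift_pure[OF G b] by simp
qed

lemma lift_cong:
  assumes G: "comm_group G" and b: "balanced R M N G b"
    and eq: "\<And>x y. x \<in> carrier M \<Longrightarrow> y \<in> carrier N \<Longrightarrow> b x y = b' x y"
    and t: "t \<in> carrier (tensor R M N)"
  shows "tensor_lift G b t = tensor_lift G b' t"
proof -
  interpret M: abelian_group M by (rule M)
  interpret N: abelian_group N by (rule N)
  have "balanced R M N G b'" using b by (auto simp: balanced_def eq[symmetric] Mc Nc)
  then show ?thesis
    by (rule lift_unique[OF G _ lift_hom[OF G b] _ t]) (use lift_pure[OF G b] eq in auto)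
qed

lemma lift_mult:
  assumes G: "comm_group G" and b: "balanced R M N G b" and b': "balanced R M N G b'"
    and t: "t \<in> carrier (tensor R M N)"
  shows "tensor_lift G (\<lambda>x y. b x y \<otimes>\<^bsub>G\<^esub> b' x y) t = tensor_lift G b t \<otimes>\<^bsub>G\<^esub> tensor_lift G b' t"
    and "balanced R M N G (\<lambda>x y. b x y \<otimes>\<^bsub>G\<^esub> b' x y)"
proof -
  interpret G: comm_group G by (rule G)
  interpret T: comm_group "tensor R M N" by (rule tensor_comm_group)
  show bb: "balanced R M N G (\<lambda>x y. b x y \<otimes>\<^bsub>G\<^esub> b' x y)"
    using b b' by (auto simp: balanced_def G.m_ac)
  have "(\<lambda>t. tensor_lift G b t \<otimes>\<^bsub>G\<^esub> tensor_lift G b' t) \<in> hom (tensor R M N) G"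
    using lift_hom[OF G b] lift_hom[OF G b'] by (auto simp: hom_def Pi_iff G.m_ac)
  from lift_unique[OF G bb this _ t]
  show "tensor_lift G (\<lambda>x y. b x y \<otimes>\<^bsub>G\<^esub> b' x y) t = tensor_lift G b t \<otimes>\<^bsub>G\<^esub> tensor_lift G b' t"
    by (simp add: lift_pure[OF G b] lift_pure[OF G b'])
qed

text \<open>The preimage of \<open>W\<close> under the lift is a subgroup, so the generators of the
  span suffice. Applied to a coproduct in \<open>C \<otimes> D\<close>, it bounds every Sweedler sum
  formed from that coproduct.\<close>

lemma lift_mem:
  assumes G: "comm_group G" and b: "balanced R M N G b"
    and W: "subgroup W G" and bW: "\<And>x y. x \<in> C \<Longrightarrow> y \<in> D \<Longrightarrow> b x y \<in> W"
    and C: "C \<subseteq> carrier M" and D: "D \<subseteq> carrier N"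
    and t: "t \<in> generate (tensor R M N) {pure_tensor R M N x y | x y. x \<in> C \<and> y \<in> D}"
  shows "tensor_lift G b t \<in> W"
proof -
  interpret G: comm_group G by (rule G)
  interpret T: comm_group "tensor R M N" by (rule tensor_comm_group)
  interpret l: group_hom "tensor R M N" G "tensor_lift G b"
    using lift_hom[OF G b] by (simp add: group_hom_def group_hom_axioms_def)
  interpret W: subgroup W G by (rule W)
  have "tensor_lift G b t \<in> W \<and> t \<in> carrier (tensor R M N)" using t
  proof induction
    case one
    then show ?case by simp
  next
    case (incl h)
    then show ?case using C D bW by (auto simp: lift_pure[OF G b] subset_iff)
  next
    case (inv h)
    then obtain x y where "x \<in> C" "y \<in> D" "h = pure_tensor R M N x y" by blast
    then show ?case using C D bW[of x y] by (auto simp: lift_pure[OF G b] subset_iff)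
  next
    case (eng h1 h2)
    then show ?case by auto
  qed
  then show ?thesis by simp
qed

text \<open>Pure tensors generate, so the group is trivial and every sequence of homomorphisms
  through it is exact. Faithful flatness is later tested on such a sequence.\<close>

lemma trivial_tensor_exact:
  assumes triv: "\<And>x y. x \<in> carrier M \<Longrightarrow> y \<in> carrier N \<Longrightarrow> pure_tensor R M N x y = \<one>\<^bsub>tensor R M N\<^esub>"
    and f: "\<And>x. x \<in> carrier M \<Longrightarrow> f x \<in> carrier M" and g: "\<And>y. y \<in> carrier N \<Longrightarrow> g y \<in> carrier N"
  shows "exact_at (tensor R M N) (tensor_map R M N f g) (tensor R M N) (tensor_map R M N f g) (tensor R M N)"
proof -
  let ?T = "tensor R M N"
  interpret T: comm_group ?T by (rule tensor_comm_group)
  have "{pure_tensor R M N x y | x y. x \<in> carrier M \<and> y \<in> carrier N} \<subseteq> {\<one>\<^bsub>?T\<^esub>}" using triv by auto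
  then have "generate ?T {pure_tensor R M N x y | x y. x \<in> carrier M \<and> y \<in> carrier N} \<subseteq> {\<one>\<^bsub>?T\<^esub>}"
    by (rule T.generate_subgroup_incl[OF _ T.triv_subgroup])
  then have carr: "carrier ?T = {\<one>\<^bsub>?T\<^esub>}" using tensor_generated by auto
  interpret M: abelian_group M by (rule M)
  interpret N: abelian_group N by (rule N)
  have "balanced R M N ?T (\<lambda>x y. pure_tensor R M N (f x) (g y))"
    using f g triv by (simp add: balanced_def Mc Nc)
  then have "tensor_map R M N f g \<one>\<^bsub>?T\<^esub> = \<one>\<^bsub>?T\<^esub>"
    unfolding tensor_map_def using lift_closed[OF tensor_comm_group _ T.one_closed] carr by auto
  then show ?thesis by (auto simp: exact_at_def kernel_def carr)
qed

end

section \<open>Linear algebra over a field\<close>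

context abelian_group
begin

lemma diff_zero [simp]: "x \<in> carrier G \<Longrightarrow> x \<ominus> \<zero> = x"
  by (simp add: a_minus_def)

lemma diff_self [simp]: "x \<in> carrier G \<Longrightarrow> x \<ominus> x = \<zero>"
  by (simp add: a_minus_def r_neg)

lemma diff_add_cancel [simp]: "x \<in> carrier G \<Longrightarrow> y \<in> carrier G \<Longrightarrow> x \<ominus> y \<oplus> y = x"
  by (simp add: a_minus_def a_assoc l_neg)

lemma diff_eq_zero_iff: "x \<in> carrier G \<Longrightarrow> y \<in> carrier G \<Longrightarrow> x \<ominus> y = \<zero> \<longleftrightarrow> x = y"
  by (metis diff_add_cancel diff_self l_zero)

lemma diff_diff_same: "x \<in> carrier G \<Longrightarrow> y \<in> carrier G \<Longrightarrow> z \<in> carrier G \<Longrightarrow> (x \<ominus> y) \<ominus> (x \<ominus> z) = z \<ominus> y"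
  using a_lcomm[of x "\<ominus> y" "\<ominus> x \<oplus> z"] by (simp add: a_minus_def minus_add minus_minus a_assoc r_neg2 a_comm[of z])

end

locale linear_space = k: field k + module k V
  for V :: "('k, 'v, 'y) module_scheme" (structure) and k :: "('k, 'x) ring_scheme"
begin

definition linear :: "('v \<Rightarrow> 'v) \<Rightarrow> bool"
  where "linear f \<longleftrightarrow> f \<in> carrier V \<rightarrow> carrier V \<and>
    (\<forall>x \<in> carrier V. \<forall>y \<in> carrier V. f (x \<oplus> y) = f x \<oplus> f y) \<and>
    (\<forall>c \<in> carrier k. \<forall>x \<in> carrier V. f (c \<odot> x) = c \<odot> f x)"

definition dual :: "('v \<Rightarrow> 'k) set"
  where "dual = {f \<in> carrier V \<rightarrow> carrier k.
    (\<forall>x \<in> carrier V. \<forall>y \<in> carrier V. f (x \<oplus> y) = f x \<oplus>\<^bsub>k\<^esub> f y) \<and>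
    (\<forall>c \<in> carrier k. \<forall>x \<in> carrier V. f (c \<odot> x) = c \<otimes>\<^bsub>k\<^esub> f x)}"

lemma linear_closed [simp]: "linear f \<Longrightarrow> x \<in> carrier V \<Longrightarrow> f x \<in> carrier V"
  and linear_add: "linear f \<Longrightarrow> x \<in> carrier V \<Longrightarrow> y \<in> carrier V \<Longrightarrow> f (x \<oplus> y) = f x \<oplus> f y"
  and linear_smult: "linear f \<Longrightarrow> c \<in> carrier k \<Longrightarrow> x \<in> carrier V \<Longrightarrow> f (c \<odot> x) = c \<odot> f x"
  by (auto simp: linear_def)

lemma dual_closed [simp]: "f \<in> dual \<Longrightarrow> x \<in> carrier V \<Longrightarrow> f x \<in> carrier k"
  and dual_add: "f \<in> dual \<Longrightarrow> x \<in> carrier V \<Longrightarrow> y \<in> carrier V \<Longrightarrow> f (x \<oplus> y) = f x \<oplus>\<^bsub>k\<^esub> f y"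
  and dual_smult: "f \<in> dual \<Longrightarrow> c \<in> carrier k \<Longrightarrow> x \<in> carrier V \<Longrightarrow> f (c \<odot> x) = c \<otimes>\<^bsub>k\<^esub> f x"
  by (auto simp: dual_def)

lemma linear_zero [simp]: assumes "linear f" shows "f \<zero> = \<zero>"
  using linear_smult[OF assms, of "\<zero>\<^bsub>k\<^esub>" "\<zero>"] assms by simp

lemma linear_minus:
  assumes "linear f" "x \<in> carrier V" "y \<in> carrier V"
  shows "f (x \<ominus> y) = f x \<ominus> f y"
proof -
  have neg: "\<ominus> z = (\<ominus>\<^bsub>k\<^esub> \<one>\<^bsub>k\<^esub>) \<odot> z" if "z \<in> carrier V" for z
    using that by (simp add: smult_l_minus)
  show ?thesis using assms by (simp add: a_minus_def linear_add neg linear_smult)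
qed

lemma dual_zero [simp]: assumes "f \<in> dual" shows "f \<zero> = \<zero>\<^bsub>k\<^esub>"
  using dual_smult[OF assms, of "\<zero>\<^bsub>k\<^esub>" "\<zero>"] assms by simp

lemma dual_minus:
  assumes "f \<in> dual" "x \<in> carrier V" "y \<in> carrier V"
  shows "f (x \<ominus> y) = f x \<ominus>\<^bsub>k\<^esub> f y"
proof -
  have neg: "\<ominus> z = (\<ominus>\<^bsub>k\<^esub> \<one>\<^bsub>k\<^esub>) \<odot> z" if "z \<in> carrier V" for z
    using that by (simp add: smult_l_minus)
  show ?thesis using assms by (simp add: a_minus_def dual_add neg dual_smult k.l_minus)
qed

lemma submodule_closed:
  assumes "submodule W k V"
  shows "\<zero> \<in> W" "x \<in> W \<Longrightarrow> x \<in> carrier V" "x \<in> W \<Longrightarrow> y \<in> W \<Longrightarrow> x \<oplus> y \<in> W"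
    "x \<in> W \<Longrightarrow> y \<in> W \<Longrightarrow> x \<ominus> y \<in> W" "x \<in> W \<Longrightarrow> \<ominus> x \<in> W"
    "c \<in> carrier k \<Longrightarrow> x \<in> W \<Longrightarrow> c \<odot> x \<in> W"
  using submoduleE[OF assms] subgroup.one_closed[OF submodule.axioms(1)[OF assms]]
  by (auto simp: a_minus_def)

lemma submoduleI':
  assumes "W \<subseteq> carrier V" "\<zero> \<in> W" "\<And>x y. x \<in> W \<Longrightarrow> y \<in> W \<Longrightarrow> x \<oplus> y \<in> W"
    "\<And>c x. c \<in> carrier k \<Longrightarrow> x \<in> W \<Longrightarrow> c \<odot> x \<in> W"
  shows "submodule W k V"
proof (rule submoduleI)
  fix a assume a: "a \<in> W"
  then have "(\<ominus>\<^bsub>k\<^esub> \<one>\<^bsub>k\<^esub>) \<odot> a \<in> W" using assms by simp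
  then show "\<ominus> a \<in> W" using a assms(1) by (auto simp: smult_l_minus subset_iff)
qed (use assms in auto)

lemma submodule_zero: "submodule {\<zero>} k V"
  by (rule submoduleI') auto

lemma submodule_Int: "submodule U k V \<Longrightarrow> submodule W k V \<Longrightarrow> submodule (U \<inter> W) k V"
  by (rule submoduleI') (auto intro: submodule_closed)

lemma submodule_image:
  assumes "linear f" "submodule W k V" shows "submodule (f ` W) k V"
proof (rule submoduleI')
  note cl = submodule_closed[OF assms(2)]
  show "f ` W \<subseteq> carrier V" using assms cl(2) by auto
  show "\<zero> \<in> f ` W" using linear_zero[OF assms(1)] cl(1) by (metis imageI)
  show "x \<oplus> y \<in> f ` W" if "x \<in> f ` W" "y \<in> f ` W" for x y
    using that cl(2,3) linear_add[OF assms(1), symmetric] by auto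
  show "c \<odot> x \<in> f ` W" if "c \<in> carrier k" "x \<in> f ` W" for c x
    using that cl(2,6) linear_smult[OF assms(1), symmetric] by auto
qed

lemma submodule_vimage:
  assumes "linear f" "submodule U k V" "submodule W k V" shows "submodule {v \<in> U. f v \<in> W} k V"
  using submodule_closed[OF assms(2)] submodule_closed[OF assms(3)] assms(1)
  by (intro submoduleI') (auto simp: linear_add linear_smult)

lemma submodule_Union_chain:
  assumes "C \<noteq> {}" "subset.chain A C" "\<And>W. W \<in> C \<Longrightarrow> submodule W k V"
  shows "submodule (\<Union>C) k V"
proof (rule submoduleI')
  show "\<Union>C \<subseteq> carrier V" using assms(3) submodule_closed(2) by blast
  show "\<zero> \<in> \<Union>C" using assms(1,3) submodule_closed(1) by blast
  show "x \<oplus> y \<in> \<Union>C" if xy: "x \<in> \<Union>C" "y \<in> \<Union>C" for x y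
  proof -
    obtain B Y where XY: "B \<in> C" "Y \<in> C" "x \<in> B" "y \<in> Y" using xy by blast
    then have "B \<subseteq> Y \<or> Y \<subseteq> B" using assms(2) by (auto simp: subset_chain_def)
    then show ?thesis using XY assms(3) submodule_closed(3) by blast
  qed
  show "c \<odot> x \<in> \<Union>C" if "c \<in> carrier k" "x \<in> \<Union>C" for c x
    using that assms(3) submodule_closed(6) by blast
qed

lemma submodule_insert:
  assumes W: "submodule W k V" and v: "v \<in> carrier V"
  shows "submodule {c \<odot> v \<oplus> w | c w. c \<in> carrier k \<and> w \<in> W} k V" (is "submodule ?U k V")
    and "W \<subseteq> {c \<odot> v \<oplus> w | c w. c \<in> carrier k \<and> w \<in> W}"
    and "v \<in> {c \<odot> v \<oplus> w | c w. c \<in> carrier k \<and> w \<in> W}"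
proof -
  note cl = submodule_closed[OF W]
  have mem: "c \<odot> v \<oplus> w \<in> ?U" if "c \<in> carrier k" "w \<in> W" for c w using that by blast
  have W': "w \<in> ?U" if "w \<in> W" for w
    using mem[of "\<zero>\<^bsub>k\<^esub>" w] that v cl(2)[OF that] by simp
  then show "W \<subseteq> ?U" by blast
  show "v \<in> ?U" using mem[of "\<one>\<^bsub>k\<^esub>" "\<zero>"] v cl(1) by simp
  show "submodule ?U k V"
  proof (rule submoduleI')
    show "?U \<subseteq> carrier V" using cl(2) v by auto
    show "\<zero> \<in> ?U" using W' cl(1) by blast
    fix x y assume "x \<in> ?U" "y \<in> ?U"
    then obtain c w d u where *: "x = c \<odot> v \<oplus> w" "y = d \<odot> v \<oplus> u"
      "c \<in> carrier k" "d \<in> carrier k" "w \<in> W" "u \<in> W" by blast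
    then have "x \<oplus> y = (c \<oplus>\<^bsub>k\<^esub> d) \<odot> v \<oplus> (w \<oplus> u)"
      using v cl(2) by (simp add: smult_l_distr M.a_ac)
    then show "x \<oplus> y \<in> ?U" using mem[of "c \<oplus>\<^bsub>k\<^esub> d" "w \<oplus> u"] * cl(3) by simp
  next
    fix c x assume "c \<in> carrier k" "x \<in> ?U"
    then obtain d w where *: "x = d \<odot> v \<oplus> w" "c \<in> carrier k" "d \<in> carrier k" "w \<in> W" by blast
    then have "c \<odot> x = (c \<otimes>\<^bsub>k\<^esub> d) \<odot> v \<oplus> c \<odot> w"
      using v cl(2) by (simp add: smult_r_distr smult_assoc1)
    then show "c \<odot> x \<in> ?U" using mem[of "c \<otimes>\<^bsub>k\<^esub> d" "c \<odot> w"] * cl(6) by simp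
  qed
qed

section \<open>Complements, projections and separating functionals\<close>

lemma smult_cancel:
  assumes W: "submodule W k V" and "c \<in> carrier k" "c \<noteq> \<zero>\<^bsub>k\<^esub>" "v \<in> carrier V" "c \<odot> v \<in> W"
  shows "v \<in> W"
proof -
  have u: "c \<in> Units k" using assms k.field_Units by auto
  then have "inv\<^bsub>k\<^esub> c \<odot> (c \<odot> v) \<in> W" using assms submodule_closed(6)[OF W] by simp
  moreover have "inv\<^bsub>k\<^esub> c \<odot> (c \<odot> v) = v" using u assms by (simp flip: smult_assoc1)
  ultimately show ?thesis by simp
qed

text \<open>Zorn's lemma gives a maximal subspace meeting \<open>W\<close> trivially, and
  \<open>Q\<close> is the projection onto it along \<open>W\<close>. The kernel of \<open>Q\<close>
  is \<open>W\<close>, so \<open>Q\<close> serves below as a linear choice of coset representatives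
  and thereby as a model of the quotient by \<open>W\<close>.\<close>

lemma ex_complement_projection:
  assumes W: "submodule W k V"
  obtains Q where "linear Q" "\<And>w. w \<in> W \<Longrightarrow> Q w = \<zero>" "\<And>v. v \<in> carrier V \<Longrightarrow> v \<ominus> Q v \<in> W"
proof -
  note W_cl = submodule_closed[OF W]
  let ?A = "{U. submodule U k V \<and> W \<inter> U = {\<zero>}}"
  have "?A \<noteq> {}" using submodule_zero W_cl(1) by blast
  moreover have "\<Union>C \<in> ?A" if "C \<noteq> {}" "subset.chain ?A C" for C
  proof -
    have "C \<subseteq> ?A" using that(2) by (simp add: subset.chain_def)
    then show ?thesis using submodule_Union_chain[OF that] that(1) by blast
  qed
  ultimately obtain U where U: "submodule U k V" "W \<inter> U = {\<zero>}"
    and max: "\<And>B. submodule B k V \<Longrightarrow> W \<inter> B = {\<zero>} \<Longrightarrow> U \<subseteq> B \<Longrightarrow> B = U"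
    using subset_Zorn_nonempty[of ?A] by auto
  note U_cl = submodule_closed[OF U(1)]
  have ex: "\<exists>u \<in> U. v \<ominus> u \<in> W" if v: "v \<in> carrier V" for v
  proof (rule ccontr)
    assume no: "\<not> ?thesis"
    \<comment> \<open>If \<open>v\<close> were outside the sum of \<open>W\<close> and
      \<open>U\<close>, adjoining it to \<open>U\<close> would still leave a trivial intersection
      with \<open>W\<close>, against maximality.\<close>
    let ?B = "{c \<odot> v \<oplus> u | c u. c \<in> carrier k \<and> u \<in> U}"
    note B = submodule_insert[OF U(1) v]
    have "z = \<zero>" if z: "z \<in> W" "z \<in> ?B" for z
    proof -
      obtain c u where c: "z = c \<odot> v \<oplus> u" "c \<in> carrier k" "u \<in> U" using z by blast
      have "c = \<zero>\<^bsub>k\<^esub>"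
      proof (rule ccontr)
        assume nz: "c \<noteq> \<zero>\<^bsub>k\<^esub>"
        then have un: "c \<in> Units k" using c k.field_Units by auto
        let ?u = "\<ominus> (inv\<^bsub>k\<^esub> c \<odot> u)"
        have "c \<odot> (v \<ominus> ?u) = z"
          using c v un U_cl(2) by (simp add: smult_r_distr a_minus_def smult_r_minus M.minus_minus flip: smult_assoc1)
        then have "v \<ominus> ?u \<in> W" using smult_cancel[OF W c(2) nz] z v U_cl(2)[OF c(3)] un by simp
        moreover have "?u \<in> U" using U_cl c un by simp
        ultimately show False using no by blast
      qed
      then have "z = u" using c U_cl(2) v by simp
      then show ?thesis using c U z by blast
    qed
    then have "W \<inter> ?B = {\<zero>}" using W_cl(1) submodule_closed(1)[OF B(1)] by blast
    then have "v \<in> U" using max[OF B(1) _ B(2)] B(3) by blast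
    moreover have "v \<ominus> v \<in> W" using v W_cl(1) by (simp add: a_minus_def M.r_neg)
    ultimately show False using no by blast
  qed
  have uniq: "u = u'" if "u \<in> U" "u' \<in> U" "v \<ominus> u \<in> W" "v \<ominus> u' \<in> W" "v \<in> carrier V" for u u' v
  proof -
    note [simp] = U_cl(2)[OF that(1)] U_cl(2)[OF that(2)] that(5)
    have "(v \<ominus> u') \<ominus> (v \<ominus> u) \<in> W" using W_cl(4) that by blast
    also have "(v \<ominus> u') \<ominus> (v \<ominus> u) = u \<ominus> u'"
      by (rule M.diff_diff_same) simp_all
    finally have "u \<ominus> u' \<in> W \<inter> U" using U_cl(4) that by blast
    then have "u \<ominus> u' = \<zero>" using U by blast
    then show ?thesis by (simp add: M.diff_eq_zero_iff)
  qed
  define Q where "Q v = (THE u. u \<in> U \<and> v \<ominus> u \<in> W)" for v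
  have Q: "Q v \<in> U \<and> v \<ominus> Q v \<in> W" if "v \<in> carrier V" for v
  proof -
    have "\<exists>!u. u \<in> U \<and> v \<ominus> u \<in> W"
      using ex[OF that] uniq[OF _ _ _ _ that] by auto
    then show ?thesis unfolding Q_def by (rule theI')
  qed
  have Q_eq: "Q v = u" if "v \<in> carrier V" "u \<in> U" "v \<ominus> u \<in> W" for v u
    using uniq[of "Q v" u v] Q[of v] that by blast
  show ?thesis
  proof
    show "linear Q" unfolding linear_def
    proof (intro conjI ballI)
      show "Q \<in> carrier V \<rightarrow> carrier V" using Q U_cl(2) by blast
      fix x y assume x: "x \<in> carrier V" and y: "y \<in> carrier V"
      note [simp] = x y U_cl(2)[of "Q x"] U_cl(2)[of "Q y"] Q[of x] Q[of y]
      have "(x \<oplus> y) \<ominus> (Q x \<oplus> Q y) = (x \<ominus> Q x) \<oplus> (y \<ominus> Q y)"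
        by (simp add: a_minus_def M.minus_add M.a_ac)
      then show "Q (x \<oplus> y) = Q x \<oplus> Q y"
        by (intro Q_eq) (simp_all add: U_cl W_cl)
    next
      fix c x assume x: "x \<in> carrier V" and c: "c \<in> carrier k"
      note [simp] = x c U_cl(2)[of "Q x"] Q[of x]
      have "(c \<odot> x) \<ominus> (c \<odot> Q x) = c \<odot> (x \<ominus> Q x)"
        by (simp add: a_minus_def smult_r_distr smult_r_minus)
      then show "Q (c \<odot> x) = c \<odot> Q x"
        by (intro Q_eq) (simp_all add: U_cl W_cl)
    qed
    show "Q w = \<zero>" if "w \<in> W" for w
      using that W_cl(2)[OF that] by (intro Q_eq) (simp_all add: U_cl)
    show "v \<ominus> Q v \<in> W" if "v \<in> carrier V" for v using Q that by blast
  qed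
qed

lemma ex_projection:
  assumes W: "submodule W k V"
  obtains p where "linear p" "\<And>w. w \<in> W \<Longrightarrow> p w = w" "\<And>v. v \<in> carrier V \<Longrightarrow> p v \<in> W"
proof -
  obtain Q where Q: "linear Q" "\<And>w. w \<in> W \<Longrightarrow> Q w = \<zero>" "\<And>v. v \<in> carrier V \<Longrightarrow> v \<ominus> Q v \<in> W"
    using ex_complement_projection[OF W] by blast
  show ?thesis
  proof (rule that[of "\<lambda>v. v \<ominus> Q v"])
    show "linear (\<lambda>v. v \<ominus> Q v)" unfolding linear_def
    proof (intro conjI ballI)
      fix x y assume *: "x \<in> carrier V" "y \<in> carrier V"
      show "(x \<oplus> y) \<ominus> Q (x \<oplus> y) = (x \<ominus> Q x) \<oplus> (y \<ominus> Q y)"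
        using * Q(1) by (simp add: linear_add[OF Q(1)] a_minus_def M.minus_add M.a_ac)
    next
      fix c x assume *: "c \<in> carrier k" "x \<in> carrier V"
      show "(c \<odot> x) \<ominus> Q (c \<odot> x) = c \<odot> (x \<ominus> Q x)"
        using * Q(1) by (simp add: linear_smult[OF Q(1)] a_minus_def smult_r_distr smult_r_minus)
    qed (use Q(1) in auto)
    show "w \<ominus> Q w = w" if "w \<in> W" for w
      using Q(2)[OF that] submodule_closed(2)[OF W that] by (simp add: a_minus_def)
  qed (rule Q(3))
qed

text \<open>The component \<open>u = Q y\<close> of \<open>y\<close> in a complement of
  \<open>W\<close> is nonzero. The functional applies \<open>Q\<close>, projects onto the line
  through \<open>u\<close> and reads off the coefficient.\<close>

lemma ex_separating:
  assumes W: "submodule W k V" and y: "y \<in> carrier V" "y \<notin> W"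
  obtains f where "f \<in> dual" "\<And>w. w \<in> W \<Longrightarrow> f w = \<zero>\<^bsub>k\<^esub>" "f y = \<one>\<^bsub>k\<^esub>"
proof -
  obtain Q where Q: "linear Q" "\<And>w. w \<in> W \<Longrightarrow> Q w = \<zero>" "\<And>v. v \<in> carrier V \<Longrightarrow> v \<ominus> Q v \<in> W"
    using ex_complement_projection[OF W] by blast
  define u where "u = Q y"
  have u: "u \<in> carrier V" using Q y by (simp add: u_def)
  have u0: "u \<noteq> \<zero>" using Q(3)[OF y(1)] y by (auto simp: u_def)
  let ?L = "{c \<odot> u \<oplus> w | c w. c \<in> carrier k \<and> w \<in> {\<zero>}}"
  note L = submodule_insert[OF submodule_zero u]
  obtain p where p: "linear p" "\<And>w. w \<in> ?L \<Longrightarrow> p w = w" "\<And>v. v \<in> carrier V \<Longrightarrow> p v \<in> ?L"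
    using ex_projection[OF L(1)] by blast
  have uniq: "c = d" if "c \<in> carrier k" "d \<in> carrier k" "c \<odot> u = d \<odot> u" for c d
  proof (rule ccontr)
    assume "c \<noteq> d"
    then have nz: "c \<ominus>\<^bsub>k\<^esub> d \<noteq> \<zero>\<^bsub>k\<^esub>" using that(1,2) by simp
    have "(c \<ominus>\<^bsub>k\<^esub> d) \<odot> u = c \<odot> u \<ominus> d \<odot> u"
      using that(1,2) u by (simp add: a_minus_def smult_l_distr smult_l_minus)
    also have "\<dots> = \<zero>" unfolding that(3) using that(2) u by simp
    finally have "(c \<ominus>\<^bsub>k\<^esub> d) \<odot> u \<in> {\<zero>}" by blast
    then have "u \<in> {\<zero>}" using smult_cancel[OF submodule_zero _ nz u] that(1,2) by blast
    then show False using u0 by simp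
  qed
  define f where "f v = (THE c. c \<in> carrier k \<and> p (Q v) = c \<odot> u)" for v
  have f: "f v \<in> carrier k \<and> p (Q v) = f v \<odot> u" if v: "v \<in> carrier V" for v
  proof -
    have "p (Q v) \<in> ?L" using p(3) Q(1) v by simp
    then have "\<exists>c. c \<in> carrier k \<and> p (Q v) = c \<odot> u" using u by auto
    then have "\<exists>!c. c \<in> carrier k \<and> p (Q v) = c \<odot> u" using uniq by metis
    then show ?thesis unfolding f_def by (rule theI')
  qed
  have f_eq: "f v = c" if "v \<in> carrier V" "c \<in> carrier k" "p (Q v) = c \<odot> u" for v c
    using uniq[of "f v" c] f[of v] that by simp
  show ?thesis
  proof
    note lin = linear_add[OF Q(1)] linear_add[OF p(1)] linear_smult[OF Q(1)] linear_smult[OF p(1)]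
    show "f \<in> dual" unfolding dual_def
    proof (intro CollectI conjI ballI)
      show "f \<in> carrier V \<rightarrow> carrier k" using f by blast
      show "f (x \<oplus> y) = f x \<oplus>\<^bsub>k\<^esub> f y" if "x \<in> carrier V" "y \<in> carrier V" for x y
        using f[OF that(1)] f[OF that(2)] that Q(1) u by (intro f_eq) (simp_all add: lin smult_l_distr)
      show "f (c \<odot> x) = c \<otimes>\<^bsub>k\<^esub> f x" if "c \<in> carrier k" "x \<in> carrier V" for c x
        using f[OF that(2)] that Q(1) u by (intro f_eq) (simp_all add: lin smult_assoc1)
    qed
    show "f w = \<zero>\<^bsub>k\<^esub>" if "w \<in> W" for w
      using Q(2)[OF that] submodule_closed(2)[OF W that] u p(1) by (intro f_eq) simp_all
    have "p u = u" using p(2) L(3) by blast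
    then show "f y = \<one>\<^bsub>k\<^esub>" using y u by (intro f_eq) (simp_all flip: u_def)
  qed
qed

text \<open>Lets an identity of vectors be checked on functionals; this is how
  \<open>lhit_rhit\<close> is obtained without a further computation with coproducts.\<close>

lemma dual_separates:
  assumes "x \<in> carrier V" "y \<in> carrier V" "\<And>f. f \<in> dual \<Longrightarrow> f x = f y"
  shows "x = y"
proof (rule ccontr)
  assume "x \<noteq> y"
  then have "x \<ominus> y \<notin> {\<zero>}" using assms(1,2) by (simp add: M.diff_eq_zero_iff)
  then obtain f where f: "f \<in> dual" "f (x \<ominus> y) = \<one>\<^bsub>k\<^esub>"
    using ex_separating[OF submodule_zero, of "x \<ominus> y"] assms(1,2) by auto
  then show False using dual_minus[OF f(1) assms(1,2)] assms(3)[OF f(1)] f assms(2) by simp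
qed

section \<open>Spans of finite sets\<close>

definition lspan :: "'v set \<Rightarrow> 'v set"
  where "lspan B = \<Inter>{W. submodule W k V \<and> B \<subseteq> W}"

lemma lspan_submodule:
  assumes "B \<subseteq> carrier V" shows "submodule (lspan B) k V"
proof (rule submoduleI')
  show "lspan B \<subseteq> carrier V" unfolding lspan_def using carrier_is_submodule assms by blast
qed (auto simp: lspan_def intro: submodule_closed)

lemma lspan_superset: "B \<subseteq> lspan B"
  by (auto simp: lspan_def)

lemma lspan_least: "submodule W k V \<Longrightarrow> B \<subseteq> W \<Longrightarrow> lspan B \<subseteq> W"
  by (auto simp: lspan_def)

lemma lspan_empty: "lspan {} = {\<zero>}"
  using lspan_least[OF submodule_zero, of "{}"] submodule_closed(1)[OF lspan_submodule, of "{}"] by auto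

lemma lspan_insert:
  assumes "B \<subseteq> carrier V" "v \<in> carrier V"
  shows "lspan (insert v B) = {c \<odot> v \<oplus> w | c w. c \<in> carrier k \<and> w \<in> lspan B}" (is "_ = ?U")
proof
  note U = submodule_insert[OF lspan_submodule[OF assms(1)] assms(2)]
  show "lspan (insert v B) \<subseteq> ?U"
    using lspan_superset[of B] U(2,3) by (intro lspan_least[OF U(1)]) blast
  have S: "submodule (lspan (insert v B)) k V" using assms by (intro lspan_submodule) blast
  have "lspan B \<subseteq> lspan (insert v B)" by (rule lspan_least[OF S]) (use lspan_superset in blast)
  moreover have "v \<in> lspan (insert v B)" using lspan_superset[of "insert v B"] by blast
  ultimately show "?U \<subseteq> lspan (insert v B)" using submodule_closed(3,6)[OF S] by blast
qed

text \<open>A substitute for dimension: the strict bound for proper subspaces permits a descent on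
  the least number of generators. The induction splits off a generator \<open>v\<close>; a vector
  \<open>w\<close> of \<open>W\<close> outside the span of the others takes its place.\<close>

lemma submodule_of_finite_span:
  assumes "finite F" "F \<subseteq> carrier V" "submodule W k V" "W \<subseteq> lspan F"
  shows "\<exists>G. finite G \<and> G \<subseteq> carrier V \<and> lspan G = W \<and> card G \<le> card F \<and> (W \<noteq> lspan F \<longrightarrow> card G < card F)"
  using assms
proof (induction F arbitrary: W)
  case empty
  then have "W = {\<zero>}" using submodule_closed(1)[OF empty(2)] lspan_empty by auto
  then show ?case using lspan_empty by (intro exI[of _ "{}"]) auto
next
  case (insert v F)
  have v: "v \<in> carrier V" and F: "F \<subseteq> carrier V" using insert by auto
  note S = lspan_submodule[OF F] note Scl = submodule_closed[OF S] note Wcl = submodule_closed[OF insert(5)]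
  note ins = lspan_insert[OF F v]
  let ?W = "W \<inter> lspan F"
  have W': "submodule ?W k V" using insert S by (intro submodule_Int)
  obtain G where G: "finite G" "G \<subseteq> carrier V" "lspan G = ?W" "card G \<le> card F" "?W \<noteq> lspan F \<Longrightarrow> card G < card F"
    using insert.IH[OF F W'] by auto
  show ?case
  proof (cases "W \<subseteq> lspan F")
    case True
    then have "?W = W" by blast
    then show ?thesis using G insert.hyps by (intro exI[of _ G]) auto
  next
    case False
    then obtain w where w: "w \<in> W" "w \<notin> lspan F" by blast
    then obtain c u where c: "w = c \<odot> v \<oplus> u" "c \<in> carrier k" "u \<in> lspan F"
      using insert.prems(3) ins by blast
    have c0: "c \<noteq> \<zero>\<^bsub>k\<^esub>" using w c v Scl(2) by auto
    then have un: "c \<in> Units k" using c k.field_Units by auto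
    have wV: "w \<in> carrier V" using w Wcl by blast
    have span: "lspan (insert w G) = W"
    proof
      have "G \<subseteq> W" using lspan_superset[of G] G(3) by blast
      then show "lspan (insert w G) \<subseteq> W" using w insert.prems(2) by (intro lspan_least) auto
      show "W \<subseteq> lspan (insert w G)"
      proof
        fix z assume z: "z \<in> W"
        then obtain d t where d: "z = d \<odot> v \<oplus> t" "d \<in> carrier k" "t \<in> lspan F"
          using insert.prems(3) ins by blast
        \<comment> \<open>The quotient of the \<open>v\<close>-coefficients of \<open>z\<close> and
          \<open>w\<close>, chosen so that subtracting \<open>e \<odot> w\<close> from
          \<open>z\<close> leaves an element of \<open>lspan F\<close>.\<close>
        define e where "e = d \<otimes>\<^bsub>k\<^esub> inv\<^bsub>k\<^esub> c"
        have e: "e \<in> carrier k" "e \<otimes>\<^bsub>k\<^esub> c = d" using d un c by (auto simp: e_def k.m_assoc)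
        note [simp] = v Scl(2)[OF c(3)] Scl(2)[OF d(3)]
        have "z \<ominus> e \<odot> w = t \<ominus> e \<odot> u"
          using e c d
          by (simp add: smult_r_distr a_minus_def M.minus_add M.a_ac M.r_neg1 M.r_neg2 M.r_neg flip: smult_assoc1)
        moreover have "z \<ominus> e \<odot> w \<in> W" "t \<ominus> e \<odot> u \<in> lspan F"
          using Scl(4,6) Wcl(4,6) z w(1) c(3) d(3) e(1) by blast+
        ultimately have "z \<ominus> e \<odot> w \<in> lspan G"
          using G(3) by simp
        moreover have "z = e \<odot> w \<oplus> (z \<ominus> e \<odot> w)"
          using Wcl(2)[OF z] wV e by (simp add: a_minus_def M.a_ac M.r_neg1 M.r_neg)
        ultimately show "z \<in> lspan (insert w G)"
          using lspan_insert[OF G(2) wV] e(1) by blast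
      qed
    qed
    have "card G < card F" if "W \<noteq> lspan (insert v F)"
    proof (rule G(5), rule notI)
      assume eq: "?W = lspan F"
      have "w \<ominus> u \<in> W" using w c eq Wcl(4) by blast
      moreover have "w \<ominus> u = c \<odot> v" using c v Scl(2) by (simp add: a_minus_def M.a_assoc M.r_neg)
      ultimately have "v \<in> W" using smult_cancel[OF insert.prems(2) c(2) c0 v] by simp
      then have "lspan (insert v F) \<subseteq> W"
        using eq lspan_superset[of F] by (intro lspan_least[OF insert.prems(2)]) auto
      then show False using that insert.prems(3) by blast
    qed
    then show ?thesis using span G wV insert.hyps
      by (intro exI[of _ "insert w G"]) (auto simp: card_insert_if)
  qed
qed

section \<open>Closure properties of linear maps and functionals\<close>

lemma linear_id: "linear (\<lambda>x. x)"
  by (auto simp: linear_def)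

lemma linearI:
  assumes "\<And>x. x \<in> carrier V \<Longrightarrow> f x \<in> carrier V"
    "\<And>x y. x \<in> carrier V \<Longrightarrow> y \<in> carrier V \<Longrightarrow> f (x \<oplus> y) = f x \<oplus> f y"
    "\<And>c x. c \<in> carrier k \<Longrightarrow> x \<in> carrier V \<Longrightarrow> f (c \<odot> x) = c \<odot> f x"
  shows "linear f"
  unfolding linear_def by (intro conjI ballI funcsetI assms)

lemma dualI:
  assumes "\<And>x. x \<in> carrier V \<Longrightarrow> f x \<in> carrier k"
    "\<And>x y. x \<in> carrier V \<Longrightarrow> y \<in> carrier V \<Longrightarrow> f (x \<oplus> y) = f x \<oplus>\<^bsub>k\<^esub> f y"
    "\<And>c x. c \<in> carrier k \<Longrightarrow> x \<in> carrier V \<Longrightarrow> f (c \<odot> x) = c \<otimes>\<^bsub>k\<^esub> f x"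
  shows "f \<in> dual"
  unfolding dual_def by (intro CollectI conjI ballI funcsetI assms)

lemma linear_comp: "linear p \<Longrightarrow> linear f \<Longrightarrow> linear (\<lambda>x. p (f x))"
  by (rule linearI) (simp_all add: linear_add linear_smult)

lemma dual_comp: "g \<in> dual \<Longrightarrow> linear f \<Longrightarrow> (\<lambda>x. g (f x)) \<in> dual"
  by (rule dualI) (simp_all add: linear_add linear_smult dual_add dual_smult)

lemma linear_plus: "linear f \<Longrightarrow> linear g \<Longrightarrow> linear (\<lambda>x. f x \<oplus> g x)"
  by (rule linearI) (simp_all add: linear_add linear_smult smult_r_distr M.a_ac)

lemma linear_scale: "c \<in> carrier k \<Longrightarrow> linear f \<Longrightarrow> linear (\<lambda>x. c \<odot> f x)"
  by (rule linearI) (simp_all add: linear_add linear_smult smult_r_distr k.m_comm flip: smult_assoc1)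

lemma linear_diff: "linear f \<Longrightarrow> linear g \<Longrightarrow> linear (\<lambda>x. f x \<ominus> g x)"
  by (rule linearI)
    (simp_all add: linear_add linear_smult a_minus_def smult_r_distr smult_r_minus M.minus_add M.a_ac)

lemma linear_dual_smult: "f \<in> dual \<Longrightarrow> v \<in> carrier V \<Longrightarrow> linear (\<lambda>x. f x \<odot> v)"
  by (rule linearI) (simp_all add: dual_add dual_smult smult_l_distr smult_assoc1)

end

section \<open>Hopf algebras\<close>

subsection \<open>Sweedler sums\<close>

text \<open>Listing \<open>H\<close> first makes its operations the default ones in the notation.\<close>

locale hopf = hopf_algebra k H
  for H :: "('k, 'h, 'y) hopf_algebra_scheme" (structure) and k :: "('k, 'x) ring_scheme"

sublocale hopf \<subseteq> linear_space H k ..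

sublocale hopf \<subseteq> HH: tensor_factors k H H
  by (rule tensor_factors.intro) (auto intro: H.is_abelian_group)

context hopf
begin

abbreviation "HH \<equiv> tensor k H H"
abbreviation "HH_algebra \<equiv> tensor_algebra k H H"
abbreviation "pure \<equiv> pure_tensor k H H"

abbreviation bilinear :: "('g, 'z) monoid_scheme \<Rightarrow> ('h \<Rightarrow> 'h \<Rightarrow> 'g) \<Rightarrow> bool"
  where "bilinear G b \<equiv> balanced k H H G b"

text \<open>Additivity in each argument, with scalars moving between neighbouring arguments: exactly
  what a homomorphism from the triple tensor product into a mere abelian group demands.\<close>

definition trilinear :: "('g, 'z) monoid_scheme \<Rightarrow> ('h \<Rightarrow> 'h \<Rightarrow> 'h \<Rightarrow> 'g) \<Rightarrow> bool"
  where "trilinear G t \<longleftrightarrow>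
    (\<forall>a \<in> carrier H. bilinear G (t a)) \<and> (\<forall>c \<in> carrier H. bilinear G (\<lambda>a b. t a b c))"

text \<open>The Sweedler sum \<open>\<Sum> b x\<^sub>1 x\<^sub>2\<close>, formed in the abelian group \<open>G\<close>.\<close>

definition sw :: "('g, 'z) monoid_scheme \<Rightarrow> ('h \<Rightarrow> 'h \<Rightarrow> 'g) \<Rightarrow> 'h \<Rightarrow> 'g"
  where "sw G b x = tensor_lift G b (comult H x)"

lemma bilinearD:
  assumes "bilinear G b" "x \<in> carrier H" "y \<in> carrier H"
  shows "b x y \<in> carrier G"
    "x' \<in> carrier H \<Longrightarrow> b (x \<oplus> x') y = b x y \<otimes>\<^bsub>G\<^esub> b x' y"
    "y' \<in> carrier H \<Longrightarrow> b x (y \<oplus> y') = b x y \<otimes>\<^bsub>G\<^esub> b x y'"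
    "c \<in> carrier k \<Longrightarrow> b (c \<odot> x) y = b x (c \<odot> y)"
  using assms by (auto simp: balanced_def)

section \<open>The algebra structure on the tensor square\<close>

lemma carrier_tensor_algebra [simp]: "carrier (HH_algebra) = carrier (HH)"
  and add_tensor_algebra: "ring.add (HH_algebra) = monoid.mult (HH)"
  and zero_tensor_algebra: "ring.zero (HH_algebra) = \<one>\<^bsub>HH\<^esub>"
  and one_tensor_algebra: "\<one>\<^bsub>HH_algebra\<^esub> = pure \<one> \<one>"
  by (simp_all add: tensor_algebra_def)

lemma comult_closed [simp]: "x \<in> carrier H \<Longrightarrow> comult H x \<in> carrier (HH)"
  using comult_hom by (auto simp: ring_hom_def)

lemma comult_add:
  "x \<in> carrier H \<Longrightarrow> y \<in> carrier H \<Longrightarrow>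
    comult H (x \<oplus> y) = comult H x \<otimes>\<^bsub>HH\<^esub> comult H y"
  using comult_hom by (auto simp: ring_hom_def add_tensor_algebra)

lemma comult_one: "comult H \<one> = pure \<one> \<one>"
  using comult_hom by (auto simp: ring_hom_def one_tensor_algebra)

lemma comult_hom_group: "comult H \<in> hom (add_monoid H) (HH)"
  by (auto simp: hom_def comult_add)

lemma smult_commute:
  "c \<in> carrier k \<Longrightarrow> d \<in> carrier k \<Longrightarrow> x \<in> carrier H \<Longrightarrow> c \<odot> (d \<odot> x) = d \<odot> (c \<odot> x)"
  by (simp add: k.m_comm flip: smult_assoc1)

lemma scale_left_bilinear:
  assumes "bilinear G b" "c \<in> carrier k" shows "bilinear G (\<lambda>x y. b (c \<odot> x) y)"
  using assms
  by (auto simp: balanced_def smult_r_distr smult_commute)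

lemma pure_bilinear: "bilinear (HH) (pure)"
  by (rule HH.pure_balanced)

lemma smult_tensor_algebra_closed:
  assumes "c \<in> carrier k" "t \<in> carrier (HH)"
  shows "c \<odot>\<^bsub>HH_algebra\<^esub> t \<in> carrier (HH)"
  using HH.lift_closed[OF HH.tensor_comm_group scale_left_bilinear[OF pure_bilinear assms(1)] assms(2)]
  by (simp add: tensor_algebra_def)

lemma tensor_algebra_smult_pure:
  assumes "c \<in> carrier k" "x \<in> carrier H" "y \<in> carrier H"
  shows "c \<odot>\<^bsub>HH_algebra\<^esub> pure x y = pure (c \<odot> x) y"
  using assms HH.lift_pure[OF HH.tensor_comm_group scale_left_bilinear[OF pure_bilinear]]
  by (simp add: tensor_algebra_def)

lemma lift_smult:
  assumes G: "comm_group G" and b: "bilinear G b" and c: "c \<in> carrier k"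
    and t: "t \<in> carrier (HH)"
  shows "tensor_lift G b (c \<odot>\<^bsub>HH_algebra\<^esub> t) = tensor_lift G (\<lambda>x y. b (c \<odot> x) y) t"
proof -
  have "tensor_lift G b (c \<odot>\<^bsub>HH_algebra\<^esub> t) =
      tensor_lift G (\<lambda>x y. tensor_lift G b (pure (c \<odot> x) y)) t"
    using HH.lift_hom_comp(1)[OF HH.tensor_comm_group G scale_left_bilinear[OF pure_bilinear c] HH.lift_hom[OF G b] t]
    by (simp add: tensor_algebra_def)
  also have "\<dots> = tensor_lift G (\<lambda>x y. b (c \<odot> x) y) t"
    by (rule HH.lift_cong[OF G HH.lift_hom_comp(2)[OF HH.tensor_comm_group G
            scale_left_bilinear[OF pure_bilinear c] HH.lift_hom[OF G b] t] _ t])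
      (simp add: HH.lift_pure[OF G b] c)
  finally show ?thesis .
qed

lemma mult_bilinear_inner:
  assumes "bilinear G b" "u \<in> carrier H" "v \<in> carrier H"
  shows "bilinear G (\<lambda>c d. b (u \<otimes> c) (v \<otimes> d))" "bilinear G (\<lambda>c d. b (c \<otimes> u) (d \<otimes> v))"
  using assms by (auto simp: balanced_def H.r_distr H.l_distr smult_mult_right smult_mult_left)

lemma mult_bilinear_outer:
  assumes G: "comm_group G" and b: "bilinear G b" and u: "u \<in> carrier (HH)"
  shows "bilinear G (\<lambda>x y. tensor_lift G (\<lambda>c d. b (x \<otimes> c) (y \<otimes> d)) u)"
proof -
  note inner = mult_bilinear_inner(1)[OF b]
  have eq: "tensor_lift G (\<lambda>c d. b (x \<otimes> c) (y \<otimes> d)) u \<otimes>\<^bsub>G\<^esub> tensor_lift G (\<lambda>c d. b (x' \<otimes> c) (y' \<otimes> d)) u =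
    tensor_lift G (\<lambda>c d. b (x \<otimes> c) (y \<otimes> d) \<otimes>\<^bsub>G\<^esub> b (x' \<otimes> c) (y' \<otimes> d)) u"
    if "x \<in> carrier H" "y \<in> carrier H" "x' \<in> carrier H" "y' \<in> carrier H" for x y x' y'
    using that by (simp add: HH.lift_mult[OF G inner inner u])
  show ?thesis unfolding balanced_def
    using HH.lift_closed[OF G inner u]
    by (auto simp: eq bilinearD[OF b] H.l_distr smult_mult_left intro!: HH.lift_cong[OF G inner _ u]
        simp flip: bilinearD(4)[OF b])
qed

lemma lift_mult_algebra:
  assumes G: "comm_group G" and b: "bilinear G b"
    and t: "t \<in> carrier (HH)" and u: "u \<in> carrier (HH)"
  shows "tensor_lift G b (t \<otimes>\<^bsub>HH_algebra\<^esub> u) =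
    tensor_lift G (\<lambda>x y. tensor_lift G (\<lambda>c d. b (x \<otimes> c) (y \<otimes> d)) u) t"
proof -
  let ?T = "HH"
  note lin = HH.lift_hom[OF G b] and T = HH.tensor_comm_group
  note pin = mult_bilinear_inner(1)[OF pure_bilinear]
    and pout = mult_bilinear_outer[OF T pure_bilinear u]
  have "tensor_lift G b (t \<otimes>\<^bsub>HH_algebra\<^esub> u) =
     tensor_lift G (\<lambda>x y. tensor_lift G b
       (tensor_lift ?T (\<lambda>c d. pure (x \<otimes> c) (y \<otimes> d)) u)) t"
    using HH.lift_hom_comp(1)[OF T G pout lin t] by (simp add: tensor_algebra_def)
  also have "\<dots> = tensor_lift G (\<lambda>x y. tensor_lift G (\<lambda>c d. b (x \<otimes> c) (y \<otimes> d)) u) t"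
  proof (rule HH.lift_cong[OF G HH.lift_hom_comp(2)[OF T G pout lin t] _ t])
    fix x y assume xy: "x \<in> carrier H" "y \<in> carrier H"
    have "tensor_lift G b (tensor_lift ?T (\<lambda>c d. pure (x \<otimes> c) (y \<otimes> d)) u) =
      tensor_lift G (\<lambda>c d. tensor_lift G b (pure (x \<otimes> c) (y \<otimes> d))) u"
      by (rule HH.lift_hom_comp(1)[OF T G pin[OF xy] lin u])
    also have "\<dots> = tensor_lift G (\<lambda>c d. b (x \<otimes> c) (y \<otimes> d)) u"
      by (rule HH.lift_cong[OF G HH.lift_hom_comp(2)[OF T G pin[OF xy] lin u] _ u])
        (simp add: HH.lift_pure[OF G b] xy)
    finally show "tensor_lift G b (tensor_lift ?T (\<lambda>c d. pure (x \<otimes> c) (y \<otimes> d)) u) =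
      tensor_lift G (\<lambda>c d. b (x \<otimes> c) (y \<otimes> d)) u" .
  qed
  finally show ?thesis .
qed

lemma mult_bilinear_outer':
  assumes G: "comm_group G" and b: "bilinear G b" and t: "t \<in> carrier (HH)"
  shows "bilinear G (\<lambda>c d. tensor_lift G (\<lambda>x y. b (x \<otimes> c) (y \<otimes> d)) t)"
proof -
  note inner = mult_bilinear_inner(2)[OF b]
  have eq: "tensor_lift G (\<lambda>x y. b (x \<otimes> c) (y \<otimes> d)) t \<otimes>\<^bsub>G\<^esub> tensor_lift G (\<lambda>x y. b (x \<otimes> c') (y \<otimes> d')) t =
    tensor_lift G (\<lambda>x y. b (x \<otimes> c) (y \<otimes> d) \<otimes>\<^bsub>G\<^esub> b (x \<otimes> c') (y \<otimes> d')) t"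
    if "c \<in> carrier H" "d \<in> carrier H" "c' \<in> carrier H" "d' \<in> carrier H" for c d c' d'
    using that by (simp add: HH.lift_mult[OF G inner inner t])
  show ?thesis unfolding balanced_def
    using HH.lift_closed[OF G inner t]
    by (auto simp: eq bilinearD[OF b] H.r_distr smult_mult_right intro!: HH.lift_cong[OF G inner _ t]
        simp flip: bilinearD(4)[OF b])
qed

text \<open>Interchange of the two sums: both sides are homomorphisms in \<open>u\<close> that agree
  on pure tensors. With the second factor outside, a product \<open>x \<otimes> a\<close> is
  expanded along the coproduct of \<open>a\<close> first, which is the useful order when
  \<open>a\<close> lies in a Hopf subalgebra.\<close>

lemma lift_mult_algebra':
  assumes G: "comm_group G" and b: "bilinear G b"
    and t: "t \<in> carrier (HH)" and u: "u \<in> carrier (HH)"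
  shows "tensor_lift G b (t \<otimes>\<^bsub>HH_algebra\<^esub> u) =
    tensor_lift G (\<lambda>c d. tensor_lift G (\<lambda>x y. b (x \<otimes> c) (y \<otimes> d)) t) u"
proof -
  interpret G: comm_group G by (rule G)
  note in1 = mult_bilinear_inner(1)[OF b] and out = mult_bilinear_outer[OF G b]
  let ?f = "\<lambda>u. tensor_lift G (\<lambda>x y. tensor_lift G (\<lambda>c d. b (x \<otimes> c) (y \<otimes> d)) u) t"
  have "?f u = tensor_lift G (\<lambda>c d. tensor_lift G (\<lambda>x y. b (x \<otimes> c) (y \<otimes> d)) t) u"
  proof (rule HH.lift_unique[OF G mult_bilinear_outer'[OF G b t] _ _ u, of ?f])
    show "?f \<in> hom (HH) G"
    proof (rule homI)
      fix u v assume u: "u \<in> carrier (HH)" and v: "v \<in> carrier (HH)"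
      have uv: "u \<otimes>\<^bsub>HH\<^esub> v \<in> carrier (HH)"
        using u v comm_group.axioms(1)[OF HH.tensor_comm_group] by (simp add: comm_monoid_def monoid.m_closed)
      have "?f (u \<otimes>\<^bsub>HH\<^esub> v) = tensor_lift G (\<lambda>x y.
          tensor_lift G (\<lambda>c d. b (x \<otimes> c) (y \<otimes> d)) u \<otimes>\<^bsub>G\<^esub>
          tensor_lift G (\<lambda>c d. b (x \<otimes> c) (y \<otimes> d)) v) t"
        using HH.lift_hom[OF G in1] u v by (intro HH.lift_cong[OF G out[OF uv] _ t]) (auto simp: hom_def)
      then show "?f (u \<otimes>\<^bsub>HH\<^esub> v) = ?f u \<otimes>\<^bsub>G\<^esub> ?f v"
        using HH.lift_mult(1)[OF G out[OF u] out[OF v] t] by simp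
    qed (rule HH.lift_closed[OF G out t])
    fix c d assume "c \<in> carrier H" "d \<in> carrier H"
    then show "?f (pure c d) = tensor_lift G (\<lambda>x y. b (x \<otimes> c) (y \<otimes> d)) t"
      by (intro HH.lift_cong[OF G out _ t]) (auto simp: HH.lift_pure[OF G in1])
  qed
  then show ?thesis by (simp add: lift_mult_algebra[OF G b t u])
qed

section \<open>Rules for Sweedler sums\<close>

lemma comult_mult:
  "x \<in> carrier H \<Longrightarrow> y \<in> carrier H \<Longrightarrow>
    comult H (x \<otimes> y) = comult H x \<otimes>\<^bsub>HH_algebra\<^esub> comult H y"
  using comult_hom by (auto simp: ring_hom_def)

lemma sw_mult:
  assumes "comm_group G" "bilinear G b" "x \<in> carrier H" "y \<in> carrier H"
  shows "sw G b (x \<otimes> y) = sw G (\<lambda>u v. sw G (\<lambda>c d. b (u \<otimes> c) (v \<otimes> d)) y) x"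
  using assms by (simp add: sw_def comult_mult lift_mult_algebra)

lemma sw_closed:
  "comm_group G \<Longrightarrow> bilinear G b \<Longrightarrow> x \<in> carrier H \<Longrightarrow> sw G b x \<in> carrier G"
  unfolding sw_def by (rule HH.lift_closed) simp_all

lemma sw_hom:
  "comm_group G \<Longrightarrow> bilinear G b \<Longrightarrow> sw G b \<in> hom (add_monoid H) G"
  using hom_compose[OF comult_hom_group HH.lift_hom] by (simp add: sw_def[abs_def] comp_def)

lemma sw_add:
  "comm_group G \<Longrightarrow> bilinear G b \<Longrightarrow> x \<in> carrier H \<Longrightarrow> y \<in> carrier H \<Longrightarrow>
    sw G b (x \<oplus> y) = sw G b x \<otimes>\<^bsub>G\<^esub> sw G b y"
  using sw_hom[of G b] by (auto simp: hom_def)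

lemma sw_smult:
  "comm_group G \<Longrightarrow> bilinear G b \<Longrightarrow> x \<in> carrier H \<Longrightarrow> c \<in> carrier k \<Longrightarrow>
    sw G b (c \<odot> x) = sw G (\<lambda>u v. b (c \<odot> u) v) x"
  by (simp add: sw_def comult_smult lift_smult)

lemma sw_cong:
  assumes "comm_group G" "bilinear G b" "x \<in> carrier H"
    and "\<And>u v. u \<in> carrier H \<Longrightarrow> v \<in> carrier H \<Longrightarrow> b u v = b' u v"
  shows "sw G b x = sw G b' x"
  unfolding sw_def using assms by (intro HH.lift_cong) auto

lemma sw_comp:
  assumes "comm_group G" "comm_group G'" "bilinear G b" "f \<in> hom G G'" "x \<in> carrier H"
  shows "f (sw G b x) = sw G' (\<lambda>u v. f (b u v)) x"
  unfolding sw_def using assms by (intro HH.lift_hom_comp(1)) auto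

lemma sw_op:
  assumes "comm_group G" "bilinear G b" "bilinear G b'" "x \<in> carrier H"
  shows "sw G (\<lambda>u v. b u v \<otimes>\<^bsub>G\<^esub> b' u v) x = sw G b x \<otimes>\<^bsub>G\<^esub> sw G b' x"
  unfolding sw_def using assms by (intro HH.lift_mult(1)) auto

lemma sw_mem:
  assumes "comm_group G" "bilinear G b" "subgroup W G"
    and "\<And>u v. u \<in> C \<Longrightarrow> v \<in> D \<Longrightarrow> b u v \<in> W" "C \<subseteq> carrier H" "D \<subseteq> carrier H"
    and "comult H x \<in> tensor_span k H C D"
  shows "sw G b x \<in> W"
  unfolding sw_def using assms HH.lift_mem[of G b W C D "comult H x"] by (simp add: tensor_span_def)

lemma sw_one: "comm_group G \<Longrightarrow> bilinear G b \<Longrightarrow> sw G b \<one> = b \<one> \<one>"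
  by (simp add: sw_def comult_one HH.lift_pure)

lemma trilinearD:
  assumes "trilinear G t"
  shows "a \<in> carrier H \<Longrightarrow> bilinear G (t a)" "c \<in> carrier H \<Longrightarrow> bilinear G (\<lambda>a b. t a b c)"
  using assms by (auto simp: trilinear_def)

lemma bilinear_sw_left:
  assumes G: "comm_group G" and t: "trilinear G t"
  shows "bilinear G (\<lambda>a b. sw G (\<lambda>c d. t c d b) a)"
proof -
  interpret G: comm_group G by (rule G)
  note t1 = trilinearD(1)[OF t] and t2 = trilinearD(2)[OF t]
  show ?thesis unfolding balanced_def
  proof (intro conjI ballI)
    fix a a' b assume "a \<in> carrier H" "a' \<in> carrier H" "b \<in> carrier H"
    then show "sw G (\<lambda>c d. t c d b) a \<in> carrier G"
      "sw G (\<lambda>c d. t c d b) (a \<oplus> a') = sw G (\<lambda>c d. t c d b) a \<otimes>\<^bsub>G\<^esub> sw G (\<lambda>c d. t c d b) a'"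
      by (simp_all add: sw_closed[OF G t2] sw_add[OF G t2])
  next
    fix a b b' assume *: "a \<in> carrier H" "b \<in> carrier H" "b' \<in> carrier H"
    then have "sw G (\<lambda>c d. t c d (b \<oplus> b')) a = sw G (\<lambda>c d. t c d b \<otimes>\<^bsub>G\<^esub> t c d b') a"
      using bilinearD(3)[OF t1] by (intro sw_cong[OF G t2]) auto
    then show "sw G (\<lambda>c d. t c d (b \<oplus> b')) a = sw G (\<lambda>c d. t c d b) a \<otimes>\<^bsub>G\<^esub> sw G (\<lambda>c d. t c d b') a"
      using * by (simp add: sw_op[OF G t2 t2])
  next
    fix r a b assume *: "r \<in> carrier k" "a \<in> carrier H" "b \<in> carrier H"
    then have "sw G (\<lambda>c d. t c d b) (r \<odot> a) = sw G (\<lambda>c d. t (r \<odot> c) d b) a"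
      by (simp add: sw_smult[OF G t2])
    also have "\<dots> = sw G (\<lambda>c d. t c d (r \<odot> b)) a"
      using * bilinearD(4)[OF t1, symmetric] bilinearD(4)[OF t2]
      by (intro sw_cong[OF G scale_left_bilinear[OF t2]]) auto
    finally show "sw G (\<lambda>c d. t c d b) (r \<odot> a) = sw G (\<lambda>c d. t c d (r \<odot> b)) a" .
  qed
qed

lemma bilinear_sw_right:
  assumes G: "comm_group G" and t: "trilinear G t"
  shows "bilinear G (\<lambda>a b. sw G (t a) b)"
proof -
  interpret G: comm_group G by (rule G)
  note t1 = trilinearD(1)[OF t] and t2 = trilinearD(2)[OF t]
  show ?thesis unfolding balanced_def
  proof (intro conjI ballI)
    fix a b b' assume "a \<in> carrier H" "b \<in> carrier H" "b' \<in> carrier H"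
    then show "sw G (t a) b \<in> carrier G"
      "sw G (t a) (b \<oplus> b') = sw G (t a) b \<otimes>\<^bsub>G\<^esub> sw G (t a) b'"
      by (simp_all add: sw_closed[OF G t1] sw_add[OF G t1])
  next
    fix a a' b assume *: "a \<in> carrier H" "a' \<in> carrier H" "b \<in> carrier H"
    then have "sw G (t (a \<oplus> a')) b = sw G (\<lambda>c d. t a c d \<otimes>\<^bsub>G\<^esub> t a' c d) b"
      using bilinearD(2)[OF t2] by (intro sw_cong[OF G t1]) auto
    then show "sw G (t (a \<oplus> a')) b = sw G (t a) b \<otimes>\<^bsub>G\<^esub> sw G (t a') b"
      using * by (simp add: sw_op[OF G t1 t1])
  next
    fix r a b assume *: "r \<in> carrier k" "a \<in> carrier H" "b \<in> carrier H"
    then have "sw G (t a) (r \<odot> b) = sw G (\<lambda>c d. t a (r \<odot> c) d) b"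
      by (simp add: sw_smult[OF G t1])
    also have "\<dots> = sw G (t (r \<odot> a)) b"
      using * bilinearD(4)[OF t2, symmetric]
      by (intro sw_cong[OF G scale_left_bilinear[OF t1]]) auto
    finally show "sw G (t (r \<odot> a)) b = sw G (t a) (r \<odot> b)" by simp
  qed
qed

section \<open>Coassociativity in the triple tensor product\<close>

sublocale HHH: tensor_factors k H "HH_algebra"
proof (rule tensor_factors.intro)
  show "abelian_group (HH_algebra)"
  proof -
    interpret T: comm_group "HH" by (rule HH.tensor_comm_group)
    show ?thesis
      by (rule abelian_groupI)
        (auto simp: add_tensor_algebra zero_tensor_algebra T.m_ac intro: T.l_inv_ex)
  qed
qed (auto simp: smult_tensor_algebra_closed H.is_abelian_group)

lemma lift_trilinear:
  assumes G: "comm_group G" and t: "trilinear G t"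
  shows "balanced k H (HH_algebra) G (\<lambda>a u. tensor_lift G (t a) u)"
proof -
  note t1 = trilinearD(1)[OF t] and t2 = trilinearD(2)[OF t]
  show ?thesis unfolding balanced_def carrier_tensor_algebra
  proof (intro conjI ballI)
    fix a u assume *: "a \<in> carrier H" "u \<in> carrier (HH)"
    show "tensor_lift G (t a) u \<in> carrier G" using HH.lift_closed[OF G t1 *(2)] * by simp
    show "tensor_lift G (t (a \<oplus> a')) u = tensor_lift G (t a) u \<otimes>\<^bsub>G\<^esub> tensor_lift G (t a') u"
      if "a' \<in> carrier H" for a'
    proof -
      have "tensor_lift G (t (a \<oplus> a')) u = tensor_lift G (\<lambda>c d. t a c d \<otimes>\<^bsub>G\<^esub> t a' c d) u"
        using * that bilinearD(2)[OF t2] by (intro HH.lift_cong[OF G t1]) auto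
      then show ?thesis using * that by (simp add: HH.lift_mult(1)[OF G t1 t1])
    qed
    show "tensor_lift G (t a) (u \<oplus>\<^bsub>HH_algebra\<^esub> v) = tensor_lift G (t a) u \<otimes>\<^bsub>G\<^esub> tensor_lift G (t a) v"
      if "v \<in> carrier (HH)" for v
      using HH.lift_hom[OF G t1, of a] * that by (auto simp: hom_def add_tensor_algebra)
    show "tensor_lift G (t (r \<odot> a)) u = tensor_lift G (t a) (r \<odot>\<^bsub>HH_algebra\<^esub> u)"
      if r: "r \<in> carrier k" for r
    proof -
      have "tensor_lift G (t a) (r \<odot>\<^bsub>HH_algebra\<^esub> u) = tensor_lift G (\<lambda>c d. t a (r \<odot> c) d) u"
        using * r by (simp add: lift_smult[OF G t1])
      also have "\<dots> = tensor_lift G (t (r \<odot> a)) u"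
        using * r bilinearD(4)[OF t2, symmetric]
        by (intro HH.lift_cong[OF G scale_left_bilinear[OF t1]]) auto
      finally show ?thesis by simp
    qed
  qed
qed

text \<open>The axiom is an equation in \<open>H \<otimes> (H \<otimes> H)\<close>. Applying the
  homomorphism induced there by \<open>t\<close> to both sides gives the rule for an arbitrary
  trilinear map.\<close>

lemma sw_coassoc:
  assumes G: "comm_group G" and t: "trilinear G t" and x: "x \<in> carrier H"
  shows "sw G (\<lambda>a b. sw G (\<lambda>c d. t c d b) a) x = sw G (\<lambda>a b. sw G (t a) b) x"
proof -
  let ?A = "HH_algebra" let ?T = "tensor k H ?A"
  let ?p = "pure" let ?q = "pure_tensor k H ?A"
  let ?L = "tensor_lift G (\<lambda>a u. tensor_lift G (t a) u)"
  note t1 = trilinearD(1)[OF t] and t2 = trilinearD(2)[OF t] and T = HHH.tensor_comm_group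
  note tl = lift_trilinear[OF G t]
  note L = HHH.lift_hom[OF G tl]
  note q = bilinearD[OF pure_bilinear] note qb = HHH.pure_balanced
  have tri: "trilinear ?T (\<lambda>c d b. ?q c (?p d b))"
    using HHH.pure_balanced pure_bilinear
    by (auto simp: trilinear_def balanced_def add_tensor_algebra tensor_algebra_smult_pure)
  have bal: "bilinear ?T (\<lambda>a b. ?q a (comult H b))"
    using HHH.pure_balanced by (auto simp: balanced_def comult_add add_tensor_algebra comult_smult)
  have "?L (sw ?T (\<lambda>a b. sw ?T (\<lambda>c d. ?q c (?p d b)) a) x) = sw G (\<lambda>a b. ?L (sw ?T (\<lambda>c d. ?q c (?p d b)) a)) x"
    by (rule sw_comp[OF T G bilinear_sw_left[OF T tri] L x])
  also have "\<dots> = sw G (\<lambda>a b. sw G (\<lambda>c d. t c d b) a) x"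
  proof (rule sw_cong[OF G _ x, symmetric])
    show "bilinear G (\<lambda>a b. sw G (\<lambda>c d. t c d b) a)" by (rule bilinear_sw_left[OF G t])
    fix a b assume ab: "a \<in> carrier H" "b \<in> carrier H"
    have "?L (sw ?T (\<lambda>c d. ?q c (?p d b)) a) = sw G (\<lambda>c d. ?L (?q c (?p d b))) a"
      by (rule sw_comp[OF T G trilinearD(2)[OF tri ab(2)] L ab(1)])
    also have "\<dots> = sw G (\<lambda>c d. t c d b) a"
    proof (rule sw_cong[OF G t2[OF ab(2)] ab(1), symmetric])
      fix c d assume "c \<in> carrier H" "d \<in> carrier H"
      then show "t c d b = ?L (?q c (?p d b))"
        using HHH.lift_pure[OF G tl, of c "?p d b"] HH.lift_pure[OF G t1, of c d b] ab by simp
    qed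
    finally show "sw G (\<lambda>c d. t c d b) a = ?L (sw ?T (\<lambda>c d. ?q c (?p d b)) a)" by simp
  qed
  finally have left: "?L (sw ?T (\<lambda>a b. sw ?T (\<lambda>c d. ?q c (?p d b)) a) x) = sw G (\<lambda>a b. sw G (\<lambda>c d. t c d b) a) x" .
  have "?L (sw ?T (\<lambda>a b. ?q a (comult H b)) x) = sw G (\<lambda>a b. ?L (?q a (comult H b))) x"
    by (rule sw_comp[OF T G bal L x])
  also have "\<dots> = sw G (\<lambda>a b. sw G (t a) b) x"
    by (rule sw_cong[OF G bilinear_sw_right[OF G t] x, symmetric]) (simp add: HHH.lift_pure[OF G tl] sw_def)
  finally show ?thesis
    using left coassoc[OF x] by (simp add: sw_def tensor_map_def)
qed

section \<open>Sweedler sums with values in the Hopf algebra\<close>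

abbreviation "\<epsilon> \<equiv> counit H"
abbreviation "\<S> \<equiv> antipode H"

text \<open>Balancedness lets a scalar pass from one argument to the other, but not out of the
  operation. Linearity in each argument is stronger and makes the resulting Sweedler sums linear
  maps.\<close>

definition bilinear_op :: "('h \<Rightarrow> 'h \<Rightarrow> 'h) \<Rightarrow> bool"
  where "bilinear_op b \<longleftrightarrow> (\<forall>v \<in> carrier H. linear (\<lambda>u. b u v)) \<and> (\<forall>u \<in> carrier H. linear (b u))"

abbreviation swH :: "('h \<Rightarrow> 'h \<Rightarrow> 'h) \<Rightarrow> 'h \<Rightarrow> 'h"
  where "swH \<equiv> sw (add_monoid H)"

lemma counit_dual: "\<epsilon> \<in> dual"
  using counit_hom by (intro dualI) (auto simp: ring_hom_def counit_smult)

lemma antipode_linear: "linear \<S>"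
  using antipode_hom by (auto simp: linear_def module_hom_def hom_def)

lemmas antipode_closed [simp] = linear_closed[OF antipode_linear]
  and counit_closed [simp] = dual_closed[OF counit_dual]

lemma linear_mult_left: "h \<in> carrier H \<Longrightarrow> linear f \<Longrightarrow> linear (\<lambda>x. h \<otimes> f x)"
  by (rule linearI) (simp_all add: linear_add linear_smult H.r_distr smult_mult_right)

lemma linear_mult_right: "h \<in> carrier H \<Longrightarrow> linear f \<Longrightarrow> linear (\<lambda>x. f x \<otimes> h)"
  by (rule linearI) (simp_all add: linear_add linear_smult H.l_distr smult_mult_left)

lemma linear_antipode: "linear f \<Longrightarrow> linear (\<lambda>x. \<S> (f x))"
  by (rule linear_comp[OF antipode_linear])

lemma bilinear_opI:
  "(\<And>v. v \<in> carrier H \<Longrightarrow> linear (\<lambda>u. b u v)) \<Longrightarrow> (\<And>u. u \<in> carrier H \<Longrightarrow> linear (b u)) \<Longrightarrow> bilinear_op b"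
  by (simp add: bilinear_op_def)

lemma bilinear_opD:
  "bilinear_op b \<Longrightarrow> v \<in> carrier H \<Longrightarrow> linear (\<lambda>u. b u v)"
  "bilinear_op b \<Longrightarrow> u \<in> carrier H \<Longrightarrow> linear (b u)"
  by (simp_all add: bilinear_op_def)

lemma bilinear_op_closed: "bilinear_op b \<Longrightarrow> u \<in> carrier H \<Longrightarrow> v \<in> carrier H \<Longrightarrow> b u v \<in> carrier H"
  using bilinear_opD(2) linear_closed by blast

lemma bilinear_op_bilinear: "bilinear_op b \<Longrightarrow> bilinear (add_monoid H) b"
  using linear_add[OF bilinear_opD(1)] linear_add[OF bilinear_opD(2)]
    linear_smult[OF bilinear_opD(1)] linear_smult[OF bilinear_opD(2)] bilinear_op_closed
  by (auto simp: balanced_def)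

lemmas swH_closed [simp] = sw_closed[OF H.a_comm_group bilinear_op_bilinear, simplified]
lemmas swH_cong = sw_cong[OF H.a_comm_group bilinear_op_bilinear]
lemmas swH_op = sw_op[OF H.a_comm_group bilinear_op_bilinear bilinear_op_bilinear, simplified]
lemmas swH_mult = sw_mult[OF H.a_comm_group bilinear_op_bilinear]
lemmas swH_one = sw_one[OF H.a_comm_group bilinear_op_bilinear]

lemma linear_hom: "linear f \<Longrightarrow> f \<in> hom (add_monoid H) (add_monoid H)"
  by (auto simp: linear_def hom_def)

lemma linear_swH_comp:
  "linear f \<Longrightarrow> bilinear_op b \<Longrightarrow> x \<in> carrier H \<Longrightarrow> f (swH b x) = swH (\<lambda>u v. f (b u v)) x"
  by (rule sw_comp[OF H.a_comm_group H.a_comm_group bilinear_op_bilinear linear_hom])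

lemma bilinear_op_comp: "linear f \<Longrightarrow> bilinear_op b \<Longrightarrow> bilinear_op (\<lambda>u v. f (b u v))"
  by (auto simp: bilinear_op_def intro: linear_comp)

lemma dual_swH_comp:
  assumes "f \<in> dual" "bilinear_op b" "x \<in> carrier H"
  shows "f (swH b x) = sw (add_monoid k) (\<lambda>u v. f (b u v)) x"
proof (rule sw_comp[OF H.a_comm_group k.a_comm_group bilinear_op_bilinear[OF assms(2)] _ assms(3)])
  show "f \<in> hom (add_monoid H) (add_monoid k)"
    using assms(1) by (intro homI) (simp_all add: dual_add)
qed

lemma linear_swH:
  assumes "bilinear_op b" "linear f" shows "linear (\<lambda>x. swH b (f x))"
proof (rule linear_comp[OF _ assms(2)])
  have smult: "swH b (c \<odot> x) = c \<odot> swH b x" if "c \<in> carrier k" "x \<in> carrier H" for c x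
  proof -
    have "swH b (c \<odot> x) = swH (\<lambda>u v. b (c \<odot> u) v) x"
      using that assms(1) by (intro sw_smult H.a_comm_group bilinear_op_bilinear)
    also have "\<dots> = swH (\<lambda>u v. c \<odot> b u v) x"
      using that linear_smult[OF bilinear_opD(1)[OF assms(1)]]
      by (intro sw_cong[OF H.a_comm_group scale_left_bilinear[OF bilinear_op_bilinear[OF assms(1)]]]) auto
    also have "\<dots> = c \<odot> swH b x"
      using that assms(1) by (intro linear_swH_comp[symmetric] linear_scale linear_id)
    finally show ?thesis .
  qed
  then show "linear (swH b)"
    using assms(1) sw_add[OF H.a_comm_group bilinear_op_bilinear[OF assms(1)]]
    by (auto simp: linear_def)
qed

text \<open>Linearity in a parameter of the summand. Together with \<open>linear_swH\<close> it
  settles the bilinearity of nested Sweedler sums, a side condition of most manipulations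
  below.\<close>

lemma linear_swH_param:
  assumes b: "\<And>x. x \<in> carrier H \<Longrightarrow> bilinear_op (b x)"
    and lin: "\<And>u v. u \<in> carrier H \<Longrightarrow> v \<in> carrier H \<Longrightarrow> linear (\<lambda>x. b x u v)"
    and y: "y \<in> carrier H"
  shows "linear (\<lambda>x. swH (b x) y)"
  unfolding linear_def
proof (intro conjI ballI)
  show "(\<lambda>x. swH (b x) y) \<in> carrier H \<rightarrow> carrier H" using b y by simp
  fix x x' assume x: "x \<in> carrier H" "x' \<in> carrier H"
  have "swH (b (x \<oplus> x')) y = swH (\<lambda>u v. b x u v \<oplus> b x' u v) y"
    using x y linear_add[OF lin] by (intro swH_cong b) auto
  then show "swH (b (x \<oplus> x')) y = swH (b x) y \<oplus> swH (b x') y"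
    using x y b by (simp add: swH_op)
next
  fix c x assume x: "c \<in> carrier k" "x \<in> carrier H"
  have "swH (b (c \<odot> x)) y = swH (\<lambda>u v. c \<odot> b x u v) y"
    using x y linear_smult[OF lin] by (intro swH_cong b) auto
  also have "\<dots> = c \<odot> swH (b x) y"
    using x y b by (intro linear_swH_comp[symmetric] linear_scale linear_id)
  finally show "swH (b (c \<odot> x)) y = c \<odot> swH (b x) y" .
qed

lemmas linear_intros = linear_id linear_plus linear_diff linear_scale linear_dual_smult linear_mult_left
  linear_mult_right linear_antipode linear_swH linear_swH_param bilinear_opI

lemma swH_coassoc:
  assumes t: "\<And>b c. b \<in> carrier H \<Longrightarrow> c \<in> carrier H \<Longrightarrow> linear (\<lambda>a. t a b c)"
    "\<And>a c. a \<in> carrier H \<Longrightarrow> c \<in> carrier H \<Longrightarrow> linear (\<lambda>b. t a b c)"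
    "\<And>a b. a \<in> carrier H \<Longrightarrow> b \<in> carrier H \<Longrightarrow> linear (\<lambda>c. t a b c)" and x: "x \<in> carrier H"
  shows "swH (\<lambda>a b. swH (\<lambda>c d. t c d b) a) x = swH (\<lambda>a b. swH (\<lambda>c d. t a c d) b) x"
proof (rule sw_coassoc[OF H.a_comm_group _ x])
  show "trilinear (add_monoid H) t" unfolding trilinear_def
    using t by (auto intro!: bilinear_op_bilinear bilinear_opI)
qed

lemma swH_counit_left: "linear f \<Longrightarrow> x \<in> carrier H \<Longrightarrow> swH (\<lambda>a b. \<epsilon> a \<odot> f b) x = f x"
proof -
  assume f: "linear f" and x: "x \<in> carrier H"
  have bil: "bilinear_op (\<lambda>a b. \<epsilon> a \<odot> b)" by (intro linear_intros counit_dual) auto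
  have "f x = f (swH (\<lambda>a b. \<epsilon> a \<odot> b) x)" using counit_left x by (simp add: sw_def)
  also have "\<dots> = swH (\<lambda>a b. f (\<epsilon> a \<odot> b)) x" by (rule linear_swH_comp[OF f bil x])
  also have "\<dots> = swH (\<lambda>a b. \<epsilon> a \<odot> f b) x"
    by (rule swH_cong[OF bilinear_op_comp[OF f bil] x]) (simp add: linear_smult[OF f])
  finally show ?thesis by simp
qed

lemma swH_counit_right: "linear f \<Longrightarrow> x \<in> carrier H \<Longrightarrow> swH (\<lambda>a b. \<epsilon> b \<odot> f a) x = f x"
proof -
  assume f: "linear f" and x: "x \<in> carrier H"
  have bil: "bilinear_op (\<lambda>a b. \<epsilon> b \<odot> a)" by (intro linear_intros counit_dual) auto
  have "f x = f (swH (\<lambda>a b. \<epsilon> b \<odot> a) x)" using counit_right x by (simp add: sw_def)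
  also have "\<dots> = swH (\<lambda>a b. f (\<epsilon> b \<odot> a)) x" by (rule linear_swH_comp[OF f bil x])
  also have "\<dots> = swH (\<lambda>a b. \<epsilon> b \<odot> f a) x"
    by (rule swH_cong[OF bilinear_op_comp[OF f bil] x]) (simp add: linear_smult[OF f])
  finally show ?thesis by simp
qed

lemma swH_antipode_left: "x \<in> carrier H \<Longrightarrow> swH (\<lambda>a b. \<S> a \<otimes> b) x = \<epsilon> x \<odot> \<one>"
  and swH_antipode_right: "x \<in> carrier H \<Longrightarrow> swH (\<lambda>a b. a \<otimes> \<S> b) x = \<epsilon> x \<odot> \<one>"
  by (simp_all add: sw_def antipode_left antipode_right)

text \<open>The left side is \<open>\<Sum> b (S(x\<^sub>1) x\<^sub>2) x\<^sub>3\<close>.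
  Coassociativity brings \<open>x\<^sub>1\<close> and \<open>x\<^sub>2\<close> together, the
  antipode axiom leaves \<open>\<epsilon>(x\<^sub>1)\<close>, and the counit absorbs it.\<close>

lemma swH_antipode_cancel:
  assumes b: "bilinear_op b" and x: "x \<in> carrier H"
  shows "swH (\<lambda>u v. swH (\<lambda>c d. b (\<S> u \<otimes> c) d) v) x = b \<one> x"
proof -
  note b1 = bilinear_opD(1)[OF b] and b2 = bilinear_opD(2)[OF b]
  have bilS: "bilinear_op (\<lambda>c d. \<S> c \<otimes> d)" by (intro linear_intros) auto
  have "swH (\<lambda>u v. swH (\<lambda>c d. b (\<S> u \<otimes> c) d) v) x = swH (\<lambda>u v. swH (\<lambda>c d. b (\<S> c \<otimes> d) v) u) x"
    using x by (intro swH_coassoc[symmetric] linear_comp[OF b1] linear_comp[OF b2] linear_intros) auto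
  also have "\<dots> = swH (\<lambda>u v. \<epsilon> u \<odot> b \<one> v) x"
  proof (rule swH_cong[OF _ x])
    show "bilinear_op (\<lambda>u v. swH (\<lambda>c d. b (\<S> c \<otimes> d) v) u)"
      by (intro linear_intros linear_comp[OF b1] linear_comp[OF b2]) auto
    fix u v assume uv: "u \<in> carrier H" "v \<in> carrier H"
    have "swH (\<lambda>c d. b (\<S> c \<otimes> d) v) u = b (swH (\<lambda>c d. \<S> c \<otimes> d) u) v"
      by (rule linear_swH_comp[OF b1[OF uv(2)] bilS uv(1), symmetric])
    also have "\<dots> = \<epsilon> u \<odot> b \<one> v"
      using uv linear_smult[OF b1[OF uv(2)], of "\<epsilon> u" "\<one>"] by (simp add: swH_antipode_left)
    finally show "swH (\<lambda>c d. b (\<S> c \<otimes> d) v) u = \<epsilon> u \<odot> b \<one> v" .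
  qed
  also have "\<dots> = b \<one> x" using b2 x by (intro swH_counit_left) auto
  finally show ?thesis .
qed

section \<open>The antipode as an anti-homomorphism\<close>

lemma counit_mult: "x \<in> carrier H \<Longrightarrow> y \<in> carrier H \<Longrightarrow> \<epsilon> (x \<otimes> y) = \<epsilon> x \<otimes>\<^bsub>k\<^esub> \<epsilon> y"
  and counit_one: "\<epsilon> \<one> = \<one>\<^bsub>k\<^esub>"
  using counit_hom by (auto simp: ring_hom_def)

lemma antipode_one: "\<S> \<one> = \<one>"
proof -
  have "bilinear_op (\<lambda>a b. \<S> a \<otimes> b)" by (intro linear_intros) auto
  from swH_one[OF this] show ?thesis by (simp add: swH_antipode_left counit_one)
qed

text \<open>\<open>Z\<close> is \<open>\<Sum> S(y\<^sub>1) S(x\<^sub>1) x\<^sub>2 y\<^sub>2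
  S(x\<^sub>3 y\<^sub>3)\<close>. Cancelling from the right gives one side of the claim, cancelling
  from the left the other: both are convolution inverses of the multiplication.\<close>

lemma antipode_mult:
  assumes x: "x \<in> carrier H" and y: "y \<in> carrier H"
  shows "\<S> (x \<otimes> y) = \<S> y \<otimes> \<S> x"
proof -
  define Z where "Z = swH (\<lambda>c d. swH (\<lambda>a b. \<S> c \<otimes> (\<S> a \<otimes> swH (\<lambda>p q. p \<otimes> \<S> q) (b \<otimes> d))) x) y"
  have bilS: "bilinear_op (\<lambda>p q. p \<otimes> \<S> q)" by (intro linear_intros) auto
  have bil1: "bilinear_op (\<lambda>a b. \<S> c \<otimes> (\<S> a \<otimes> swH (\<lambda>p q. p \<otimes> \<S> q) (b \<otimes> d)))"
    if "c \<in> carrier H" "d \<in> carrier H" for c d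
    using that by (intro linear_intros) (auto simp: bilS)
  have bil2: "bilinear_op (\<lambda>c d. swH (\<lambda>a b. \<S> c \<otimes> (\<S> a \<otimes> swH (\<lambda>p q. p \<otimes> \<S> q) (b \<otimes> d))) x)"
    using x by (intro linear_intros) (auto simp: bilS)
  \<comment> \<open>The factor \<open>x\<^sub>2 y\<^sub>2 S(x\<^sub>3 y\<^sub>3)\<close> collapses
    by the antipode axiom for a single product.\<close>
  have "Z = swH (\<lambda>c d. \<epsilon> d \<odot> (\<S> c \<otimes> \<S> x)) y"
    unfolding Z_def
  proof (rule swH_cong[OF bil2 y])
    fix c d assume cd: "c \<in> carrier H" "d \<in> carrier H"
    have "swH (\<lambda>a b. \<S> c \<otimes> (\<S> a \<otimes> swH (\<lambda>p q. p \<otimes> \<S> q) (b \<otimes> d))) x =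
      swH (\<lambda>a b. \<epsilon> b \<odot> (\<epsilon> d \<odot> (\<S> c \<otimes> \<S> a))) x"
      using cd by (intro swH_cong[OF bil1 x]) (auto simp: swH_antipode_right counit_mult smult_mult_right smult_assoc1)
    also have "\<dots> = \<epsilon> d \<odot> (\<S> c \<otimes> \<S> x)"
      using cd x by (intro swH_counit_right linear_intros) auto
    finally show "swH (\<lambda>a b. \<S> c \<otimes> (\<S> a \<otimes> swH (\<lambda>p q. p \<otimes> \<S> q) (b \<otimes> d))) x = \<epsilon> d \<odot> (\<S> c \<otimes> \<S> x)" .
  qed
  also have "\<dots> = \<S> y \<otimes> \<S> x" using x y by (intro swH_counit_right linear_intros) auto
  finally have Z1: "Z = \<S> y \<otimes> \<S> x" .
  \<comment> \<open>With the legs of \<open>y\<close> held fixed,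
    \<open>S(x\<^sub>1) x\<^sub>2\<close> cancels; what remains has the shape in which
    \<open>S(y\<^sub>1) y\<^sub>2\<close> cancels too.\<close>
  have "Z = swH (\<lambda>c d. swH (\<lambda>d1 d2. (\<S> c \<otimes> d1) \<otimes> \<S> (x \<otimes> d2)) d) y"
    unfolding Z_def
  proof (rule swH_cong[OF bil2 y])
    fix c d assume cd: "c \<in> carrier H" "d \<in> carrier H"
    let ?b = "\<lambda>p q. \<S> c \<otimes> swH (\<lambda>d1 d2. (p \<otimes> d1) \<otimes> \<S> (q \<otimes> d2)) d"
    have bb: "bilinear_op ?b" using cd by (intro linear_intros) auto
    have inb: "bilinear_op (\<lambda>d1 d2. (p \<otimes> d1) \<otimes> \<S> (q \<otimes> d2))" if "p \<in> carrier H" "q \<in> carrier H" for p q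
      using that by (intro linear_intros) auto
    have "swH (\<lambda>a b. \<S> c \<otimes> (\<S> a \<otimes> swH (\<lambda>p q. p \<otimes> \<S> q) (b \<otimes> d))) x =
      swH (\<lambda>a b. swH (\<lambda>b1 b2. ?b (\<S> a \<otimes> b1) b2) b) x"
    proof (rule swH_cong[OF bil1[OF cd] x])
      fix a b assume ab: "a \<in> carrier H" "b \<in> carrier H"
      let ?V = "\<lambda>p q. swH (\<lambda>d1 d2. (p \<otimes> d1) \<otimes> \<S> (q \<otimes> d2)) d"
      have V: "bilinear_op ?V" using cd by (intro linear_intros) auto
      have "swH (\<lambda>p q. p \<otimes> \<S> q) (b \<otimes> d) = swH ?V b"
        by (rule swH_mult[OF bilS ab(2) cd(2)])
      then have "\<S> c \<otimes> (\<S> a \<otimes> swH (\<lambda>p q. p \<otimes> \<S> q) (b \<otimes> d)) =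
          swH (\<lambda>p q. \<S> c \<otimes> (\<S> a \<otimes> ?V p q)) b"
        using linear_swH_comp[of "\<lambda>z. \<S> c \<otimes> (\<S> a \<otimes> z)", OF _ V ab(2)] ab cd
        by (simp add: linear_intros)
      also have "\<dots> = swH (\<lambda>b1 b2. ?b (\<S> a \<otimes> b1) b2) b"
      proof (rule swH_cong[OF _ ab(2)])
        show "bilinear_op (\<lambda>p q. \<S> c \<otimes> (\<S> a \<otimes> ?V p q))"
          using ab cd by (intro bilinear_op_comp[OF _ V] linear_intros) auto
        fix u v assume uv: "u \<in> carrier H" "v \<in> carrier H"
        have "\<S> a \<otimes> ?V u v = swH (\<lambda>d1 d2. \<S> a \<otimes> ((u \<otimes> d1) \<otimes> \<S> (v \<otimes> d2))) d"
          using ab cd uv inb by (intro linear_swH_comp[where f = "\<lambda>z. \<S> a \<otimes> z"] linear_intros) auto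
        also have "\<dots> = ?V (\<S> a \<otimes> u) v"
          using ab uv inb[of "\<S> a \<otimes> u" v]
          by (intro swH_cong[OF _ cd(2), symmetric]) (auto simp: H.m_assoc)
        finally show "\<S> c \<otimes> (\<S> a \<otimes> ?V u v) = ?b (\<S> a \<otimes> u) v" by simp
      qed
      finally show "\<S> c \<otimes> (\<S> a \<otimes> swH (\<lambda>p q. p \<otimes> \<S> q) (b \<otimes> d)) =
        swH (\<lambda>b1 b2. ?b (\<S> a \<otimes> b1) b2) b" .
    qed
    also have "\<dots> = ?b \<one> x" by (rule swH_antipode_cancel[OF bb x])
    also have "\<dots> = swH (\<lambda>d1 d2. \<S> c \<otimes> ((\<one> \<otimes> d1) \<otimes> \<S> (x \<otimes> d2))) d"
      using cd x inb by (intro linear_swH_comp[where f = "\<lambda>z. \<S> c \<otimes> z"] linear_intros) auto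
    also have "\<dots> = swH (\<lambda>d1 d2. (\<S> c \<otimes> d1) \<otimes> \<S> (x \<otimes> d2)) d"
      using cd x inb[of "\<S> c" x]
      by (intro swH_cong[symmetric]) (auto simp: H.m_assoc)
    finally show "swH (\<lambda>a b. \<S> c \<otimes> (\<S> a \<otimes> swH (\<lambda>p q. p \<otimes> \<S> q) (b \<otimes> d))) x =
      swH (\<lambda>d1 d2. (\<S> c \<otimes> d1) \<otimes> \<S> (x \<otimes> d2)) d" .
  qed
  also have "\<dots> = \<one> \<otimes> \<S> (x \<otimes> y)"
    using x y by (intro swH_antipode_cancel[where b = "\<lambda>p q. p \<otimes> \<S> (x \<otimes> q)"] linear_intros) auto
  finally show ?thesis using Z1 x y by simp
qed

subsection \<open>The action of the dual algebra\<close>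

text \<open>
  The actions \<open>f \<rightharpoonup> x = \<Sum> x\<^sub>1 f(x\<^sub>2)\<close> and \<open>x \<leftharpoonup> f = \<Sum> f(x\<^sub>1) x\<^sub>2\<close> of the dual algebra. Comodules
  are handled as modules over it.
\<close>

definition lhit :: "('h \<Rightarrow> 'k) \<Rightarrow> 'h \<Rightarrow> 'h"
  where "lhit f x = swH (\<lambda>a b. f b \<odot> a) x"

definition rhit :: "('h \<Rightarrow> 'k) \<Rightarrow> 'h \<Rightarrow> 'h"
  where "rhit f x = swH (\<lambda>a b. f a \<odot> b) x"

lemma bilinear_op_lhit: "f \<in> dual \<Longrightarrow> bilinear_op (\<lambda>a b. f b \<odot> a)"
  and bilinear_op_rhit: "f \<in> dual \<Longrightarrow> bilinear_op (\<lambda>a b. f a \<odot> b)"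
  by (intro linear_intros; simp)+

lemma lhit_closed [simp]: "f \<in> dual \<Longrightarrow> x \<in> carrier H \<Longrightarrow> lhit f x \<in> carrier H"
  and rhit_closed [simp]: "f \<in> dual \<Longrightarrow> x \<in> carrier H \<Longrightarrow> rhit f x \<in> carrier H"
  by (simp_all add: lhit_def rhit_def bilinear_op_lhit bilinear_op_rhit)

lemma linear_lhit: "f \<in> dual \<Longrightarrow> linear (lhit f)"
  and linear_rhit: "f \<in> dual \<Longrightarrow> linear (rhit f)"
  unfolding lhit_def[abs_def] rhit_def[abs_def]
  by (intro linear_swH linear_id bilinear_op_lhit bilinear_op_rhit; assumption)+

lemma lhit_counit: "x \<in> carrier H \<Longrightarrow> lhit \<epsilon> x = x"
  and rhit_counit: "x \<in> carrier H \<Longrightarrow> rhit \<epsilon> x = x"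
  using swH_counit_right[OF linear_id] swH_counit_left[OF linear_id] by (simp_all add: lhit_def rhit_def)

lemma dual_bilinear: "f \<in> dual \<Longrightarrow> bilinear_op b \<Longrightarrow> bilinear (add_monoid k) (\<lambda>u v. f (b u v))"
  using bilinearD[OF bilinear_op_bilinear[of b]]
  by (auto simp: balanced_def dual_add)

text \<open>Both sides are \<open>\<Sum> g(x\<^sub>1) f(x\<^sub>2)\<close>, the value at
  \<open>x\<close> of the convolution product of \<open>g\<close> and \<open>f\<close>. This
  adjunction exchanges annihilators for the left action with orthogonality to right
  translates.\<close>

lemma dual_hit:
  assumes "f \<in> dual" "g \<in> dual" "x \<in> carrier H" shows "f (rhit g x) = g (lhit f x)"
proof -
  have "f (rhit g x) = sw (add_monoid k) (\<lambda>u v. f (g u \<odot> v)) x"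
    unfolding rhit_def using assms by (intro dual_swH_comp bilinear_op_rhit)
  also have "\<dots> = sw (add_monoid k) (\<lambda>u v. g (f v \<odot> u)) x"
    using assms by (intro sw_cong[OF k.a_comm_group dual_bilinear[OF _ bilinear_op_rhit]])
      (simp_all add: dual_smult k.m_comm)
  also have "\<dots> = g (lhit f x)"
    unfolding lhit_def using assms by (intro dual_swH_comp[symmetric] bilinear_op_lhit)
  finally show ?thesis .
qed

lemma linear_swH_apply:
  assumes "linear p" "bilinear_op b" "bilinear_op b'" "x \<in> carrier H"
    and "\<And>u v. u \<in> carrier H \<Longrightarrow> v \<in> carrier H \<Longrightarrow> p (b u v) = b' u v"
  shows "p (swH b x) = swH b' x"
  using linear_swH_comp[OF assms(1,2,4)] swH_cong[OF bilinear_op_comp[OF assms(1,2)] assms(4,5)] by simp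

text \<open>The functional on the right is the convolution product \<open>f * g\<close>, so this is
  the associativity law of a left module over the dual algebra.\<close>

lemma lhit_lhit:
  assumes f: "f \<in> dual" and g: "g \<in> dual" and x: "x \<in> carrier H"
  shows "lhit f (lhit g x) = lhit (\<lambda>y. f (lhit g y)) x"
proof -
  have "lhit f (lhit g x) = swH (\<lambda>a b. swH (\<lambda>c d. g b \<odot> (f d \<odot> c)) a) x"
    unfolding lhit_def[of g]
  proof (rule linear_swH_apply[OF linear_lhit[OF f] bilinear_op_lhit[OF g] _ x])
    show "bilinear_op (\<lambda>a b. swH (\<lambda>c d. g b \<odot> (f d \<odot> c)) a)" using f g by (intro linear_intros) auto
    show "lhit f (g b \<odot> a) = swH (\<lambda>c d. g b \<odot> (f d \<odot> c)) a" if "a \<in> carrier H" "b \<in> carrier H" for a b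
      using linear_smult[OF linear_lhit[OF f]] linear_swH_comp[OF linear_scale[OF _ linear_id] bilinear_op_lhit[OF f], of "g b" a] f g that
      by (simp add: lhit_def)
  qed
  also have "\<dots> = swH (\<lambda>a b. swH (\<lambda>c d. g d \<odot> (f c \<odot> a)) b) x"
    using f g x by (intro swH_coassoc linear_intros) auto
  also have "\<dots> = lhit (\<lambda>y. f (lhit g y)) x"
    unfolding lhit_def[of "\<lambda>y. f (lhit g y)"]
  proof (rule swH_cong[OF _ x])
    show "bilinear_op (\<lambda>a b. swH (\<lambda>c d. g d \<odot> (f c \<odot> a)) b)" using f g by (intro linear_intros) auto
    show "swH (\<lambda>c d. g d \<odot> (f c \<odot> a)) b = f (lhit g b) \<odot> a" if "a \<in> carrier H" "b \<in> carrier H" for a b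
      unfolding lhit_def using f g that
      by (intro linear_swH_apply[symmetric, where p = "\<lambda>y. f y \<odot> a"] linear_intros)
        (auto simp: dual_smult smult_assoc1)
  qed
  finally show ?thesis .
qed

lemma rhit_rhit:
  assumes f: "f \<in> dual" and g: "g \<in> dual" and x: "x \<in> carrier H"
  shows "rhit f (rhit g x) = rhit (\<lambda>y. f (rhit g y)) x"
proof -
  have "rhit f (rhit g x) = swH (\<lambda>a b. swH (\<lambda>c d. g a \<odot> (f c \<odot> d)) b) x"
    unfolding rhit_def[of g]
  proof (rule linear_swH_apply[OF linear_rhit[OF f] bilinear_op_rhit[OF g] _ x])
    show "bilinear_op (\<lambda>a b. swH (\<lambda>c d. g a \<odot> (f c \<odot> d)) b)" using f g by (intro linear_intros) auto
    show "rhit f (g a \<odot> b) = swH (\<lambda>c d. g a \<odot> (f c \<odot> d)) b" if "a \<in> carrier H" "b \<in> carrier H" for a b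
      using linear_smult[OF linear_rhit[OF f]] linear_swH_comp[OF linear_scale[OF _ linear_id] bilinear_op_rhit[OF f], of "g a" b] f g that
      by (simp add: rhit_def)
  qed
  also have "\<dots> = swH (\<lambda>a b. swH (\<lambda>c d. g c \<odot> (f d \<odot> b)) a) x"
    using f g x by (intro swH_coassoc[symmetric] linear_intros) auto
  also have "\<dots> = rhit (\<lambda>y. f (rhit g y)) x"
    unfolding rhit_def[of "\<lambda>y. f (rhit g y)"]
  proof (rule swH_cong[OF _ x])
    show "bilinear_op (\<lambda>a b. swH (\<lambda>c d. g c \<odot> (f d \<odot> b)) a)" using f g by (intro linear_intros) auto
    show "swH (\<lambda>c d. g c \<odot> (f d \<odot> b)) a = f (rhit g a) \<odot> b" if "a \<in> carrier H" "b \<in> carrier H" for a b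
      unfolding rhit_def using f g that
      by (intro linear_swH_apply[symmetric, where p = "\<lambda>y. f y \<odot> b"] linear_intros)
        (auto simp: dual_smult smult_assoc1)
  qed
  finally show ?thesis .
qed

text \<open>Makes \<open>H\<close> a bimodule over its dual algebra. Testing against functionals
  reduces the claim to \<open>rhit_rhit\<close>.\<close>

lemma lhit_rhit:
  assumes f: "f \<in> dual" and g: "g \<in> dual" and x: "x \<in> carrier H"
  shows "lhit f (rhit g x) = rhit g (lhit f x)"
proof (rule dual_separates)
  fix h assume h: "h \<in> dual"
  have "h (lhit f (rhit g x)) = f (rhit h (rhit g x))" using assms h by (simp add: dual_hit)
  also have "\<dots> = f (rhit (\<lambda>y. h (rhit g y)) x)" using assms h by (simp add: rhit_rhit)
  also have "\<dots> = h (rhit g (lhit f x))"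
    using assms h by (simp add: dual_hit[OF f dual_comp[OF h linear_rhit[OF g]]])
  finally show "h (lhit f (rhit g x)) = h (rhit g (lhit f x))" .
qed (use assms in auto)

lemma dual_plus: "f \<in> dual \<Longrightarrow> g \<in> dual \<Longrightarrow> (\<lambda>x. f x \<oplus>\<^bsub>k\<^esub> g x) \<in> dual"
  by (rule dualI) (simp_all add: dual_add dual_smult k.r_distr k.a_ac)

lemma dual_scale: "c \<in> carrier k \<Longrightarrow> f \<in> dual \<Longrightarrow> (\<lambda>x. c \<otimes>\<^bsub>k\<^esub> f x) \<in> dual"
  by (rule dualI) (simp_all add: dual_add dual_smult k.r_distr k.m_ac)

lemma dual_null: "(\<lambda>x. \<zero>\<^bsub>k\<^esub>) \<in> dual"
  by (rule dualI) simp_all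

lemma submodule_rhits:
  assumes x: "x \<in> carrier H" shows "submodule {rhit f x | f. f \<in> dual} k H"
proof (rule submoduleI')
  show "\<zero> \<in> {rhit f x | f. f \<in> dual}"
  proof -
    have "rhit (\<lambda>x. \<zero>\<^bsub>k\<^esub>) x = \<zero>"
      using assms dual_null by (intro dual_separates) (auto simp: dual_hit)
    then show ?thesis using dual_null by force
  qed
  fix u v assume "u \<in> {rhit f x | f. f \<in> dual}" "v \<in> {rhit f x | f. f \<in> dual}"
  then obtain f g where fg: "f \<in> dual" "g \<in> dual" "u = rhit f x" "v = rhit g x" by blast
  then have "u \<oplus> v = rhit (\<lambda>x. f x \<oplus>\<^bsub>k\<^esub> g x) x"
    using x by (intro dual_separates) (auto simp: dual_hit dual_plus dual_add)
  then show "u \<oplus> v \<in> {rhit f x | f. f \<in> dual}" using dual_plus fg by blast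
next
  fix c u assume c: "c \<in> carrier k" and "u \<in> {rhit f x | f. f \<in> dual}"
  then obtain f where f: "f \<in> dual" "u = rhit f x" by blast
  then have "c \<odot> u = rhit (\<lambda>x. c \<otimes>\<^bsub>k\<^esub> f x) x"
    using x c by (intro dual_separates) (auto simp: dual_hit dual_scale dual_smult)
  then show "c \<odot> u \<in> {rhit f x | f. f \<in> dual}" using dual_scale c f by blast
qed (use x in auto)

text \<open>
  This lemma replaces the extension of a comodule map \<open>H\<^sup>* t \<rightarrow> H\<^sup>* d\<close>, \<open>t \<mapsto> d\<close>: all such maps
  are right translations by functionals.
\<close>

lemma ex_rhit:
  assumes t: "t \<in> carrier H" and d: "d \<in> carrier H"
    and ann: "\<And>f. f \<in> dual \<Longrightarrow> lhit f t = \<zero> \<Longrightarrow> f d = \<zero>\<^bsub>k\<^esub>"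
  shows "\<exists>g \<in> dual. rhit g t = d"
proof (rule ccontr)
  assume "\<not> ?thesis"
  then have "d \<notin> {rhit g t | g. g \<in> dual}" by blast
  from ex_separating[OF submodule_rhits[OF t] d this] obtain f
    where f: "f \<in> dual" "\<And>w. w \<in> {rhit g t | g. g \<in> dual} \<Longrightarrow> f w = \<zero>\<^bsub>k\<^esub>" "f d = \<one>\<^bsub>k\<^esub>" by blast
  \<comment> \<open>By the adjunction \<open>dual_hit\<close>, a functional vanishing on all right
    translates of \<open>t\<close> annihilates \<open>t\<close>.\<close>
  have "lhit f t = \<zero>"
  proof (rule dual_separates)
    fix g assume g: "g \<in> dual"
    then have "f (rhit g t) = \<zero>\<^bsub>k\<^esub>" using f(2) by blast
    then show "g (lhit f t) = g \<zero>" using dual_hit[OF f(1) g t] g by simp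
  qed (use f t in auto)
  then show False using ann[OF f(1)] f(3) by simp
qed

section \<open>Tensor spans and slices\<close>

lemma tensor_span_subgroup:
  assumes "C \<subseteq> carrier H" "D \<subseteq> carrier H" shows "subgroup (tensor_span k H C D) (HH)"
  unfolding tensor_span_def using assms
  by (intro group.generate_is_subgroup comm_group.axioms(2)[OF HH.tensor_comm_group]) auto

lemma tensor_span_mono: "C \<subseteq> C' \<Longrightarrow> D \<subseteq> D' \<Longrightarrow> tensor_span k H C D \<subseteq> tensor_span k H C' D'"
  unfolding tensor_span_def by (rule group.mono_generate[OF comm_group.axioms(2)[OF HH.tensor_comm_group]]) blast

lemma pure_in_tensor_span: "x \<in> C \<Longrightarrow> y \<in> D \<Longrightarrow> pure x y \<in> tensor_span k H C D"
  unfolding tensor_span_def by (rule generate.incl) blast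

lemma tensor_span_carrier: "tensor_span k H (carrier H) (carrier H) = carrier (HH)"
  using HH.tensor_generated by (simp add: tensor_span_def)

lemma tensor_span_finite:
  assumes "t \<in> tensor_span k H C D"
  shows "\<exists>F. finite F \<and> F \<subseteq> D \<and> t \<in> tensor_span k H C F"
    and "\<exists>F. finite F \<and> F \<subseteq> C \<and> t \<in> tensor_span k H F D"
proof -
  have "\<exists>F G. finite F \<and> finite G \<and> F \<subseteq> C \<and> G \<subseteq> D \<and> t \<in> tensor_span k H F G"
    using assms unfolding tensor_span_def[of k H C D]
  proof induction
    case one
    then show ?case using generate.one by (force simp: tensor_span_def)
  next
    case (incl h)
    then obtain x y where "x \<in> C" "y \<in> D" "h = pure x y" by blast
    then show ?case using pure_in_tensor_span[of x "{x}" y "{y}"] by (intro exI[of _ "{x}"] exI[of _ "{y}"]) auto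
  next
    case (inv h)
    then obtain x y where "x \<in> C" "y \<in> D" "h = pure x y" by blast
    then show ?case unfolding tensor_span_def by (intro exI[of _ "{x}"] exI[of _ "{y}"]) (auto intro: generate.inv)
  next
    case (eng h1 h2)
    then obtain F G F' G' where *: "finite F" "finite G" "F \<subseteq> C" "G \<subseteq> D" "h1 \<in> tensor_span k H F G"
      "finite F'" "finite G'" "F' \<subseteq> C" "G' \<subseteq> D" "h2 \<in> tensor_span k H F' G'" by blast
    then have "h1 \<in> tensor_span k H (F \<union> F') (G \<union> G')" "h2 \<in> tensor_span k H (F \<union> F') (G \<union> G')"
      using tensor_span_mono[of F "F \<union> F'" G "G \<union> G'"] tensor_span_mono[of F' "F \<union> F'" G' "G \<union> G'"] by blast+
    then have "h1 \<otimes>\<^bsub>HH\<^esub> h2 \<in> tensor_span k H (F \<union> F') (G \<union> G')"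
      unfolding tensor_span_def by (rule generate.eng)
    then show ?case using * by (intro exI[of _ "F \<union> F'"] exI[of _ "G \<union> G'"]) auto
  qed
  then obtain F G where *: "finite F" "finite G" "F \<subseteq> C" "G \<subseteq> D" "t \<in> tensor_span k H F G" by blast
  have "t \<in> tensor_span k H C G" "t \<in> tensor_span k H F D"
    using tensor_span_mono[OF *(3) order_refl] tensor_span_mono[OF order_refl *(4)] *(5) by blast+
  then show "\<exists>F. finite F \<and> F \<subseteq> D \<and> t \<in> tensor_span k H C F" "\<exists>F. finite F \<and> F \<subseteq> C \<and> t \<in> tensor_span k H F D"
    using * by blast+
qed

text \<open>The map \<open>id \<otimes> f\<close> from \<open>H \<otimes> H\<close> to
  \<open>H\<close>.\<close>

abbreviation slice :: "('h \<Rightarrow> 'k) \<Rightarrow> ('h \<times> 'h \<Rightarrow>\<^sub>0 int) set \<Rightarrow> 'h"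
  where "slice f t \<equiv> tensor_lift (add_monoid H) (\<lambda>a b. f b \<odot> a) t"

lemma tensor_span_insert:
  assumes v: "v \<in> carrier H" and F: "F \<subseteq> carrier H"
    and t: "t \<in> tensor_span k H (carrier H) (lspan (insert v F))"
  shows "\<exists>u \<in> carrier H. \<exists>s \<in> tensor_span k H (carrier H) (lspan F). t = pure u v \<otimes>\<^bsub>HH\<^esub> s"
proof -
  let ?T = "HH" let ?p = "pure"
  interpret T: comm_group ?T by (rule HH.tensor_comm_group)
  note S = submodule_closed[OF lspan_submodule[OF F]]
  have sub: "subgroup (tensor_span k H (carrier H) (lspan F)) ?T"
    using S(2) by (intro tensor_span_subgroup) auto
  interpret S: subgroup "tensor_span k H (carrier H) (lspan F)" ?T by (rule sub)
  let ?U = "{?p u v \<otimes>\<^bsub>?T\<^esub> s | u s. u \<in> carrier H \<and> s \<in> tensor_span k H (carrier H) (lspan F)}"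
  note p = bilinearD[OF pure_bilinear]
  have p0: "?p \<zero> v = \<one>\<^bsub>?T\<^esub>"
    using p(1)[of "\<zero>" v] p(2)[of "\<zero>" v "\<zero>"] v by simp
  have pinv: "inv\<^bsub>?T\<^esub> ?p u v = ?p (\<ominus> u) v" if "u \<in> carrier H" for u
    using p(2)[of "\<ominus> u" v u] that v p0 by (intro T.inv_equality) (auto simp: H.l_neg)
  have U: "subgroup ?U ?T"
  proof (rule T.subgroupI)
    show "?U \<subseteq> carrier ?T" using v by auto
    show "?U \<noteq> {}" using S.one_closed H.zero_closed by blast
    fix a assume "a \<in> ?U"
    then obtain u s where a: "a = ?p u v \<otimes>\<^bsub>?T\<^esub> s" "u \<in> carrier H" "s \<in> tensor_span k H (carrier H) (lspan F)" by blast
    then have "inv\<^bsub>?T\<^esub> a = ?p (\<ominus> u) v \<otimes>\<^bsub>?T\<^esub> inv\<^bsub>?T\<^esub> s"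
      using v by (simp add: T.inv_mult pinv)
    moreover have "inv\<^bsub>?T\<^esub> s \<in> tensor_span k H (carrier H) (lspan F)" using a by simp
    ultimately show "inv\<^bsub>?T\<^esub> a \<in> ?U" using a H.a_inv_closed by blast
    fix b assume "b \<in> ?U"
    then obtain u' s' where b: "b = ?p u' v \<otimes>\<^bsub>?T\<^esub> s'" "u' \<in> carrier H" "s' \<in> tensor_span k H (carrier H) (lspan F)" by blast
    have "a \<otimes>\<^bsub>?T\<^esub> b = ?p (u \<oplus> u') v \<otimes>\<^bsub>?T\<^esub> (s \<otimes>\<^bsub>?T\<^esub> s')"
      using a b v p(2)[of u v u'] by (simp add: T.m_ac)
    moreover have "u \<oplus> u' \<in> carrier H" "s \<otimes>\<^bsub>?T\<^esub> s' \<in> tensor_span k H (carrier H) (lspan F)"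
      using a b by simp_all
    ultimately show "a \<otimes>\<^bsub>?T\<^esub> b \<in> ?U" by blast
  qed
  have mem: "?p x y \<in> ?U" if xy: "x \<in> carrier H" "y \<in> lspan (insert v F)" for x y
  proof -
    obtain c w where y: "y = c \<odot> v \<oplus> w" "c \<in> carrier k" "w \<in> lspan F"
      using xy(2) unfolding lspan_insert[OF F v] by blast
    then have "?p x y = ?p (c \<odot> x) v \<otimes>\<^bsub>?T\<^esub> ?p x w"
      using that v S(2) by (simp add: p)
    moreover have "c \<odot> x \<in> carrier H" "?p x w \<in> tensor_span k H (carrier H) (lspan F)"
      using that y pure_in_tensor_span[of x "carrier H" w "lspan F"] by simp_all
    ultimately show ?thesis by blast
  qed
  have "tensor_span k H (carrier H) (lspan (insert v F)) \<subseteq> ?U"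
    unfolding tensor_span_def[of k H "carrier H" "lspan (insert v F)"]
    by (rule T.generate_subgroup_incl[OF _ U]) (use mem in blast)
  then show ?thesis using t by blast
qed

lemma slice_hom: "f \<in> dual \<Longrightarrow> slice f \<in> hom (HH) (add_monoid H)"
  using bilinear_op_lhit by (intro HH.lift_hom H.a_comm_group bilinear_op_bilinear)

lemma slice_pure: "f \<in> dual \<Longrightarrow> x \<in> carrier H \<Longrightarrow> y \<in> carrier H \<Longrightarrow> slice f (pure x y) = f y \<odot> x"
  using HH.lift_pure[OF H.a_comm_group bilinear_op_bilinear[OF bilinear_op_lhit]] by simp

text \<open>Split off one generator \<open>v\<close> with its coefficient \<open>u\<close>. A
  functional that is one at \<open>v\<close> and zero on the span of the others has \<open>u\<close>
  as its slice, so \<open>u\<close> lies in \<open>C\<close>; the remaining tensor then also has all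
  its slices in \<open>C\<close>.\<close>

lemma slices_in_submodule:
  assumes C: "submodule C k H" and "finite F" "F \<subseteq> carrier H"
    and t: "t \<in> tensor_span k H (carrier H) (lspan F)"
    and slices: "\<And>f. f \<in> dual \<Longrightarrow> slice f t \<in> C"
  shows "t \<in> tensor_span k H C (lspan F)"
  using assms(2-)
proof (induction F arbitrary: t)
  case empty
  interpret T: comm_group "HH" by (rule HH.tensor_comm_group)
  note p = bilinearD[OF pure_bilinear]
  have "pure x \<zero> = \<one>\<^bsub>HH\<^esub>" if "x \<in> carrier H" for x
    using p(1)[of x "\<zero>"] p(3)[of x "\<zero>" "\<zero>"] that by simp
  then have "{pure x y | x y. x \<in> carrier H \<and> y \<in> {\<zero>}} \<subseteq> {\<one>\<^bsub>HH\<^esub>}" by blast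
  then have "tensor_span k H (carrier H) {\<zero>} \<subseteq> {\<one>\<^bsub>HH\<^esub>}"
    unfolding tensor_span_def by (intro T.generate_subgroup_incl T.triv_subgroup)
  then have "t = \<one>\<^bsub>HH\<^esub>" using empty by (auto simp: lspan_empty)
  then show ?case unfolding tensor_span_def by (simp add: generate.one)
next
  case (insert v F)
  interpret T: comm_group "HH" by (rule HH.tensor_comm_group)
  have v: "v \<in> carrier H" and F: "F \<subseteq> carrier H" using insert by auto
  note S = submodule_closed[OF lspan_submodule[OF F]] note Ccl = submodule_closed[OF C]
  have S': "submodule (lspan (insert v F)) k H" using v F by (intro lspan_submodule) auto
  have sub: "lspan F \<subseteq> lspan (insert v F)"
    by (rule lspan_least[OF S']) (use lspan_superset in blast)
  show ?case
  proof (cases "v \<in> lspan F")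
    case True
    then have "lspan (insert v F) = lspan F"
      using sub lspan_superset[of F] by (intro equalityI lspan_least[OF lspan_submodule[OF F]]) auto
    then show ?thesis using insert F by auto
  next
    case False
    obtain u s where us: "u \<in> carrier H" "s \<in> tensor_span k H (carrier H) (lspan F)"
      "t = pure u v \<otimes>\<^bsub>HH\<^esub> s"
      using tensor_span_insert[OF v F insert.prems(2)] by blast
    have s: "s \<in> carrier (HH)"
      using us(2) subgroup.subset[OF tensor_span_subgroup[of "carrier H" "lspan F"]] S(2) by blast
    have slice_t: "slice f t = f v \<odot> u \<oplus> slice f s" if f: "f \<in> dual" for f
      using slice_hom[OF f] us s v f by (simp add: hom_def slice_pure)
    have slice_closed: "slice f s \<in> carrier H" if "f \<in> dual" for f
      using slice_hom[OF that] s by (auto simp: hom_def)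
    obtain g where g: "g \<in> dual" "\<And>w. w \<in> lspan F \<Longrightarrow> g w = \<zero>\<^bsub>k\<^esub>" "g v = \<one>\<^bsub>k\<^esub>"
      using ex_separating[OF lspan_submodule[OF F] v False] by blast
    have "slice g s \<in> {\<zero>}"
      using us(2) g S(2) bilinear_op_lhit[OF g(1)] submodule_zero
      by (intro HH.lift_mem[where C = "carrier H" and D = "lspan F"] H.a_comm_group bilinear_op_bilinear)
        (auto simp: tensor_span_def submodule_def)
    then have u: "u \<in> C" using insert.prems(3)[OF g(1)] slice_t[OF g(1)] g us(1) by simp
    have "slice f s \<in> C" if f: "f \<in> dual" for f
    proof -
      have "slice f t \<ominus> f v \<odot> u \<in> C" using insert.prems(3)[OF f] f v u Ccl by simp
      also have "slice f t \<ominus> f v \<odot> u = slice f s"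
        using slice_t[OF f] slice_closed[OF f] f v us(1) by (simp add: a_minus_def H.a_ac H.r_neg1 H.r_neg2)
      finally show ?thesis .
    qed
    then have "s \<in> tensor_span k H C (lspan F)" using insert.IH[OF F us(2)] by blast
    then have "s \<in> tensor_span k H C (lspan (insert v F))" using tensor_span_mono[OF order_refl[of C] sub] by blast
    moreover have "pure u v \<in> tensor_span k H C (lspan (insert v F))"
      using u lspan_superset[of "insert v F"] by (intro pure_in_tensor_span) auto
    ultimately show ?thesis unfolding us(3) tensor_span_def by (intro generate.eng)
  qed
qed

text \<open>The tensor \<open>(id \<otimes> g)(\<Delta> x)\<close>.\<close>

abbreviation sw_pure :: "('h \<Rightarrow> 'h) \<Rightarrow> 'h \<Rightarrow> ('h \<times> 'h \<Rightarrow>\<^sub>0 int) set"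
  where "sw_pure g x \<equiv> sw (HH) (\<lambda>a b. pure a (g b)) x"

lemma bilinear_sw_pure: "linear g \<Longrightarrow> bilinear (HH) (\<lambda>a b. pure a (g b))"
  using pure_bilinear by (auto simp: balanced_def linear_add linear_smult)

lemma slice_sw_pure:
  assumes "linear g" "f \<in> dual" "x \<in> carrier H"
  shows "slice f (sw_pure g x) = lhit (\<lambda>z. f (g z)) x"
proof -
  have "slice f (sw_pure g x) = swH (\<lambda>a b. slice f (pure a (g b))) x"
    using assms by (intro sw_comp slice_hom bilinear_sw_pure HH.tensor_comm_group H.a_comm_group)
  also have "\<dots> = lhit (\<lambda>z. f (g z)) x"
    unfolding lhit_def using assms dual_comp
    by (intro swH_cong[symmetric] bilinear_op_lhit) (auto simp: slice_pure)
  finally show ?thesis .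
qed

text \<open>The slices of this tensor are the elements in the last hypothesis, which puts the first
  legs into \<open>C\<close>; \<open>E\<close> puts the second legs into \<open>D\<close>. The slice
  criterion asks for a finite set of second legs, and every single tensor supplies one.\<close>

lemma sw_pure_mem:
  assumes g: "linear g" and C: "submodule C k H" and D: "submodule D k H" and x: "x \<in> carrier H"
    and E: "E \<subseteq> carrier H" "comult H x \<in> tensor_span k H (carrier H) E" "g ` E \<subseteq> D"
    and lhit: "\<And>f. f \<in> dual \<Longrightarrow> lhit (\<lambda>z. f (g z)) x \<in> C"
  shows "sw_pure g x \<in> tensor_span k H C D"
proof -
  note Dcl = submodule_closed[OF D]
  have "sw_pure g x \<in> tensor_span k H (carrier H) D"
    using g E Dcl(2)
    by (intro sw_mem[OF HH.tensor_comm_group bilinear_sw_pure[OF g] tensor_span_subgroup _ order_refl E(1,2)])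
      (auto intro: pure_in_tensor_span)
  from tensor_span_finite(1)[OF this] obtain F
    where F: "finite F" "F \<subseteq> D" "sw_pure g x \<in> tensor_span k H (carrier H) F" by blast
  have FH: "F \<subseteq> carrier H" using F(2) Dcl(2) by blast
  have "sw_pure g x \<in> tensor_span k H (carrier H) (lspan F)"
    using F(3) tensor_span_mono[OF order_refl[of "carrier H"] lspan_superset[of F]] by blast
  then have "sw_pure g x \<in> tensor_span k H C (lspan F)"
    using lhit g x by (intro slices_in_submodule[OF C F(1) FH]) (auto simp: slice_sw_pure)
  then show ?thesis using tensor_span_mono[OF order_refl[of C] lspan_least[OF D F(2)]] by blast
qed

text \<open>The bridge from the action of functionals to Sweedler sums: \<open>b\<close> is applied
  to the tensor that \<open>sw_pure_mem\<close> places in \<open>C \<otimes> D\<close>. The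
  filtration arguments below rest on it.\<close>

lemma swH_slice_mem:
  assumes b: "bilinear_op b" and g: "linear g" and C: "submodule C k H" and D: "submodule D k H"
    and W: "submodule W k H" and x: "x \<in> carrier H"
    and E: "E \<subseteq> carrier H" "comult H x \<in> tensor_span k H (carrier H) E" "g ` E \<subseteq> D"
    and lhit: "\<And>f. f \<in> dual \<Longrightarrow> lhit (\<lambda>z. f (g z)) x \<in> C"
    and bW: "\<And>c d. c \<in> C \<Longrightarrow> d \<in> D \<Longrightarrow> b c d \<in> W"
  shows "swH (\<lambda>u v. b u (g v)) x \<in> W"
proof -
  note bil = bilinear_op_bilinear[OF b]
  have "tensor_lift (add_monoid H) b (sw_pure g x) = swH (\<lambda>u v. tensor_lift (add_monoid H) b (pure u (g v))) x"
    by (rule sw_comp[OF HH.tensor_comm_group H.a_comm_group bilinear_sw_pure[OF g] HH.lift_hom[OF H.a_comm_group bil] x])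
  also have "\<dots> = swH (\<lambda>u v. b u (g v)) x"
  proof (rule swH_cong[OF _ x, symmetric])
    show "bilinear_op (\<lambda>u v. b u (g v))"
      using linear_comp[OF bilinear_opD(2)[OF b] g] bilinear_opD(1)[OF b] g by (intro bilinear_opI) auto
  qed (use g in \<open>simp add: HH.lift_pure[OF H.a_comm_group bil]\<close>)
  finally have "tensor_lift (add_monoid H) b (sw_pure g x) = swH (\<lambda>u v. b u (g v)) x" .
  moreover have "tensor_lift (add_monoid H) b (sw_pure g x) \<in> W"
    using sw_pure_mem[OF g C D x E lhit] bW submodule_closed(2)[OF C] submodule_closed(2)[OF D]
    by (intro HH.lift_mem[OF H.a_comm_group bil submodule.axioms(1)[OF W], of C D]) (auto simp: tensor_span_def)
  ultimately show ?thesis by simp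
qed

text \<open>Submodules over the dual algebra. The left stable subspaces are the right coideals, with
  \<Delta> C in \<open>C \<otimes> H\<close>; the right stable ones are the left coideals.\<close>

definition left_stable :: "'h set \<Rightarrow> bool"
  where "left_stable C \<longleftrightarrow> submodule C k H \<and> (\<forall>f \<in> dual. \<forall>x \<in> C. lhit f x \<in> C)"

definition right_stable :: "'h set \<Rightarrow> bool"
  where "right_stable C \<longleftrightarrow> submodule C k H \<and> (\<forall>f \<in> dual. \<forall>x \<in> C. rhit f x \<in> C)"

lemma swH_mem:
  assumes "bilinear_op b" "submodule W k H" "C \<subseteq> carrier H" "D \<subseteq> carrier H"
    "comult H x \<in> tensor_span k H C D" "\<And>u v. u \<in> C \<Longrightarrow> v \<in> D \<Longrightarrow> b u v \<in> W"
  shows "swH b x \<in> W"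
  using assms by (intro sw_mem[OF H.a_comm_group bilinear_op_bilinear submodule.axioms(1)])

lemma subcoalgebraD:
  assumes "subcoalgebra k H C"
  shows "submodule C k H" "\<And>x. x \<in> C \<Longrightarrow> comult H x \<in> tensor_span k H C C"
    "\<And>x. x \<in> C \<Longrightarrow> x \<in> carrier H"
  using assms submodule_closed(2) by (auto simp: subcoalgebra_def)

lemma subcoalgebra_stable:
  assumes C: "subcoalgebra k H C" shows "left_stable C" "right_stable C"
  unfolding left_stable_def right_stable_def lhit_def rhit_def
proof (safe intro!: subcoalgebraD[OF C])
  note C' = subcoalgebraD[OF C]
  fix f x assume "f \<in> dual" "x \<in> C"
  then show "swH (\<lambda>a b. f b \<odot> a) x \<in> C" "swH (\<lambda>a b. f a \<odot> b) x \<in> C"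
    using C'(3) submodule_closed(6)[OF C'(1)]
    by (intro swH_mem[OF _ C'(1) _ _ C'(2)] bilinear_op_lhit bilinear_op_rhit; auto)+
qed

lemma comult_in_tensor_span:
  assumes "submodule C k H" "x \<in> carrier H" "\<And>f. f \<in> dual \<Longrightarrow> lhit f x \<in> C"
  shows "comult H x \<in> tensor_span k H C (carrier H)"
proof -
  have "sw_pure (\<lambda>z. z) x \<in> tensor_span k H C (carrier H)"
    using assms tensor_span_carrier
    by (intro sw_pure_mem[where E = "carrier H"] linear_id carrier_is_submodule) auto
  moreover have "sw_pure (\<lambda>z. z) x = comult H x"
    unfolding sw_def using assms pure_bilinear
    by (intro HH.lift_unique[symmetric, where f = "\<lambda>t. t"] HH.tensor_comm_group) (auto simp: hom_def)
  ultimately show ?thesis by simp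
qed

text \<open>The intersection of \<open>C \<otimes> H\<close> and \<open>H \<otimes> C\<close> is
  \<open>C \<otimes> C\<close>. Let \<open>p\<close> project onto \<open>C\<close>. Right stability
  kills \<open>(id \<otimes> (id - p))(\<Delta> x)\<close>, so the second legs may be projected by
  \<open>p\<close>; left stability then puts the first legs into \<open>C\<close>.\<close>

lemma stable_subcoalgebra:
  assumes l: "left_stable C" and r: "right_stable C" shows "subcoalgebra k H C"
  unfolding subcoalgebra_def
proof safe
  show C: "submodule C k H" using l by (simp add: left_stable_def)
  note Ccl = submodule_closed[OF C]
  obtain p where p: "linear p" "\<And>w. w \<in> C \<Longrightarrow> p w = w" "\<And>v. v \<in> carrier H \<Longrightarrow> p v \<in> C"
    using ex_projection[OF C] by blast
  interpret T: comm_group "HH" by (rule HH.tensor_comm_group)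
  fix x assume xC: "x \<in> C"
  then have x: "x \<in> carrier H" by (rule Ccl(2))
  let ?q = "\<lambda>z. z \<ominus> p z"
  have q: "linear ?q" by (intro linear_intros p)
  have "lhit (\<lambda>z. f (?q z)) x \<in> {\<zero>}" if f: "f \<in> dual" for f
  proof -
    have fq: "(\<lambda>z. f (?q z)) \<in> dual" by (rule dual_comp[OF f q])
    have "lhit (\<lambda>z. f (?q z)) x = \<zero>"
    proof (rule dual_separates)
      fix g assume g: "g \<in> dual"
      then have "rhit g x \<in> C" using r xC by (simp add: right_stable_def)
      then have "f (?q (rhit g x)) = \<zero>\<^bsub>k\<^esub>" using p(2) Ccl(2) f by simp
      then show "g (lhit (\<lambda>z. f (?q z)) x) = g \<zero>"
        using dual_hit[OF fq g x] g by simp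
    qed (use fq x in auto)
    then show ?thesis by simp
  qed
  then have "sw_pure ?q x \<in> tensor_span k H {\<zero>} (carrier H)"
    using x tensor_span_carrier q linear_closed[OF q]
    by (intro sw_pure_mem[where E = "carrier H"] submodule_zero carrier_is_submodule) (auto simp del: H.minus_closed)
  moreover have "tensor_span k H {\<zero>} (carrier H) \<subseteq> {\<one>\<^bsub>HH\<^esub>}"
  proof -
    have "pure \<zero> y = \<one>\<^bsub>HH\<^esub>" if "y \<in> carrier H" for y
      using bilinearD(1)[OF pure_bilinear, of "\<zero>" y]
        bilinearD(2)[OF pure_bilinear, of "\<zero>" y "\<zero>"] that by simp
    then show ?thesis
      unfolding tensor_span_def by (intro T.generate_subgroup_incl T.triv_subgroup) auto
  qed
  ultimately have 0: "sw_pure ?q x = \<one>\<^bsub>HH\<^esub>" by blast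
  note bil = bilinear_sw_pure[OF p(1)] bilinear_sw_pure[OF q]
  have "comult H x = sw (HH) (\<lambda>a b. pure a (p b) \<otimes>\<^bsub>HH\<^esub> pure a (?q b)) x"
    unfolding sw_def
  proof (rule HH.lift_unique[where f = "\<lambda>t. t"])
    show "bilinear (HH) (\<lambda>a b. pure a (p b) \<otimes>\<^bsub>HH\<^esub> pure a (?q b))"
      by (rule HH.lift_mult(2)[OF HH.tensor_comm_group bil, of "comult H x"]) (use x in simp)
    fix a b assume ab: "a \<in> carrier H" "b \<in> carrier H"
    have "p b \<oplus> ?q b = b" using ab p(1) by (simp add: a_minus_def H.a_ac H.r_neg1 H.r_neg2 H.r_neg)
    then show "pure a b = pure a (p b) \<otimes>\<^bsub>HH\<^esub> pure a (?q b)"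
      using bilinearD(3)[OF pure_bilinear, of a "p b" "?q b"] ab p(1) by simp
  qed (use x HH.tensor_comm_group in \<open>auto simp: hom_def\<close>)
  also have "\<dots> = sw_pure p x"
    using sw_op[OF HH.tensor_comm_group bil x] 0 sw_closed[OF HH.tensor_comm_group bil(1) x] by simp
  also have "\<dots> \<in> tensor_span k H C C"
    using p x xC l dual_comp[OF _ p(1)] tensor_span_carrier
    by (intro sw_pure_mem[where E = "carrier H"] C) (auto simp: left_stable_def)
  finally show "comult H x \<in> tensor_span k H C C" .
qed

lemma left_stableD:
  assumes "left_stable C"
  shows "submodule C k H" "\<And>f x. f \<in> dual \<Longrightarrow> x \<in> C \<Longrightarrow> lhit f x \<in> C" "\<And>x. x \<in> C \<Longrightarrow> x \<in> carrier H"
  using assms submodule_closed(2) by (auto simp: left_stable_def)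

lemma right_stableD:
  assumes "right_stable C"
  shows "submodule C k H" "\<And>f x. f \<in> dual \<Longrightarrow> x \<in> C \<Longrightarrow> rhit f x \<in> C" "\<And>x. x \<in> C \<Longrightarrow> x \<in> carrier H"
  using assms submodule_closed(2) by (auto simp: right_stable_def)

lemma left_stable_Int: "left_stable C \<Longrightarrow> left_stable D \<Longrightarrow> left_stable (C \<inter> D)"
  by (auto simp: left_stable_def submodule_Int)

lemma dual_counit_lhit: "f \<in> dual \<Longrightarrow> x \<in> carrier H \<Longrightarrow> \<epsilon> (lhit f x) = f x"
  using dual_hit[OF _ counit_dual] by (simp add: rhit_counit)

lemma lspan_left_stable:
  assumes "S \<subseteq> carrier H" "\<And>f x. f \<in> dual \<Longrightarrow> x \<in> S \<Longrightarrow> lhit f x \<in> lspan S"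
  shows "left_stable (lspan S)"
  unfolding left_stable_def
proof (intro conjI ballI lspan_submodule[OF assms(1)])
  fix f x assume f: "f \<in> dual" and x: "x \<in> lspan S"
  have "submodule {v \<in> carrier H. lhit f v \<in> lspan S} k H"
    by (rule submodule_vimage[OF linear_lhit[OF f] carrier_is_submodule lspan_submodule[OF assms(1)]])
  then have "lspan S \<subseteq> {v \<in> carrier H. lhit f v \<in> lspan S}"
    using assms f by (intro lspan_least) auto
  then show "lhit f x \<in> lspan S" using x by blast
qed

lemma lspan_right_stable:
  assumes "S \<subseteq> carrier H" "\<And>f x. f \<in> dual \<Longrightarrow> x \<in> S \<Longrightarrow> rhit f x \<in> lspan S"
  shows "right_stable (lspan S)"
  unfolding right_stable_def
proof (intro conjI ballI lspan_submodule[OF assms(1)])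
  fix f x assume f: "f \<in> dual" and x: "x \<in> lspan S"
  have "submodule {v \<in> carrier H. rhit f v \<in> lspan S} k H"
    by (rule submodule_vimage[OF linear_rhit[OF f] carrier_is_submodule lspan_submodule[OF assms(1)]])
  then have "lspan S \<subseteq> {v \<in> carrier H. rhit f v \<in> lspan S}"
    using assms f by (intro lspan_least) auto
  then show "rhit f x \<in> lspan S" using x by blast
qed

subsection \<open>The coradical and the wedge filtration\<close>

text \<open>The subcoalgebra generated by the right coideal \<open>T\<close>: any subcoalgebra
  containing \<open>T\<close> is closed under right translation.\<close>

definition right_translates :: "'h set \<Rightarrow> 'h set"
  where "right_translates T = lspan {rhit f t | f t. f \<in> dual \<and> t \<in> T}"

lemma right_translates:
  assumes T: "left_stable T"
  shows "subcoalgebra k H (right_translates T)" "T \<subseteq> right_translates T"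
proof -
  note T' = left_stableD[OF T]
  let ?S = "{rhit f t | f t. f \<in> dual \<and> t \<in> T}"
  have S: "?S \<subseteq> carrier H" using T'(3) by auto
  have "lhit f x \<in> ?S" if "f \<in> dual" "x \<in> ?S" for f x
  proof -
    obtain g t where *: "x = rhit g t" "g \<in> dual" "t \<in> T" using \<open>x \<in> ?S\<close> by auto
    then have "lhit f x = rhit g (lhit f t)" using that(1) T'(3) by (simp add: lhit_rhit)
    then show ?thesis using T'(2)[OF that(1) *(3)] *(2) by blast
  qed
  moreover have "rhit f x \<in> ?S" if "f \<in> dual" "x \<in> ?S" for f x
  proof -
    obtain g t where *: "x = rhit g t" "g \<in> dual" "t \<in> T" using \<open>x \<in> ?S\<close> by auto
    then have "rhit f x = rhit (\<lambda>y. f (rhit g y)) t" using that(1) T'(3) by (simp add: rhit_rhit)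
    then show ?thesis using dual_comp[OF that(1) linear_rhit[OF *(2)]] * by blast
  qed
  ultimately show "subcoalgebra k H (right_translates T)"
    unfolding right_translates_def using lspan_superset[of ?S]
    by (intro stable_subcoalgebra lspan_left_stable lspan_right_stable S) blast+
  show "T \<subseteq> right_translates T"
  proof
    fix t assume t: "t \<in> T"
    then have "t = rhit \<epsilon> t" using T'(3) by (simp add: rhit_counit)
    then have "t \<in> ?S" using t counit_dual by blast
    then show "t \<in> right_translates T" unfolding right_translates_def using lspan_superset[of ?S] by blast
  qed
qed

text \<open>The functionals form a list because its length, the number of summands, is the induction
  measure in \<open>ex_translate_in_subcomodule\<close>.\<close>

primrec translate_sum :: "'h set \<Rightarrow> ('h \<Rightarrow> 'k) list \<Rightarrow> 'h set" where
  "translate_sum T [] = {\<zero>}"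
| "translate_sum T (f # fs) = {rhit f t \<oplus> z | t z. t \<in> T \<and> z \<in> translate_sum T fs}"

lemma left_stable_zero: "left_stable {\<zero>}"
  by (auto simp: left_stable_def submodule_zero linear_zero[OF linear_lhit])

lemma translate_sum_left_stable:
  assumes T: "left_stable T" and fs: "set fs \<subseteq> dual" shows "left_stable (translate_sum T fs)"
  using fs
proof (induction fs)
  case Nil
  then show ?case by (simp add: left_stable_zero)
next
  case (Cons f fs)
  note T' = left_stableD[OF T] note Tcl = submodule_closed[OF T'(1)]
  have f: "f \<in> dual" and Z: "left_stable (translate_sum T fs)" using Cons by auto
  note Z' = left_stableD[OF Z] note Zcl = submodule_closed[OF Z'(1)]
  note lin = linear_rhit[OF f]
  have mem: "rhit f t \<oplus> z \<in> translate_sum T (f # fs)" if "t \<in> T" "z \<in> translate_sum T fs" for t z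
    using that by auto
  show ?case unfolding left_stable_def
  proof (intro conjI ballI submoduleI')
    show "translate_sum T (f # fs) \<subseteq> carrier H" using f Tcl(2) Zcl(2) by auto
    show "\<zero> \<in> translate_sum T (f # fs)" using mem[OF Tcl(1) Zcl(1)] linear_zero[OF lin] by simp
    fix x y assume "x \<in> translate_sum T (f # fs)" "y \<in> translate_sum T (f # fs)"
    then obtain t z t' z' where *: "x = rhit f t \<oplus> z" "y = rhit f t' \<oplus> z'" "t \<in> T" "t' \<in> T"
      "z \<in> translate_sum T fs" "z' \<in> translate_sum T fs" by auto
    then have "x \<oplus> y = rhit f (t \<oplus> t') \<oplus> (z \<oplus> z')"
      using f Tcl(2) Zcl(2) by (simp add: linear_add[OF lin] H.a_ac)
    then show "x \<oplus> y \<in> translate_sum T (f # fs)" using mem[OF Tcl(3) Zcl(3)] * by metis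
  next
    fix c x assume c: "c \<in> carrier k" and "x \<in> translate_sum T (f # fs)"
    then obtain t z where *: "x = rhit f t \<oplus> z" "t \<in> T" "z \<in> translate_sum T fs" by auto
    then have "c \<odot> x = rhit f (c \<odot> t) \<oplus> c \<odot> z"
      using c f Tcl(2) Zcl(2) by (simp add: linear_smult[OF lin] smult_r_distr)
    then show "c \<odot> x \<in> translate_sum T (f # fs)" using mem[OF Tcl(6) Zcl(6)] * c by metis
  next
    fix g x assume g: "g \<in> dual" and "x \<in> translate_sum T (f # fs)"
    then obtain t z where *: "x = rhit f t \<oplus> z" "t \<in> T" "z \<in> translate_sum T fs" by auto
    then have "lhit g x = rhit f (lhit g t) \<oplus> lhit g z"
      using g f Tcl(2) Zcl(2) by (simp add: linear_add[OF linear_lhit[OF g]] lhit_rhit)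
    then show "lhit g x \<in> translate_sum T (f # fs)" using mem[OF T'(2) Z'(2)] * g by metis
  qed
qed

lemma translate_sum_append:
  assumes "T \<subseteq> carrier H" "set fs \<subseteq> dual" "set gs \<subseteq> dual" "x \<in> translate_sum T fs" "y \<in> translate_sum T gs"
    "left_stable T"
  shows "x \<oplus> y \<in> translate_sum T (fs @ gs)"
  using assms(2,4)
proof (induction fs arbitrary: x)
  case Nil
  then show ?case using assms(5) left_stableD(3)[OF translate_sum_left_stable[OF assms(6,3)]] by simp
next
  case (Cons f fs)
  then obtain t z where *: "x = rhit f t \<oplus> z" "t \<in> T" "z \<in> translate_sum T fs" by auto
  have cl: "rhit f t \<in> carrier H" "z \<in> carrier H" "y \<in> carrier H"
    using * Cons.prems assms left_stableD(3)[OF translate_sum_left_stable[OF assms(6,3)]]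
      left_stableD(3)[OF translate_sum_left_stable[OF assms(6), of fs]] by auto
  then have "x \<oplus> y = rhit f t \<oplus> (z \<oplus> y)" by (simp add: * H.a_assoc)
  moreover have "z \<oplus> y \<in> translate_sum T (fs @ gs)" using Cons * by auto
  ultimately show ?case using * by auto
qed

lemma right_translates_sum:
  assumes T: "left_stable T" and x: "x \<in> right_translates T"
  shows "\<exists>fs. set fs \<subseteq> dual \<and> x \<in> translate_sum T fs"
proof -
  note T' = left_stableD[OF T]
  have TH: "T \<subseteq> carrier H" using T'(3) by blast
  note st = left_stableD[OF translate_sum_left_stable[OF T]]
  let ?W = "{x. \<exists>fs. set fs \<subseteq> dual \<and> x \<in> translate_sum T fs}"
  have "submodule ?W k H"
  proof (rule submoduleI')
    show "?W \<subseteq> carrier H" using st(3) by blast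
    show "\<zero> \<in> ?W" by (auto intro: exI[of _ "[]"])
    fix x y assume "x \<in> ?W" "y \<in> ?W"
    then obtain fs gs where "set fs \<subseteq> dual" "set gs \<subseteq> dual" "x \<in> translate_sum T fs" "y \<in> translate_sum T gs" by blast
    then show "x \<oplus> y \<in> ?W" using translate_sum_append[OF TH _ _ _ _ T, of fs gs x y]
      by (intro CollectI exI[of _ "fs @ gs"]) simp
  next
    fix c x assume c: "c \<in> carrier k" and "x \<in> ?W"
    then show "c \<odot> x \<in> ?W" using submodule_closed(6)[OF st(1)] by blast
  qed
  moreover have "{rhit f t | f t. f \<in> dual \<and> t \<in> T} \<subseteq> ?W"
  proof clarify
    fix f t assume "f \<in> dual" "t \<in> T"
    then show "\<exists>fs. set fs \<subseteq> dual \<and> rhit f t \<in> translate_sum T fs"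
      using TH by (intro exI[of _ "[f]"]) force
  qed
  ultimately show ?thesis using x lspan_least unfolding right_translates_def by blast
qed

text \<open>
  The induction shortens a nonzero element of \<open>D\<close> written as \<open>\<Sum>\<^sub>i t\<^sub>i \<leftharpoonup> f\<^sub>i\<close>
  until its annihilator contains that of \<open>t\<^sub>1\<close>.
\<close>

lemma ex_translate_in_subcomodule:
  assumes T: "left_stable T" and D: "left_stable D" and "set fs \<subseteq> dual" "d \<in> D" "d \<in> translate_sum T fs" "d \<noteq> \<zero>"
  shows "\<exists>f \<in> dual. \<exists>t \<in> T. rhit f t \<in> D \<and> rhit f t \<noteq> \<zero>"
  using assms(3-)
proof (induction fs arbitrary: d)
  case Nil
  then show ?case by simp
next
  case (Cons f fs)
  note T' = left_stableD[OF T] and D' = left_stableD[OF D]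
  have f: "f \<in> dual" and fs: "set fs \<subseteq> dual" using Cons by auto
  note Z' = left_stableD[OF translate_sum_left_stable[OF T fs]]
  obtain t z where d: "d = rhit f t \<oplus> z" "t \<in> T" "z \<in> translate_sum T fs" using Cons by auto
  show ?case
  proof (cases "\<exists>g \<in> dual. lhit g t = \<zero> \<and> lhit g d \<noteq> \<zero>")
    case True
    then obtain g where g: "g \<in> dual" "lhit g t = \<zero>" "lhit g d \<noteq> \<zero>" by blast
    have "lhit g d = rhit f (lhit g t) \<oplus> lhit g z"
      using g f d T'(3) Z'(3) by (simp add: linear_add[OF linear_lhit] lhit_rhit)
    then have "lhit g d = lhit g z" using g d Z'(3) by (simp add: linear_zero[OF linear_rhit[OF f]])
    then have "lhit g d \<in> translate_sum T fs" using Z'(2) d g by simp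
    then show ?thesis using Cons.IH[OF fs D'(2)[OF g(1) Cons.prems(2)]] g by blast
  next
    case False
    have "\<exists>g \<in> dual. rhit g t = d"
    proof (rule ex_rhit)
      show "t \<in> carrier H" "d \<in> carrier H" using T' D' d Cons by auto
      then show "g d = \<zero>\<^bsub>k\<^esub>" if "g \<in> dual" "lhit g t = \<zero>" for g
        using False that dual_counit_lhit[of g d] counit_dual by auto
    qed
    then show ?thesis using d Cons.prems by blast
  qed
qed

text \<open>The subcoalgebra generated by a simple right coideal is simple: a nonzero subcoalgebra
  \<open>D\<close> of it contains a nonzero translate of an element of \<open>T\<close>. Translating
  back shows that \<open>T\<close> meets \<open>D\<close>, and then \<open>D\<close> contains all of
  \<open>T\<close>.\<close>

lemma simple_comodule_in_coradical:
  assumes T: "left_stable T" "T \<noteq> {\<zero>}"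
    and simple: "\<And>P. left_stable P \<Longrightarrow> P \<subseteq> T \<Longrightarrow> P = {\<zero>} \<or> P = T"
  shows "T \<subseteq> coradical k H"
proof -
  note T' = left_stableD[OF T(1)] note Tcl = submodule_closed[OF T'(1)]
  let ?C = "right_translates T"
  note C = right_translates[OF T(1)]
  have sub: "?C \<subseteq> D" if D: "subcoalgebra k H D" "D \<subseteq> ?C" "D \<noteq> {\<zero>}" for D
  proof -
    note Dl = subcoalgebra_stable(1)[OF D(1)] and Dr = subcoalgebra_stable(2)[OF D(1)]
    note D' = left_stableD[OF Dl] and D'' = right_stableD[OF Dr]
    obtain d where d: "d \<in> D" "d \<noteq> \<zero>" using D(3) submodule_closed(1)[OF D'(1)] by blast
    then have "d \<in> ?C" using D(2) by blast
    from right_translates_sum[OF T(1) this] obtain fs where "set fs \<subseteq> dual" "d \<in> translate_sum T fs" by blast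
    from ex_translate_in_subcomodule[OF T(1) Dl this(1) d(1) this(2) d(2)] obtain f t
      where f: "f \<in> dual" "t \<in> T" "rhit f t \<in> D" "rhit f t \<noteq> \<zero>" by blast
    have tH: "t \<in> carrier H" using f T' by blast
    have t0: "t \<noteq> \<zero>" using f linear_zero[OF linear_rhit] by auto
    \<comment> \<open>The kernel of the translation by \<open>f\<close> on \<open>T\<close> is
      stable and omits \<open>t\<close>, so simplicity makes the translation injective on
      \<open>T\<close>.\<close>
    let ?K = "{s \<in> T. rhit f s \<in> {\<zero>}}"
    have "left_stable ?K"
      using submodule_vimage[OF linear_rhit[OF f(1)] T'(1) submodule_zero] T' f(1)
      by (auto simp: left_stable_def linear_zero[OF linear_lhit] simp flip: lhit_rhit)
    then have K: "?K = {\<zero>}" using simple[of ?K] f by blast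
    \<comment> \<open>Injectivity provides the annihilator condition of \<open>ex_rhit\<close>,
      which yields a functional undoing the translation at \<open>t\<close>.\<close>
    have "\<exists>g \<in> dual. rhit g (rhit f t) = t"
    proof (rule ex_rhit)
      fix g assume g: "g \<in> dual" "lhit g (rhit f t) = \<zero>"
      then have "lhit g t \<in> ?K" using f T' by (simp add: lhit_rhit)
      then have "lhit g t = \<zero>" using K by blast
      then show "g t = \<zero>\<^bsub>k\<^esub>" using dual_counit_lhit[OF g(1) tH] counit_dual by simp
    qed (use f tH in auto)
    then obtain g where g: "g \<in> dual" "rhit g (rhit f t) = t" by blast
    have "t \<in> T \<inter> D" using D''(2)[OF g(1) f(3)] g(2) f(2) by simp
    then have "T \<inter> D = T" using simple[OF left_stable_Int[OF T(1) Dl]] t0 by auto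
    then have "{rhit f t | f t. f \<in> dual \<and> t \<in> T} \<subseteq> D" using D''(2) by blast
    then show ?thesis unfolding right_translates_def by (rule lspan_least[OF D'(1)])
  qed
  have "?C \<noteq> {\<zero>}" using T(2) C(2) Tcl(1) by blast
  then have "simple_subcoalgebra k H ?C" unfolding simple_subcoalgebra_def using C(1) sub by blast
  then have "x \<in> coradical k H" if "x \<in> ?C" for x
    unfolding coradical_def using that by (intro generate.incl) blast
  then show ?thesis using C(2) by blast
qed

text \<open>
  The elements annihilated by \<open>(A\<^sup>\<bottom>)\<^sup>n\<close>, where \<open>A\<^sup>\<bottom>\<close> is the annihilator of \<open>A\<close> in the dual algebra.
  For a subcoalgebra \<open>A\<close> this is the \<open>n\<close>-fold wedge power of \<open>A\<close>.
\<close>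

primrec fil :: "'h set \<Rightarrow> nat \<Rightarrow> 'h set" where
  "fil A 0 = {\<zero>}"
| "fil A (Suc n) = {x \<in> carrier H. \<forall>f \<in> dual. (\<forall>a \<in> A. f a = \<zero>\<^bsub>k\<^esub>) \<longrightarrow> lhit f x \<in> fil A n}"

lemma fil_submodule: "submodule (fil A n) k H"
proof (induction n)
  case 0
  then show ?case by (simp add: submodule_zero)
next
  case (Suc n)
  note cl = submodule_closed[OF Suc]
  show ?case
    using cl by (intro submoduleI') (auto simp: linear_zero[OF linear_lhit] linear_add[OF linear_lhit] linear_smult[OF linear_lhit])
qed

lemma fil_Suc: "fil A n \<subseteq> fil A (Suc n)"
proof (induction n)
  case 0
  then show ?case by (auto simp: linear_zero[OF linear_lhit])
qed auto

lemma fil_mono: "m \<le> n \<Longrightarrow> fil A m \<subseteq> fil A n"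
  by (rule lift_Suc_mono_le[of "fil A"]) (rule fil_Suc)

text \<open>If \<open>f\<close> vanishes on the stable subspace \<open>A\<close>, so does its
  convolution product \<open>f * g\<close> with any \<open>g\<close>. Hence acting by
  \<open>g\<close> first and by \<open>f\<close> afterwards still lowers the degree by one.\<close>

lemma fil_left_stable:
  assumes "left_stable A" shows "left_stable (fil A n)"
proof (cases n)
  case 0
  then show ?thesis by (simp add: left_stable_zero)
next
  case (Suc m)
  have "lhit g x \<in> fil A n" if g: "g \<in> dual" and x: "x \<in> fil A n" for g x
  proof -
    have "lhit f (lhit g x) \<in> fil A m" if f: "f \<in> dual" "\<forall>a \<in> A. f a = \<zero>\<^bsub>k\<^esub>" for f
    proof -
      have "lhit f (lhit g x) = lhit (\<lambda>y. f (lhit g y)) x"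
        using f g x Suc by (simp add: lhit_lhit)
      moreover have "\<forall>a \<in> A. f (lhit g a) = \<zero>\<^bsub>k\<^esub>" using f left_stableD(2)[OF assms g] by simp
      ultimately show ?thesis using x Suc dual_comp[OF f(1) linear_lhit[OF g]] by auto
    qed
    then show ?thesis using x g Suc by auto
  qed
  then show ?thesis by (simp add: left_stable_def fil_submodule)
qed

text \<open>The degree is shifted so that \<open>A\<close> itself sits in degree one. A functional
  separating \<open>x\<close> from \<open>A\<close> acts nontrivially on \<open>x\<close>, as the
  counit of the result is its value at \<open>x\<close>; conversely, \<open>dual_hit\<close> moves
  the test back into \<open>A\<close>.\<close>

lemma fil_one:
  assumes A: "right_stable A" shows "fil A (Suc 0) = A"
proof
  note A' = right_stableD[OF A]
  show "fil A (Suc 0) \<subseteq> A"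
  proof
    fix x assume x: "x \<in> fil A (Suc 0)"
    then have xH: "x \<in> carrier H" by simp
    show "x \<in> A"
    proof (rule ccontr)
      assume "x \<notin> A"
      from ex_separating[OF A'(1) xH this] obtain f
        where f: "f \<in> dual" "\<And>w. w \<in> A \<Longrightarrow> f w = \<zero>\<^bsub>k\<^esub>" "f x = \<one>\<^bsub>k\<^esub>" by blast
      then have "lhit f x = \<zero>" using x by auto
      then show False using dual_counit_lhit[OF f(1) xH] f(3) counit_dual by simp
    qed
  qed
  show "A \<subseteq> fil A (Suc 0)"
  proof
    fix a assume a: "a \<in> A"
    have "lhit f a = \<zero>" if f: "f \<in> dual" "\<forall>a \<in> A. f a = \<zero>\<^bsub>k\<^esub>" for f
    proof (rule dual_separates)
      fix g assume "g \<in> dual"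
      then show "g (lhit f a) = g \<zero>" using dual_hit[OF f(1) _ A'(3)[OF a]] A'(2)[OF _ a] f by simp
    qed (use A'(3) a f in auto)
    then show "a \<in> fil A (Suc 0)" using A'(3)[OF a] by simp
  qed
qed

section \<open>Local finiteness and exhaustion by the filtration\<close>

lemma lhits_finite:
  assumes x: "x \<in> carrier H"
  obtains F where "finite F" "F \<subseteq> carrier H" "\<And>f. f \<in> dual \<Longrightarrow> lhit f x \<in> lspan F"
proof -
  have "comult H x \<in> tensor_span k H (carrier H) (carrier H)" using x tensor_span_carrier by simp
  from tensor_span_finite(2)[OF this] obtain F
    where F: "finite F" "F \<subseteq> carrier H" "comult H x \<in> tensor_span k H F (carrier H)" by blast
  have "lhit f x \<in> lspan F" if f: "f \<in> dual" for f
    unfolding lhit_def using F f submodule_closed(6)[OF lspan_submodule[OF F(2)]] lspan_superset[of F]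
    by (intro swH_mem[OF bilinear_op_lhit[OF f] lspan_submodule[OF F(2)] F(2) order_refl F(3)]) auto
  then show ?thesis using that F by blast
qed

lemma rhits_finite:
  assumes x: "x \<in> carrier H"
  obtains F where "finite F" "F \<subseteq> carrier H" "\<And>f. f \<in> dual \<Longrightarrow> rhit f x \<in> lspan F"
proof -
  have "comult H x \<in> tensor_span k H (carrier H) (carrier H)" using x tensor_span_carrier by simp
  from tensor_span_finite(1)[OF this] obtain F
    where F: "finite F" "F \<subseteq> carrier H" "comult H x \<in> tensor_span k H (carrier H) F" by blast
  have "rhit f x \<in> lspan F" if f: "f \<in> dual" for f
    unfolding rhit_def using F f submodule_closed(6)[OF lspan_submodule[OF F(2)]] lspan_superset[of F]
    by (intro swH_mem[OF bilinear_op_rhit[OF f] lspan_submodule[OF F(2)] order_refl F(2,3)]) auto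
  then show ?thesis using that F by blast
qed

text \<open>The elements \<open>lhit f x\<close> span a stable subspace inside the span of the
  finitely many first legs of \<open>\<Delta> x\<close>; the counit shows that it contains
  \<open>x\<close>.\<close>

lemma ex_finite_left_stable:
  assumes x: "x \<in> carrier H"
  obtains G where "finite G" "G \<subseteq> carrier H" "left_stable (lspan G)" "x \<in> lspan G"
proof -
  obtain F where F: "finite F" "F \<subseteq> carrier H" "\<And>f. f \<in> dual \<Longrightarrow> lhit f x \<in> lspan F"
    using lhits_finite[OF x] by blast
  let ?S = "{lhit f x | f. f \<in> dual}"
  have S: "?S \<subseteq> carrier H" using x by auto
  have st: "left_stable (lspan ?S)"
  proof (rule lspan_left_stable[OF S])
    fix f y assume f: "f \<in> dual" and "y \<in> ?S"
    then obtain g where g: "g \<in> dual" "y = lhit g x" by blast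
    then have "lhit f y = lhit (\<lambda>z. f (lhit g z)) x" using f x by (simp add: lhit_lhit)
    then have "lhit f y \<in> ?S" using dual_comp[OF f linear_lhit[OF g(1)]] by blast
    then show "lhit f y \<in> lspan ?S" using lspan_superset[of ?S] by blast
  qed
  have "lspan ?S \<subseteq> lspan F" using F by (intro lspan_least lspan_submodule) auto
  from submodule_of_finite_span[OF F(1,2) lspan_submodule[OF S] this] obtain G
    where G: "finite G" "G \<subseteq> carrier H" "lspan G = lspan ?S" by blast
  have "lhit \<epsilon> x \<in> ?S" using counit_dual by blast
  then have "x \<in> lspan ?S" using lspan_superset[of ?S] x by (auto simp: lhit_counit)
  then show ?thesis using that G st by simp
qed

lemma finite_lspan_in_fil:
  assumes "finite G" "G \<subseteq> (\<Union>n. fil A n)" shows "\<exists>n. lspan G \<subseteq> fil A n"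
proof -
  have "\<exists>n. G \<subseteq> fil A n" using assms
  proof (induction G)
    case (insert g G)
    then obtain m n where "G \<subseteq> fil A n" "g \<in> fil A m" by auto
    then have "insert g G \<subseteq> fil A (max m n)"
      using fil_mono[of m "max m n" A] fil_mono[of n "max m n" A] by auto
    then show ?case by blast
  qed simp
  then show ?thesis using lspan_least[OF fil_submodule] by blast
qed

text \<open>Take a finitely spanned stable \<open>V\<close> outside the union \<open>N\<close>, with
  fewest generators, so that every proper stable subspace of \<open>V\<close> lies in
  \<open>N\<close>. The part \<open>U\<close> of \<open>V\<close> in \<open>N\<close> lies in a
  single \<open>fil A n\<close>. Functionals vanishing on \<open>A\<close> send \<open>V\<close>
  into \<open>U\<close>, so \<open>V\<close> lies in \<open>fil A (Suc n)\<close>, a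
  contradiction.\<close>

lemma fil_exhausts:
  assumes A: "left_stable A" and cor: "coradical k H \<subseteq> A" and x: "x \<in> carrier H"
  shows "\<exists>n. x \<in> fil A n"
proof (rule ccontr)
  assume no: "\<not> ?thesis"
  let ?N = "\<Union>n. fil A n"
  define P where "P n \<longleftrightarrow> (\<exists>G. finite G \<and> G \<subseteq> carrier H \<and> card G = n \<and> left_stable (lspan G) \<and> \<not> lspan G \<subseteq> ?N)" for n
  obtain G0 where "finite G0" "G0 \<subseteq> carrier H" "left_stable (lspan G0)" "x \<in> lspan G0"
    using ex_finite_left_stable[OF x] by blast
  then have "P (card G0)" unfolding P_def using no by blast
  then have "P (LEAST n. P n)" by (rule LeastI)
  then obtain G where G: "finite G" "G \<subseteq> carrier H" "card G = (LEAST n. P n)" "left_stable (lspan G)" "\<not> lspan G \<subseteq> ?N"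
    unfolding P_def by blast
  let ?V = "lspan G"
  note V = left_stableD[OF G(4)]
  have small: "W \<subseteq> ?N" if W: "left_stable W" "W \<subseteq> ?V" "W \<noteq> ?V" for W
  proof (rule ccontr)
    assume *: "\<not> W \<subseteq> ?N"
    obtain G' where G': "finite G'" "G' \<subseteq> carrier H" "lspan G' = W" "card G' < card G"
      using submodule_of_finite_span[OF G(1,2) left_stableD(1)[OF W(1)] W(2)] W(3) by blast
    then have "P (card G')" unfolding P_def using W * by blast
    then have "card G \<le> card G'" unfolding G(3) by (rule Least_le)
    then show False using G'(4) by simp
  qed
  have "submodule ?N k H"
  proof (rule submodule_Union_chain)
    show "subset.chain UNIV (range (fil A))"
      unfolding subset_chain_def using fil_mono[of _ _ A] by (auto dest: subsetD) (metis nat_le_linear subsetD)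
  qed (auto simp: fil_submodule)
  then have N: "left_stable ?N" unfolding left_stable_def using left_stableD(2)[OF fil_left_stable[OF A]] by blast
  let ?U = "?V \<inter> ?N"
  have U: "left_stable ?U" by (rule left_stable_Int[OF G(4) N])
  obtain G' where G': "finite G'" "G' \<subseteq> carrier H" "lspan G' = ?U"
    using submodule_of_finite_span[OF G(1,2) left_stableD(1)[OF U]] by blast
  then have "G' \<subseteq> ?N" using lspan_superset[of G'] by blast
  from finite_lspan_in_fil[OF G'(1) this] obtain n where n: "?U \<subseteq> fil A n" using G'(3) by auto
  have "lhit f v \<in> ?U" if f: "f \<in> dual" "\<forall>a \<in> A. f a = \<zero>\<^bsub>k\<^esub>" and v: "v \<in> ?V" for f v
  proof (rule ccontr)
    assume "lhit f v \<notin> ?U"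
    then obtain g where g: "g \<in> dual" "\<And>w. w \<in> ?U \<Longrightarrow> g w = \<zero>\<^bsub>k\<^esub>" "g (lhit f v) = \<one>\<^bsub>k\<^esub>"
      using ex_separating[OF left_stableD(1)[OF U], of "lhit f v"] f(1) V(3)[OF v] by auto
    \<comment> \<open>Translation by \<open>g\<close> kills \<open>U\<close>, so \<open>T\<close> is
      a quotient of \<open>V / U\<close>, which has no proper nonzero stable subspace. Thus
      \<open>T\<close> is zero or simple, and a simple one lies in the coradical.\<close>
    let ?T = "rhit g ` ?V"
    have T: "left_stable ?T"
      unfolding left_stable_def using submodule_image[OF linear_rhit[OF g(1)] V(1)] V(2,3) g(1)
      by (auto simp: lhit_rhit)
    have gU: "rhit g u = \<zero>" if u: "u \<in> ?U" for u
    proof (rule dual_separates)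
      fix h assume h: "h \<in> dual"
      then have "h (rhit g u) = g (lhit h u)" using g V(3) u by (intro dual_hit) auto
      then show "h (rhit g u) = h \<zero>" using g(2)[OF left_stableD(2)[OF U h u]] h by simp
    qed (use g V(3) u in auto)
    have "?T \<subseteq> A"
    proof (cases "?T = {\<zero>}")
      case True
      then show ?thesis using submodule_closed(1)[OF left_stableD(1)[OF A]] by simp
    next
      case False
      have "P = {\<zero>} \<or> P = ?T" if P: "left_stable P" "P \<subseteq> ?T" for P
      proof -
        let ?Q = "{w \<in> ?V. rhit g w \<in> P}"
        have Q: "left_stable ?Q"
          unfolding left_stable_def
          using submodule_vimage[OF linear_rhit[OF g(1)] V(1) left_stableD(1)[OF P(1)]] V left_stableD(2)[OF P(1)] g(1)
          by (auto simp flip: lhit_rhit)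
        show ?thesis
        proof (cases "?Q = ?V")
          case True
          then have "?T \<subseteq> P" by blast
          then show ?thesis using P by blast
        next
          case False
          then have "?Q \<subseteq> ?U" using small[OF Q] by blast
          then have "P \<subseteq> {\<zero>}" using gU P(2) by blast
          then show ?thesis using submodule_closed(1)[OF left_stableD(1)[OF P(1)]] by blast
        qed
      qed
      then show ?thesis using simple_comodule_in_coradical[OF T False] cor by blast
    qed
    then have "f (rhit g v) = \<zero>\<^bsub>k\<^esub>" using f v by blast
    then show False using dual_hit[OF f(1) g(1) V(3)[OF v]] g(3) by simp
  qed
  then have "?V \<subseteq> fil A (Suc n)" using n V(3) by auto
  then show False using G(5) by blast
qed

lemma swH_mult':
  assumes "bilinear_op b" "x \<in> carrier H" "y \<in> carrier H"
  shows "swH b (x \<otimes> y) = swH (\<lambda>c d. swH (\<lambda>u v. b (u \<otimes> c) (v \<otimes> d)) x) y"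
  using assms by (simp add: sw_def comult_mult lift_mult_algebra'[OF H.a_comm_group bilinear_op_bilinear])

subsection \<open>Hopf modules in the filtration\<close>

lemma bilinear_op_diff: "bilinear_op b \<Longrightarrow> bilinear_op b' \<Longrightarrow> bilinear_op (\<lambda>u v. b u v \<ominus> b' u v)"
  by (auto simp: bilinear_op_def intro: linear_diff)

lemma swH_diff:
  assumes "bilinear_op b" "bilinear_op b'" "x \<in> carrier H"
  shows "swH (\<lambda>u v. b u v \<ominus> b' u v) x = swH b x \<ominus> swH b' x"
proof -
  have "swH b x = swH (\<lambda>u v. (b u v \<ominus> b' u v) \<oplus> b' u v) x"
    using assms by (intro swH_cong) (auto simp: bilinear_op_closed)
  also have "\<dots> = swH (\<lambda>u v. b u v \<ominus> b' u v) x \<oplus> swH b' x"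
    using assms by (intro swH_op bilinear_op_diff)
  finally show ?thesis
    using assms bilinear_op_diff[OF assms(1,2)] by (simp add: a_minus_def H.a_assoc H.r_neg)
qed

lemma swH_diff_mem:
  assumes "bilinear_op b" "bilinear_op b'" "submodule W k H" "C \<subseteq> carrier H" "D \<subseteq> carrier H"
    "x \<in> carrier H" "comult H x \<in> tensor_span k H C D"
    "\<And>u v. u \<in> C \<Longrightarrow> v \<in> D \<Longrightarrow> b u v \<ominus> b' u v \<in> W"
  shows "swH b x \<ominus> swH b' x \<in> W"
  using swH_mem[OF bilinear_op_diff[OF assms(1,2)] assms(3,4,5,7,8)] swH_diff[OF assms(1,2,6)] by simp

text \<open>Agreement is required only on the legs where the coproduct lives. This suits maps such
  as a projection \<open>p\<close>, which is the identity on \<open>A\<close> alone.\<close>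

lemma swH_cong_on:
  assumes "bilinear_op b" "bilinear_op b'" "C \<subseteq> carrier H" "D \<subseteq> carrier H"
    "x \<in> carrier H" "comult H x \<in> tensor_span k H C D"
    "\<And>u v. u \<in> C \<Longrightarrow> v \<in> D \<Longrightarrow> b u v = b' u v"
  shows "swH b x = swH b' x"
proof -
  have "swH b x \<ominus> swH b' x \<in> {\<zero>}"
  proof (rule swH_diff_mem[OF assms(1,2) submodule_zero assms(3-6)])
    fix u v assume uv: "u \<in> C" "v \<in> D"
    then have "b' u v \<in> carrier H" using assms(3,4) by (intro bilinear_op_closed[OF assms(2)]) auto
    then show "b u v \<ominus> b' u v \<in> {\<zero>}" using assms(7)[OF uv] by simp
  qed
  then show ?thesis using assms by (simp add: H.diff_eq_zero_iff)
qed

lemma comult_left_stable: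
  "left_stable C \<Longrightarrow> x \<in> C \<Longrightarrow> comult H x \<in> tensor_span k H C (carrier H)"
  using left_stableD[of C] by (intro comult_in_tensor_span) auto

lemma hopf_subalgebraD:
  assumes "hopf_subalgebra k H A"
  shows "subring A H" "submodule A k H" "subcoalgebra k H A" "left_stable A" "right_stable A"
    "a \<in> A \<Longrightarrow> a \<in> carrier H" "a \<in> A \<Longrightarrow> b \<in> A \<Longrightarrow> a \<otimes> b \<in> A" "\<one> \<in> A" "a \<in> A \<Longrightarrow> \<S> a \<in> A"
    "a \<in> A \<Longrightarrow> comult H a \<in> tensor_span k H A A"
  using assms subcoalgebra_stable[of A] subcoalgebraD(3)[of A] subcoalgebraD(2)[of A] subringE(3,6)[of A H]
  by (auto simp: hopf_subalgebra_def unital_subalgebra_def)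

text \<open>Acting by \<open>f\<close> on \<open>x a\<close> gives
  \<open>\<Sum> (f\<^sub>2 \<rightharpoonup> x) a\<^sub>1\<close> with
  \<open>f\<^sub>2(v) = f(v a\<^sub>2)\<close>. If \<open>f\<close> vanishes on \<open>A\<close>, so
  does \<open>f\<^sub>2\<close>, because \<open>A\<close> is closed under multiplication.\<close>

lemma fil_mult:
  assumes A: "hopf_subalgebra k H A" shows "x \<in> fil A n \<Longrightarrow> a \<in> A \<Longrightarrow> x \<otimes> a \<in> fil A n"
proof (induction n arbitrary: x a)
  case 0
  then show ?case using hopf_subalgebraD(6)[OF A] by simp
next
  case (Suc n)
  note A' = hopf_subalgebraD[OF A]
  have x: "x \<in> carrier H" and a: "a \<in> carrier H" using Suc.prems A'(6) by auto
  have AH: "A \<subseteq> carrier H" using A'(6) by blast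
  have "lhit f (x \<otimes> a) \<in> fil A n" if f: "f \<in> dual" "\<forall>a \<in> A. f a = \<zero>\<^bsub>k\<^esub>" for f
  proof -
    note fb = bilinear_op_lhit[OF f(1)]
    let ?b = "\<lambda>c d. swH (\<lambda>u v. f (v \<otimes> d) \<odot> (u \<otimes> c)) x"
    have fd: "(\<lambda>v. f (v \<otimes> d)) \<in> dual" "(\<lambda>v. f (d \<otimes> v)) \<in> dual" if "d \<in> carrier H" for d
      using that
      by (auto intro: dual_comp[OF f(1) linear_mult_right[OF _ linear_id]] dual_comp[OF f(1) linear_mult_left[OF _ linear_id]])
    have bb: "bilinear_op ?b"
      using x f(1) by (intro linear_intros fd linear_dual_smult[OF fd(1)] linear_dual_smult[OF fd(2)]) auto
    have "lhit f (x \<otimes> a) = swH ?b a" unfolding lhit_def by (rule swH_mult'[OF fb x a])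
    also have "\<dots> \<in> fil A n"
    proof (rule swH_mem[OF bb fil_submodule AH AH A'(10)[OF Suc.prems(2)]])
      fix c d assume cd: "c \<in> A" "d \<in> A"
      have cd': "c \<in> carrier H" "d \<in> carrier H" using cd AH by auto
      note fd' = fd(1)[OF cd'(2)]
      have "lhit (\<lambda>v. f (v \<otimes> d)) x \<otimes> c = ?b c d"
        unfolding lhit_def
      proof (rule linear_swH_apply[where p = "\<lambda>z. z \<otimes> c", OF _ bilinear_op_lhit[OF fd'] _ x])
        show "linear (\<lambda>z. z \<otimes> c)" using cd' by (intro linear_intros)
        show "bilinear_op (\<lambda>u v. f (v \<otimes> d) \<odot> (u \<otimes> c))"
          using cd' f(1) by (intro linear_intros fd) auto
        show "f (v \<otimes> d) \<odot> u \<otimes> c = f (v \<otimes> d) \<odot> (u \<otimes> c)"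
          if "u \<in> carrier H" "v \<in> carrier H" for u v
          using that cd' f(1) by (simp add: smult_mult_left)
      qed
      moreover have "lhit (\<lambda>v. f (v \<otimes> d)) x \<in> fil A n"
        using Suc.prems(1) fd(1)[of d] cd A' f by auto
      ultimately show "?b c d \<in> fil A n" using Suc.IH[OF _ cd(1)] by metis
    qed
    finally show ?thesis .
  qed
  then show ?case using x a by simp
qed

text \<open>If \<open>g\<close> vanishes on \<open>A\<close>, so does every functional
  \<open>f \<circ> g\<close>. The first legs of \<open>(id \<otimes> g)(\<Delta> x)\<close>
  therefore lie one step lower in the filtration than \<open>x\<close>.\<close>

lemma swH_fil_Suc_mem:
  assumes "x \<in> fil A (Suc m)" "bilinear_op b" "linear g" "submodule W k H" "submodule D k H"
    "\<And>a. a \<in> A \<Longrightarrow> g a = \<zero>" "\<And>z. z \<in> carrier H \<Longrightarrow> g z \<in> D"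
    "\<And>u v. u \<in> fil A m \<Longrightarrow> v \<in> D \<Longrightarrow> b u v \<in> W"
  shows "swH (\<lambda>u v. b u (g v)) x \<in> W"
proof (rule swH_slice_mem[OF assms(2,3) fil_submodule assms(5,4)])
  show x: "x \<in> carrier H" using assms(1) by simp
  then show "comult H x \<in> tensor_span k H (carrier H) (carrier H)" by (simp add: tensor_span_carrier)
  show "lhit (\<lambda>z. f (g z)) x \<in> fil A m" if "f \<in> dual" for f
    using that assms(1,6) dual_comp[OF that assms(3)] by simp
qed (use assms in auto)

text \<open>
  Modulo \<open>fil A m\<close> the space \<open>fil A (m + 1)\<close> is a Hopf module over \<open>A\<close>. The map \<open>E\<close> is a lift of the
  projection \<open>x \<mapsto> x\<^sub>0 S(x\<^sub>1)\<close> onto its coinvariants and the last claim is the decomposition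
  \<open>x = x\<^sub>0 S(x\<^sub>1) x\<^sub>2\<close> of the fundamental theorem of Hopf modules.
\<close>

lemma ex_coinvariant_projection:
  assumes A: "hopf_subalgebra k H A"
    and p: "linear p" "\<And>a. a \<in> A \<Longrightarrow> p a = a" "\<And>h. h \<in> carrier H \<Longrightarrow> p h \<in> A"
  obtains E where "linear E" "\<And>x. x \<in> fil A m \<Longrightarrow> E x = \<zero>"
    "\<And>x a. x \<in> fil A (Suc m) \<Longrightarrow> a \<in> A \<Longrightarrow> E (x \<otimes> a) = \<epsilon> a \<odot> E x"
    "\<And>x. x \<in> fil A (Suc m) \<Longrightarrow> x \<ominus> swH (\<lambda>u v. E u \<otimes> p v) x \<in> fil A m"
proof -
  note A' = hopf_subalgebraD[OF A]
  have AH: "A \<subseteq> carrier H" using A'(6) by blast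
  note F = fil_submodule[of A m] note Fcl = submodule_closed[OF F] note Acl = submodule_closed[OF A'(2)]
  note fl = fil_left_stable[OF A'(4)]
  have pc [simp]: "p h \<in> carrier H" if "h \<in> carrier H" for h using p(1) that by simp
  have lin_p: "linear (\<lambda>x. p (f x))" if "linear f" for f by (rule linear_comp[OF p(1) that])
  \<comment> \<open>\<open>Q\<close> vanishes exactly on \<open>fil A m\<close>, so working modulo
    \<open>fil A m\<close> means applying \<open>Q\<close>.\<close>
  obtain Q where Q: "linear Q" "\<And>w. w \<in> fil A m \<Longrightarrow> Q w = \<zero>"
    "\<And>v. v \<in> carrier H \<Longrightarrow> v \<ominus> Q v \<in> fil A m"
    using ex_complement_projection[OF F] by blast
  have Q_eq: "Q x = Q y" if "x \<ominus> y \<in> fil A m" "x \<in> carrier H" "y \<in> carrier H" for x y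
    using Q(2)[OF that(1)] that Q(1) by (simp add: linear_minus H.diff_eq_zero_iff)
  \<comment> \<open>The coaction on the factor takes values in \<open>A\<close>, but
    \<open>\<Delta> x\<close> itself has second legs in \<open>H\<close>. The projection
    \<open>p\<close> replaces them by elements of \<open>A\<close>.\<close>
  let ?e = "\<lambda>u v. u \<otimes> \<S> (p v)"
  have eb: "bilinear_op ?e" by (intro linear_intros lin_p) auto
  define E0 where "E0 = (\<lambda>x. swH ?e x)"
  have E0: "linear E0" unfolding E0_def by (intro linear_swH eb linear_id)
  have E0_fil: "E0 x \<in> fil A m" if "x \<in> fil A m" for x
    unfolding E0_def using fil_mult[OF A] A'(9) p(3)
    by (intro swH_mem[OF eb F _ order_refl comult_left_stable[OF fl that]]) (auto intro: Fcl(2))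
  define E where "E = (\<lambda>x. Q (E0 x))"
  have E: "linear E" unfolding E_def by (rule linear_comp[OF Q(1) E0])
  have 1: "E x = \<zero>" if "x \<in> fil A m" for x
    unfolding E_def using Q(2) E0_fil that by simp
  have 2: "E (x \<otimes> a) = \<epsilon> a \<odot> E x" if xF: "x \<in> fil A (Suc m)" and aA: "a \<in> A" for x a
  proof -
    have x: "x \<in> carrier H" and a: "a \<in> carrier H" using xF aA AH by auto
    define K where "K = (\<lambda>h. swH (\<lambda>u v. (u \<otimes> h) \<otimes> \<S> (p v)) x)"
    have Kb: "bilinear_op (\<lambda>u v. (u \<otimes> h) \<otimes> \<S> (p v))" if "h \<in> carrier H" for h
      using that by (intro linear_intros lin_p) auto
    have K: "linear K" unfolding K_def using x by (intro linear_intros lin_p) auto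
    let ?b = "\<lambda>c d. swH (\<lambda>u v. (u \<otimes> c) \<otimes> \<S> (p (v \<otimes> d))) x"
    have inb: "bilinear_op (\<lambda>u v. (u \<otimes> c) \<otimes> \<S> (p (v \<otimes> d)))" if "c \<in> carrier H" "d \<in> carrier H" for c d
      using that by (intro linear_intros lin_p) auto
    have bb: "bilinear_op ?b" using x by (intro linear_intros lin_p) auto
    have bK: "bilinear_op (\<lambda>c d. K (c \<otimes> \<S> d))"
      by (intro bilinear_op_comp[OF K] linear_intros) auto
    have "E0 (x \<otimes> a) = swH ?b a" unfolding E0_def by (rule swH_mult'[OF eb x a])
    \<comment> \<open>Replacing \<open>p (v \<otimes> d)\<close> by \<open>p v \<otimes> d\<close>
      is exact for \<open>v\<close> in \<open>A\<close>, so the error lies in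
      \<open>fil A m\<close>. After the replacement the legs of \<open>a\<close> meet as
      \<open>c \<otimes> \<S> d\<close> and collapse to the counit.\<close>
    moreover have "swH ?b a \<ominus> swH (\<lambda>c d. K (c \<otimes> \<S> d)) a \<in> fil A m"
    proof (rule swH_diff_mem[OF bb bK F AH AH a A'(10)[OF aA]])
      fix c d assume cd: "c \<in> A" "d \<in> A"
      then have cd': "c \<in> carrier H" "d \<in> carrier H" using AH by auto
      let ?g = "\<lambda>v. p (v \<otimes> d) \<ominus> p v \<otimes> d"
      let ?c = "\<lambda>u w. (u \<otimes> c) \<otimes> \<S> w"
      have g: "linear ?g" using cd' by (intro linear_intros lin_p) auto
      have cb: "bilinear_op ?c" using cd' by (intro linear_intros) auto
      have "swH (\<lambda>u v. ?c u (?g v)) x \<in> fil A m"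
      proof (rule swH_fil_Suc_mem[OF xF cb g F A'(2)])
        show "?g a = \<zero>" if "a \<in> A" for a using that p(2) A'(6,7) cd by simp
        show "?g z \<in> A" if "z \<in> carrier H" for z using that p(3) A'(7) cd cd' Acl(4) by simp
        show "?c u v \<in> fil A m" if "u \<in> fil A m" "v \<in> A" for u v
          using that fil_mult[OF A] A'(9) cd by simp
      qed
      also have "swH (\<lambda>u v. ?c u (?g v)) x =
        swH (\<lambda>u v. (u \<otimes> c) \<otimes> \<S> (p (v \<otimes> d)) \<ominus> (u \<otimes> (c \<otimes> \<S> d)) \<otimes> \<S> (p v)) x"
      proof (rule swH_cong[OF _ x])
        show "bilinear_op (\<lambda>u v. ?c u (?g v))"
          using cd' g by (intro linear_intros linear_comp[OF g]) auto
        fix u v assume uv: "u \<in> carrier H" "v \<in> carrier H"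
        have Sg: "\<S> (?g v) = \<S> (p (v \<otimes> d)) \<ominus> \<S> d \<otimes> \<S> (p v)"
          using uv cd' by (simp add: linear_minus[OF antipode_linear] antipode_mult)
        show "?c u (?g v) = (u \<otimes> c) \<otimes> \<S> (p (v \<otimes> d)) \<ominus> (u \<otimes> (c \<otimes> \<S> d)) \<otimes> \<S> (p v)"
          unfolding Sg using uv cd' by (simp add: a_minus_def H.r_distr H.r_minus H.m_assoc)
      qed
      also have "\<dots> = ?b c d \<ominus> K (c \<otimes> \<S> d)"
        unfolding K_def using cd' by (intro swH_diff inb Kb x) auto
      finally show "?b c d \<ominus> K (c \<otimes> \<S> d) \<in> fil A m" .
    qed
    moreover have "swH (\<lambda>c d. K (c \<otimes> \<S> d)) a = \<epsilon> a \<odot> E0 x"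
    proof -
      have "swH (\<lambda>c d. K (c \<otimes> \<S> d)) a = K (swH (\<lambda>c d. c \<otimes> \<S> d) a)"
        using a by (intro linear_swH_comp[OF K, symmetric] linear_intros) auto
      also have "\<dots> = \<epsilon> a \<odot> K \<one>" using a by (simp add: swH_antipode_right linear_smult[OF K])
      also have "K \<one> = E0 x" unfolding K_def E0_def using x by (intro swH_cong Kb) auto
      finally show ?thesis .
    qed
    ultimately have "E0 (x \<otimes> a) \<ominus> \<epsilon> a \<odot> E0 x \<in> fil A m" by simp
    then have "Q (E0 (x \<otimes> a)) = Q (\<epsilon> a \<odot> E0 x)" using x a E0 by (intro Q_eq) auto
    then show ?thesis unfolding E_def using linear_smult[OF Q(1)] x a E0 by simp
  qed
  have 3: "x \<ominus> swH (\<lambda>u v. E u \<otimes> p v) x \<in> fil A m" if xF: "x \<in> fil A (Suc m)" for x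
  proof -
    have x: "x \<in> carrier H" using xF by simp
    define T where "T = (\<lambda>v. swH (\<lambda>c d. \<S> (p c) \<otimes> p d) v)"
    have Tb: "bilinear_op (\<lambda>c d. \<S> (p c) \<otimes> p d)" by (intro linear_intros lin_p) auto
    have T: "linear T" unfolding T_def by (intro linear_swH Tb linear_id)
    have b0: "bilinear_op (\<lambda>u v. E0 u \<otimes> p v)" "bilinear_op (\<lambda>u v. E u \<otimes> p v)" "bilinear_op (\<lambda>u v. u \<otimes> T v)"
      using E0 E T by (intro linear_intros lin_p E0 E linear_comp[OF T]; simp)+
    \<comment> \<open>\<open>E\<close> is \<open>Q\<close> after \<open>E0\<close>, so their values
      differ by elements of \<open>fil A m\<close>, which absorbs right multiplication by
      \<open>A\<close>.\<close>
    have step1: "swH (\<lambda>u v. E0 u \<otimes> p v) x \<ominus> swH (\<lambda>u v. E u \<otimes> p v) x \<in> fil A m"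
    proof (rule swH_diff_mem[OF b0(1,2) F order_refl order_refl x])
      show "comult H x \<in> tensor_span k H (carrier H) (carrier H)" using x by (simp add: tensor_span_carrier)
      fix u v assume uv: "u \<in> carrier H" "v \<in> carrier H"
      have "(E0 u \<ominus> E u) \<otimes> p v \<in> fil A m"
        unfolding E_def using uv E0 Q(3) p(3) by (intro fil_mult[OF A]) auto
      then show "E0 u \<otimes> p v \<ominus> E u \<otimes> p v \<in> fil A m"
        using uv E0 E by (simp add: a_minus_def H.l_distr H.l_minus)
    qed
    have step2: "swH (\<lambda>u v. E0 u \<otimes> p v) x = swH (\<lambda>u v. u \<otimes> T v) x"
    proof -
      have "swH (\<lambda>u v. E0 u \<otimes> p v) x = swH (\<lambda>u v. swH (\<lambda>c d. (c \<otimes> \<S> (p d)) \<otimes> p v) u) x"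
      proof (rule swH_cong[OF b0(1) x])
        fix u v assume "u \<in> carrier H" "v \<in> carrier H"
        then show "E0 u \<otimes> p v = swH (\<lambda>c d. (c \<otimes> \<S> (p d)) \<otimes> p v) u"
          unfolding E0_def by (intro linear_swH_comp[where f = "\<lambda>z. z \<otimes> p v"] linear_mult_right linear_id eb) auto
      qed
      also have "\<dots> = swH (\<lambda>u v. swH (\<lambda>c d. (u \<otimes> \<S> (p c)) \<otimes> p d) v) x"
        using x by (intro swH_coassoc linear_intros lin_p) auto
      also have "\<dots> = swH (\<lambda>u v. u \<otimes> T v) x"
      proof (rule swH_cong[OF b0(3) x, symmetric])
        fix u v assume "u \<in> carrier H" "v \<in> carrier H"
        then show "u \<otimes> T v = swH (\<lambda>c d. (u \<otimes> \<S> (p c)) \<otimes> p d) v"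
          unfolding T_def
          by (intro linear_swH_apply[where p = "\<lambda>z. u \<otimes> z"] linear_intros lin_p) (auto simp: H.m_assoc)
      qed
      finally show ?thesis .
    qed
    \<comment> \<open>On \<open>A\<close> the map \<open>T\<close> is the counit times the unit, by
      the antipode axiom. Hence \<open>?g\<close> vanishes there and exchanging the two maps costs
      an element of \<open>fil A m\<close>.\<close>
    let ?g = "\<lambda>v. \<epsilon> v \<odot> \<one> \<ominus> T v"
    have g: "linear ?g" using T by (intro linear_intros counit_dual) auto
    have mb: "bilinear_op (\<lambda>u v. u \<otimes> v)" by (intro linear_intros) auto
    have "swH (\<lambda>u v. u \<otimes> ?g v) x \<in> fil A m"
    proof (rule swH_fil_Suc_mem[OF xF mb g F A'(2)])
      show "?g a = \<zero>" if a: "a \<in> A" for a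
      proof -
        have "T a = swH (\<lambda>c d. \<S> c \<otimes> d) a"
          unfolding T_def using a AH p(2)
          by (intro swH_cong_on[OF Tb _ AH AH _ A'(10)[OF a]] linear_intros) auto
        then show ?thesis using a AH by (simp add: swH_antipode_left subset_iff)
      qed
      have "T z \<in> A" if "z \<in> carrier H" for z
        unfolding T_def using that p(3) A'(7,9)
        by (intro swH_mem[OF Tb A'(2) order_refl order_refl]) (auto simp: tensor_span_carrier)
      then show "?g z \<in> A" if "z \<in> carrier H" for z
        using that Acl(4,6) A'(8) by simp
    qed (use fil_mult[OF A] in auto)
    also have "swH (\<lambda>u v. u \<otimes> ?g v) x = swH (\<lambda>u v. \<epsilon> v \<odot> u \<ominus> u \<otimes> T v) x"
      using x T g by (intro swH_cong linear_intros linear_comp[OF g])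
        (auto simp: a_minus_def H.r_distr H.r_minus smult_mult_right)
    also have "\<dots> = swH (\<lambda>u v. \<epsilon> v \<odot> u) x \<ominus> swH (\<lambda>u v. u \<otimes> T v) x"
      by (rule swH_diff[OF bilinear_op_lhit[OF counit_dual] b0(3) x])
    also have "swH (\<lambda>u v. \<epsilon> v \<odot> u) x = x" using swH_counit_right[OF linear_id x] .
    finally have "x \<ominus> swH (\<lambda>u v. E0 u \<otimes> p v) x \<in> fil A m" using step2 by simp
    from Fcl(3)[OF this step1] show ?thesis
      using x b0 by (simp add: a_minus_def H.a_assoc H.r_neg1)
  qed
  show ?thesis by (rule that[OF E 1 2 3])
qed

text \<open>On \<open>fil A (Suc m)\<close> the map
  \<open>s(x) = \<Sum> E(x\<^sub>1) p(x\<^sub>2)\<close> is right \<open>A\<close>-linear. It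
  vanishes on \<open>fil A m\<close> and is congruent to the identity modulo \<open>fil A m\<close>,
  so subtracting it from the identity gives an \<open>A\<close>-linear retraction.\<close>

lemma ex_retraction:
  assumes A: "hopf_subalgebra k H A"
  obtains r where "linear r" "\<And>x. x \<in> fil A m \<Longrightarrow> r x = x" "\<And>x. x \<in> fil A (Suc m) \<Longrightarrow> r x \<in> fil A m"
    "\<And>x a. x \<in> fil A (Suc m) \<Longrightarrow> a \<in> A \<Longrightarrow> r (x \<otimes> a) = r x \<otimes> a"
proof -
  note A' = hopf_subalgebraD[OF A]
  have AH: "A \<subseteq> carrier H" using A'(6) by blast
  note F = fil_submodule[of A m] note Fcl = submodule_closed[OF F]
  note fl = fil_left_stable[OF A'(4)]
  obtain p where p: "linear p" "\<And>a. a \<in> A \<Longrightarrow> p a = a" "\<And>h. h \<in> carrier H \<Longrightarrow> p h \<in> A"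
    using ex_projection[OF A'(2)] by blast
  obtain E where E: "linear E" "\<And>x. x \<in> fil A m \<Longrightarrow> E x = \<zero>"
    "\<And>x a. x \<in> fil A (Suc m) \<Longrightarrow> a \<in> A \<Longrightarrow> E (x \<otimes> a) = \<epsilon> a \<odot> E x"
    "\<And>x. x \<in> fil A (Suc m) \<Longrightarrow> x \<ominus> swH (\<lambda>u v. E u \<otimes> p v) x \<in> fil A m"
    using ex_coinvariant_projection[OF A p] by blast
  have [simp]: "p h \<in> carrier H" "E h \<in> carrier H" if "h \<in> carrier H" for h using p(1) E(1) that by simp_all
  have lin_p: "linear (\<lambda>x. p (f x))" if "linear f" for f by (rule linear_comp[OF p(1) that])
  have lin_E: "linear (\<lambda>x. E (f x))" if "linear f" for f by (rule linear_comp[OF E(1) that])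
  let ?e = "\<lambda>u v. E u \<otimes> p v"
  have eb: "bilinear_op ?e" by (intro linear_intros lin_p lin_E) auto
  define s where "s = (\<lambda>x. swH ?e x)"
  have s: "linear s" unfolding s_def by (intro linear_swH eb linear_id)
  have s0: "s x = \<zero>" if "x \<in> fil A m" for x
  proof -
    have "s x \<in> {\<zero>}"
      unfolding s_def using E(2) p
      by (intro swH_mem[OF eb submodule_zero _ order_refl comult_left_stable[OF fl that]]) (auto intro: Fcl(2))
    then show ?thesis by simp
  qed
  have s_mult: "s (x \<otimes> a) = s x \<otimes> a" if xF: "x \<in> fil A (Suc m)" and aA: "a \<in> A" for x a
  proof -
    have x: "x \<in> carrier H" and a: "a \<in> carrier H" using xF aA AH by auto
    let ?b = "\<lambda>c d. swH (\<lambda>u v. E (u \<otimes> c) \<otimes> p (v \<otimes> d)) x"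
    have bb: "bilinear_op ?b" using x by (intro linear_intros lin_p lin_E) auto
    have cb: "bilinear_op (\<lambda>c d. \<epsilon> c \<odot> (s x \<otimes> d))"
      using x s by (intro linear_intros counit_dual) auto
    have "s (x \<otimes> a) = swH ?b a" unfolding s_def by (rule swH_mult'[OF eb x a])
    also have "\<dots> = swH (\<lambda>c d. \<epsilon> c \<odot> (s x \<otimes> d)) a"
    proof (rule swH_cong_on[OF bb cb AH AH a A'(10)[OF aA]])
      fix c d assume cd: "c \<in> A" "d \<in> A"
      then have cd': "c \<in> carrier H" "d \<in> carrier H" using AH by auto
      let ?g = "\<lambda>v. p (v \<otimes> d) \<ominus> p v \<otimes> d"
      let ?c1 = "\<lambda>u v. E (u \<otimes> c) \<otimes> p (v \<otimes> d)"
      let ?c2 = "\<lambda>u v. (\<epsilon> c \<odot> E u) \<otimes> p (v \<otimes> d)"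
      let ?c3 = "\<lambda>u v. (\<epsilon> c \<odot> E u) \<otimes> (p v \<otimes> d)"
      have g: "linear ?g" using cd' by (intro linear_intros lin_p) auto
      have c1: "bilinear_op ?c1" and c2: "bilinear_op ?c2" and c3: "bilinear_op ?c3"
        and c4: "bilinear_op (\<lambda>u v. (\<epsilon> c \<odot> E u) \<otimes> v)"
        and c5: "bilinear_op (\<lambda>u v. (\<epsilon> c \<odot> E u) \<otimes> ?g v)"
        using cd' g by (intro linear_intros lin_p lin_E linear_comp[OF g]; simp)+
      have "swH ?c1 x = swH ?c2 x"
        by (rule swH_cong_on[OF c1 c2 _ order_refl x comult_left_stable[OF fl xF]]) (use E(3) cd in auto)
      also have "\<dots> = swH ?c3 x"
      proof -
        have "swH (\<lambda>u v. (\<epsilon> c \<odot> E u) \<otimes> ?g v) x \<in> {\<zero>}"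
          using cd cd' p A'(6,7) E(2) g
          by (intro swH_fil_Suc_mem[OF xF c4 g submodule_zero carrier_is_submodule]) auto
        also have "swH (\<lambda>u v. (\<epsilon> c \<odot> E u) \<otimes> ?g v) x = swH (\<lambda>u v. ?c2 u v \<ominus> ?c3 u v) x"
          using cd' by (intro swH_cong[OF c5 x]) (auto simp: a_minus_def H.r_distr H.r_minus)
        also have "\<dots> = swH ?c2 x \<ominus> swH ?c3 x" by (rule swH_diff[OF c2 c3 x])
        finally show ?thesis using x c2 c3 by (simp add: H.diff_eq_zero_iff)
      qed
      also have "\<dots> = \<epsilon> c \<odot> (s x \<otimes> d)"
        unfolding s_def using cd'
        by (intro linear_swH_apply[symmetric, where p = "\<lambda>z. \<epsilon> c \<odot> (z \<otimes> d)"] eb c3 x linear_intros)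
          (auto simp: smult_mult_left H.m_assoc)
      finally show "?b c d = \<epsilon> c \<odot> (s x \<otimes> d)" .
    qed
    also have "\<dots> = s x \<otimes> a" using x a s by (intro swH_counit_left linear_intros) auto
    finally show ?thesis .
  qed
  show ?thesis
  proof (rule that[of "\<lambda>x. x \<ominus> s x"])
    show "linear (\<lambda>x. x \<ominus> s x)" by (intro linear_intros s)
    show "x \<ominus> s x = x" if "x \<in> fil A m" for x using s0[OF that] Fcl(2)[OF that] by simp
    show "x \<ominus> s x \<in> fil A m" if "x \<in> fil A (Suc m)" for x using E(4)[OF that] by (simp add: s_def)
    show "x \<otimes> a \<ominus> s (x \<otimes> a) = (x \<ominus> s x) \<otimes> a" if "x \<in> fil A (Suc m)" "a \<in> A" for x a
      using s_mult[OF that] that AH s by (auto simp: a_minus_def H.l_distr H.l_minus)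
  qed
qed

section \<open>Ideals generated by augmentation ideals\<close>

definition mult_span :: "'h set \<Rightarrow> 'h set \<Rightarrow> 'h set"
  where "mult_span M I = lspan {x \<otimes> y | x y. x \<in> M \<and> y \<in> I}"

definition augmentation :: "'h set \<Rightarrow> 'h set"
  where "augmentation B = {b \<in> B. \<epsilon> b = \<zero>\<^bsub>k\<^esub>}"

lemma mult_span_submodule: "M \<subseteq> carrier H \<Longrightarrow> I \<subseteq> carrier H \<Longrightarrow> submodule (mult_span M I) k H"
  unfolding mult_span_def by (rule lspan_submodule) auto

lemma mult_span_mem: "x \<in> M \<Longrightarrow> y \<in> I \<Longrightarrow> x \<otimes> y \<in> mult_span M I"
  unfolding mult_span_def using lspan_superset[of "{x \<otimes> y | x y. x \<in> M \<and> y \<in> I}"] by auto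

lemma mult_span_least:
  "submodule W k H \<Longrightarrow> (\<And>x y. x \<in> M \<Longrightarrow> y \<in> I \<Longrightarrow> x \<otimes> y \<in> W) \<Longrightarrow> mult_span M I \<subseteq> W"
  unfolding mult_span_def by (rule lspan_least) auto

lemma mult_span_mono:
  assumes "M \<subseteq> M'" "I \<subseteq> I'" "M' \<subseteq> carrier H" "I' \<subseteq> carrier H" shows "mult_span M I \<subseteq> mult_span M' I'"
  using assms by (intro mult_span_least mult_span_submodule mult_span_mem) auto

text \<open>The retraction of \<open>ex_retraction\<close> fixes \<open>y\<close> and, being
  \<open>A\<close>-linear, carries products with elements of \<open>I\<close> to products whose left
  factor lies in \<open>fil A m\<close>.\<close>

lemma mult_span_fil_step:
  assumes A: "hopf_subalgebra k H A" and I: "I \<subseteq> A"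
    and y: "y \<in> mult_span (fil A (Suc m)) I" "y \<in> fil A m"
  shows "y \<in> mult_span (fil A m) I"
proof -
  note A' = hopf_subalgebraD[OF A]
  obtain r where r: "linear r" "\<And>x. x \<in> fil A m \<Longrightarrow> r x = x" "\<And>x. x \<in> fil A (Suc m) \<Longrightarrow> r x \<in> fil A m"
    "\<And>x a. x \<in> fil A (Suc m) \<Longrightarrow> a \<in> A \<Longrightarrow> r (x \<otimes> a) = r x \<otimes> a"
    using ex_retraction[OF A] by blast
  have IH: "I \<subseteq> carrier H" using I A'(6) by blast
  have FH: "fil A n \<subseteq> carrier H" for n using submodule_closed(2)[OF fil_submodule] by blast
  have "submodule {v \<in> carrier H. r v \<in> mult_span (fil A m) I} k H"
    by (intro submodule_vimage r(1) carrier_is_submodule mult_span_submodule FH IH)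
  then have "mult_span (fil A (Suc m)) I \<subseteq> {v \<in> carrier H. r v \<in> mult_span (fil A m) I}"
    using r(3,4) I IH by (intro mult_span_least) (auto simp: subset_iff intro!: mult_span_mem)
  then show ?thesis using y r(2) by auto
qed

text \<open>By exhaustion \<open>y\<close> lies in \<open>mult_span (fil A n) I\<close> for some
  \<open>n\<close>; the degree is then lowered one step at a time. In degree one the result reads
  \<open>H I \<inter> A = A I\<close>.\<close>

lemma mult_span_fil:
  assumes A: "hopf_subalgebra k H A" and cor: "coradical k H \<subseteq> A" and I: "I \<subseteq> A"
    and y: "y \<in> mult_span (carrier H) I" "y \<in> fil A m"
  shows "y \<in> mult_span (fil A m) I"
proof -
  note A' = hopf_subalgebraD[OF A]
  have IH: "I \<subseteq> carrier H" using I A'(6) by blast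
  have FH: "fil A n \<subseteq> carrier H" for n using submodule_closed(2)[OF fil_submodule] by blast
  note mono = mult_span_mono[OF _ order_refl FH IH]
  let ?N = "\<Union>n. mult_span (fil A n) I"
  have "submodule ?N k H"
  proof (rule submodule_Union_chain)
    show "subset.chain UNIV (range (\<lambda>n. mult_span (fil A n) I))"
      unfolding subset_chain_def using mono[OF fil_mono] by auto (meson nat_le_linear subsetD)
  qed (auto simp: mult_span_submodule FH IH)
  moreover have "x \<otimes> z \<in> ?N" if "x \<in> carrier H" "z \<in> I" for x z
    using fil_exhausts[OF A'(4) cor that(1)] mult_span_mem[OF _ that(2)] by blast
  ultimately have "mult_span (carrier H) I \<subseteq> ?N" by (rule mult_span_least)
  then obtain n where "y \<in> mult_span (fil A n) I" using y(1) by blast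
  \<comment> \<open>Starting from degree \<open>m + n\<close> leaves exactly \<open>n\<close> steps
    down to \<open>m\<close>, whether or not \<open>n\<close> exceeds \<open>m\<close>.\<close>
  then have n: "y \<in> mult_span (fil A (m + n)) I" using mono[OF fil_mono, of n "m + n"] by auto
  have "y \<in> mult_span (fil A (m + n - j)) I" if "j \<le> n" for j using that
  proof (induction j)
    case (Suc j)
    have eq: "m + n - j = Suc (m + n - Suc j)" using Suc.prems by simp
    have "m \<le> m + n - Suc j" using Suc.prems by simp
    from fil_mono[OF this, of A] have "y \<in> fil A (m + n - Suc j)" using y(2) by blast
    moreover have "y \<in> mult_span (fil A (m + n - j)) I" by (rule Suc.IH) (use Suc.prems in linarith)
    ultimately show ?case unfolding eq by - (rule mult_span_fil_step[OF A I])
  qed (use n in simp)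
  from this[of n] show ?thesis by simp
qed

text \<open>It is enough that degree two adds nothing to \<open>B\<close>. For \<open>x\<close> in
  degree two, \<open>x - \<epsilon>(x) 1\<close> lies in \<open>H B\<^sup>+\<close>, hence in
  \<open>F B\<^sup>+\<close> for \<open>F\<close> of degree two. There \<open>E\<close> vanishes
  because \<open>E (z \<otimes> b) = \<epsilon> b \<odot> E z\<close>. Thus
  \<open>E x = \<zero>\<close>, and the Hopf module decomposition leaves \<open>x\<close> in
  \<open>B\<close>.\<close>

lemma hopf_subalgebra_eq_carrier:
  assumes B: "hopf_subalgebra k H B" and cor: "coradical k H \<subseteq> B"
    and aug: "augmentation (carrier H) \<subseteq> mult_span (carrier H) (augmentation B)"
  shows "B = carrier H"
proof -
  note B' = hopf_subalgebraD[OF B]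
  have BH: "B \<subseteq> carrier H" using B'(6) by blast
  note fil1 = fil_one[OF B'(5)]
  note fl = fil_left_stable[OF B'(4)]
  obtain p where p: "linear p" "\<And>a. a \<in> B \<Longrightarrow> p a = a" "\<And>h. h \<in> carrier H \<Longrightarrow> p h \<in> B"
    using ex_projection[OF B'(2)] by blast
  obtain E where E: "linear E" "\<And>x. x \<in> fil B (Suc 0) \<Longrightarrow> E x = \<zero>"
    "\<And>x a. x \<in> fil B (Suc (Suc 0)) \<Longrightarrow> a \<in> B \<Longrightarrow> E (x \<otimes> a) = \<epsilon> a \<odot> E x"
    "\<And>x. x \<in> fil B (Suc (Suc 0)) \<Longrightarrow> x \<ominus> swH (\<lambda>u v. E u \<otimes> p v) x \<in> fil B (Suc 0)"
    using ex_coinvariant_projection[OF B p] by blast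
  let ?F = "fil B (Suc (Suc 0))"
  note Fcl = submodule_closed[OF fil_submodule[of B "Suc (Suc 0)"]]
  have [simp]: "p h \<in> carrier H" "E h \<in> carrier H" if "h \<in> carrier H" for h using p(1) E(1) that by simp_all
  have one: "\<one> \<in> ?F" using fil_Suc[of B "Suc 0"] fil1 B'(8) by blast
  have EF: "E x = \<zero>" if xF: "x \<in> ?F" for x
  proof -
    have x: "x \<in> carrier H" using Fcl(2)[OF xF] .
    let ?y = "x \<ominus> \<epsilon> x \<odot> \<one>"
    have "\<epsilon> ?y = \<zero>\<^bsub>k\<^esub>" using x by (simp add: dual_minus[OF counit_dual] dual_smult[OF counit_dual] counit_one)
    then have "?y \<in> augmentation (carrier H)" using x by (simp add: augmentation_def)
    moreover have "?y \<in> ?F" using Fcl(4)[OF xF Fcl(6)[OF _ one]] x by simp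
    ultimately have "?y \<in> mult_span ?F (augmentation B)"
      using aug by (intro mult_span_fil[OF B cor]) (auto simp: augmentation_def)
    moreover have "mult_span ?F (augmentation B) \<subseteq> {v \<in> carrier H. E v \<in> {\<zero>}}"
    proof (rule mult_span_least)
      show "submodule {v \<in> carrier H. E v \<in> {\<zero>}} k H"
        by (intro submodule_vimage E(1) carrier_is_submodule submodule_zero)
      fix z b assume zb: "z \<in> ?F" "b \<in> augmentation B"
      then have "E (z \<otimes> b) = \<epsilon> b \<odot> E z" by (intro E(3)) (auto simp: augmentation_def)
      then show "z \<otimes> b \<in> {v \<in> carrier H. E v \<in> {\<zero>}}"
        using zb BH Fcl(2)[OF zb(1)] by (auto simp: augmentation_def)
    qed
    ultimately have "E ?y = \<zero>" by blast
    moreover have "E ?y = E x \<ominus> \<epsilon> x \<odot> E \<one>"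
      using x by (simp add: linear_minus[OF E(1)] linear_smult[OF E(1)])
    moreover have "E \<one> = \<zero>" using E(2) B'(8) fil1 by blast
    ultimately show ?thesis using x by simp
  qed
  have F: "?F = B"
  proof
    show "B \<subseteq> ?F" using fil_Suc[of B "Suc 0"] fil1 by blast
    show "?F \<subseteq> B"
    proof
      fix x assume xF: "x \<in> ?F"
      have eb: "bilinear_op (\<lambda>u v. E u \<otimes> p v)"
        by (intro linear_intros linear_comp[OF p(1)] linear_comp[OF E(1)]) auto
      have "swH (\<lambda>u v. E u \<otimes> p v) x \<in> {\<zero>}"
      proof (rule swH_mem[OF eb submodule_zero _ order_refl comult_left_stable[OF fl xF]])
        show "?F \<subseteq> carrier H" using Fcl(2) by blast
        show "E u \<otimes> p v \<in> {\<zero>}" if "u \<in> ?F" "v \<in> carrier H" for u v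
          unfolding EF[OF that(1)] using that(2) by simp
      qed
      then have "x \<ominus> \<zero> \<in> fil B (Suc 0)" using E(4)[OF xF] by simp
      then show "x \<in> B" using Fcl(2)[OF xF] fil1 by (auto simp del: fil.simps)
    qed
  qed
  have "fil B n \<subseteq> B" for n
  proof (induction n)
    case 0
    then show ?case using submodule_closed(1)[OF B'(2)] by simp
  next
    case (Suc n)
    then have "fil B (Suc n) \<subseteq> ?F" using fil1 by auto
    then show ?case using F by blast
  qed
  then show ?thesis using fil_exhausts[OF B'(4) cor] BH by blast
qed

subsection \<open>Affine Hopf subalgebras\<close>

lemma unital_subalgebraI:
  assumes "W \<subseteq> carrier H" "\<one> \<in> W" "\<And>x y. x \<in> W \<Longrightarrow> y \<in> W \<Longrightarrow> x \<oplus> y \<in> W"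
    "\<And>x y. x \<in> W \<Longrightarrow> y \<in> W \<Longrightarrow> x \<otimes> y \<in> W" "\<And>c x. c \<in> carrier k \<Longrightarrow> x \<in> W \<Longrightarrow> c \<odot> x \<in> W"
  shows "unital_subalgebra k H W"
proof -
  have "\<zero>\<^bsub>k\<^esub> \<odot> \<one> \<in> W" using assms(2,5) k.zero_closed by blast
  then have sub: "submodule W k H" using assms by (intro submoduleI') auto
  have "subring W H"
    using assms submodule_closed(5)[OF sub] by (intro H.subringI) auto
  with sub show ?thesis by (simp add: unital_subalgebra_def)
qed

lemma unital_subalgebraD:
  assumes "unital_subalgebra k H W"
  shows "submodule W k H" "\<one> \<in> W" "\<And>x y. x \<in> W \<Longrightarrow> y \<in> W \<Longrightarrow> x \<otimes> y \<in> W"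
  using assms subringE(3,6)[of W H] by (auto simp: unital_subalgebra_def)

lemma carrier_unital_subalgebra: "unital_subalgebra k H (carrier H)"
  by (rule unital_subalgebraI) auto

lemma generated_subalgebra_unital:
  assumes "S \<subseteq> carrier H" shows "unital_subalgebra k H (generated_subalgebra k H S)"
proof (rule unital_subalgebraI)
  show "generated_subalgebra k H S \<subseteq> carrier H"
    unfolding generated_subalgebra_def using assms carrier_unital_subalgebra by blast
qed (auto simp: generated_subalgebra_def dest: unital_subalgebraD intro: submodule_closed unital_subalgebraD)

lemma generated_subalgebra_superset: "S \<subseteq> generated_subalgebra k H S"
  by (auto simp: generated_subalgebra_def)

lemma generated_subalgebra_least: "unital_subalgebra k H W \<Longrightarrow> S \<subseteq> W \<Longrightarrow> generated_subalgebra k H S \<subseteq> W"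
  by (auto simp: generated_subalgebra_def)

section \<open>Generated Hopf subalgebras and their antipodes\<close>

lemma tensor_span_mult_closed:
  assumes B: "unital_subalgebra k H B" and t: "t \<in> tensor_span k H B B" and u: "u \<in> tensor_span k H B B"
  shows "t \<otimes>\<^bsub>HH_algebra\<^esub> u \<in> tensor_span k H B B"
proof -
  note B' = unital_subalgebraD[OF B]
  have BH: "B \<subseteq> carrier H" using submodule_closed(2)[OF B'(1)] by blast
  note sub = tensor_span_subgroup[OF BH BH] note T = HH.tensor_comm_group
  have uT: "u \<in> carrier (HH)" using subgroup.subset[OF sub] u by blast
  have "tensor_lift (HH) (\<lambda>a b. tensor_lift (HH)
      (\<lambda>c d. pure (a \<otimes> c) (b \<otimes> d)) u) t \<in> tensor_span k H B B"
  proof (rule HH.lift_mem[OF T mult_bilinear_outer[OF T pure_bilinear uT] sub _ BH BH])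
    fix a b assume ab: "a \<in> B" "b \<in> B"
    then show "tensor_lift (HH) (\<lambda>c d. pure (a \<otimes> c) (b \<otimes> d)) u \<in> tensor_span k H B B"
      using BH B'(3) u
      by (intro HH.lift_mem[OF T mult_bilinear_inner(1)[OF pure_bilinear] sub _ BH BH])
        (auto simp: tensor_span_def intro!: pure_in_tensor_span[unfolded tensor_span_def])
  qed (use t in \<open>simp add: tensor_span_def\<close>)
  then show ?thesis by (simp add: tensor_algebra_def)
qed

lemma tensor_span_smult_closed:
  assumes B: "unital_subalgebra k H B" and t: "t \<in> tensor_span k H B B" and c: "c \<in> carrier k"
  shows "c \<odot>\<^bsub>HH_algebra\<^esub> t \<in> tensor_span k H B B"
proof -
  note B' = unital_subalgebraD[OF B]
  have BH: "B \<subseteq> carrier H" using submodule_closed(2)[OF B'(1)] by blast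
  note sub = tensor_span_subgroup[OF BH BH] note T = HH.tensor_comm_group
  have "tensor_lift (HH) (\<lambda>a b. pure (c \<odot> a) b) t \<in> tensor_span k H B B"
    using t submodule_closed(6)[OF B'(1)] c
    by (intro HH.lift_mem[OF T scale_left_bilinear[OF pure_bilinear c] sub _ BH BH])
      (auto simp: tensor_span_def intro!: pure_in_tensor_span[unfolded tensor_span_def])
  then show ?thesis by (simp add: tensor_algebra_def)
qed

text \<open>The elements with coproduct in \<open>B \<otimes> B\<close> form a subalgebra since the
  comultiplication is multiplicative, and those with antipode in \<open>B\<close> do so since the
  antipode is anti-multiplicative. Generators therefore suffice.\<close>

lemma generated_subalgebra_hopf:
  assumes S: "S \<subseteq> carrier H"
    and comult: "\<And>s. s \<in> S \<Longrightarrow> comult H s \<in> tensor_span k H (generated_subalgebra k H S) (generated_subalgebra k H S)"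
    and antipode: "\<And>s. s \<in> S \<Longrightarrow> \<S> s \<in> generated_subalgebra k H S"
  shows "hopf_subalgebra k H (generated_subalgebra k H S)" (is "hopf_subalgebra k H ?B")
proof -
  note B = generated_subalgebra_unital[OF S]
  note B' = unital_subalgebraD[OF B] note Bcl = submodule_closed[OF B'(1)]
  have BH: "?B \<subseteq> carrier H" using Bcl(2) by blast
  note sub = tensor_span_subgroup[OF BH BH]
  have "unital_subalgebra k H {y \<in> ?B. comult H y \<in> tensor_span k H ?B ?B}"
  proof (rule unital_subalgebraI)
    show "\<one> \<in> {y \<in> ?B. comult H y \<in> tensor_span k H ?B ?B}"
      using B'(2) by (auto simp: comult_one intro: pure_in_tensor_span)
  qed (use Bcl B'(3) subgroup.m_closed[OF sub] tensor_span_mult_closed[OF B] tensor_span_smult_closed[OF B]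
      in \<open>auto simp: comult_add comult_mult comult_smult\<close>)
  then have 1: "?B \<subseteq> {y \<in> ?B. comult H y \<in> tensor_span k H ?B ?B}"
    using comult generated_subalgebra_superset[of S] by (intro generated_subalgebra_least) auto
  have "unital_subalgebra k H {y \<in> ?B. \<S> y \<in> ?B}"
    using Bcl B'(2,3)
    by (intro unital_subalgebraI) (auto simp: antipode_one antipode_mult linear_add[OF antipode_linear] linear_smult[OF antipode_linear])
  then have 2: "?B \<subseteq> {y \<in> ?B. \<S> y \<in> ?B}"
    using antipode generated_subalgebra_superset[of S] by (intro generated_subalgebra_least) auto
  show ?thesis
    unfolding hopf_subalgebra_def subcoalgebra_def using B B'(1) 1 2 by blast
qed

text \<open>
  Takeuchi's argument: the antipode is determined by its restriction to the coradical, so a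
  bialgebra containing the coradical and its antipodes is closed under the antipode.
\<close>

lemma antipode_in_subalgebra:
  assumes A: "hopf_subalgebra k H A" and C: "subcoalgebra k H C"
    and B: "unital_subalgebra k H B" and AB: "A \<subseteq> B" and CB: "C \<subseteq> B"
  shows "x \<in> C \<inter> fil A n \<Longrightarrow> \<S> x \<in> B"
proof (induction n arbitrary: x)
  case 0
  then show ?case using submodule_closed(1)[OF unital_subalgebraD(1)[OF B]] by (simp add: linear_zero[OF antipode_linear])
next
  case (Suc n)
  note A' = hopf_subalgebraD[OF A] and C' = subcoalgebraD[OF C] and B' = unital_subalgebraD[OF B]
  note Cl = subcoalgebra_stable(1)[OF C] note Bcl = submodule_closed[OF B'(1)] note Acl = submodule_closed[OF A'(2)]
  have AH: "A \<subseteq> carrier H" and CH: "C \<subseteq> carrier H" using A'(6) C'(3) by blast+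
  let ?U = "C \<inter> fil A n" let ?V = "C \<inter> fil A (Suc n)"
  have U: "left_stable ?U" and V: "left_stable ?V"
    by (rule left_stable_Int[OF Cl fil_left_stable[OF A'(4)]])+
  note U' = left_stableD[OF U] and V' = left_stableD[OF V]
  obtain p where p: "linear p" "\<And>a. a \<in> A \<Longrightarrow> p a = a" "\<And>h. h \<in> carrier H \<Longrightarrow> p h \<in> A"
    using ex_projection[OF A'(2)] by blast
  have [simp]: "p h \<in> carrier H" if "h \<in> carrier H" for h using p(1) that by simp
  have lin_p: "linear (\<lambda>x. p (f x))" if "linear f" for f by (rule linear_comp[OF p(1) that])
  have Sb: "bilinear_op (\<lambda>u w. \<S> u \<otimes> w)" by (intro linear_intros) auto
  have slice: "lhit (\<lambda>z. f (g z)) y \<in> ?U"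
    if "y \<in> ?V" "linear g" "\<And>a. a \<in> A \<Longrightarrow> g a = \<zero>" "f \<in> dual" for f g y
    using that left_stableD(2)[OF Cl] dual_comp[OF that(4,2)] by simp
  \<comment> \<open>\<open>J\<close> imitates
    \<open>\<Sum> S(y\<^sub>1) y\<^sub>2 = \<epsilon>(y) 1\<close> with the second leg forced into
    \<open>A\<close>. The difference of \<open>p\<close> and the identity vanishes on
    \<open>A\<close>, so in the error the first legs drop to \<open>fil A n\<close>, where the
    induction hypothesis applies.\<close>
  define J where "J = (\<lambda>x. swH (\<lambda>u v. \<S> u \<otimes> p v) x)"
  have Jb: "bilinear_op (\<lambda>u v. \<S> u \<otimes> p v)" by (intro linear_intros lin_p) auto
  have J: "linear J" unfolding J_def by (intro linear_swH Jb linear_id)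
  have JV: "J y \<in> B" if y: "y \<in> ?V" for y
  proof -
    have yH: "y \<in> carrier H" using V'(3)[OF y] .
    let ?g = "\<lambda>v. p v \<ominus> v"
    have g: "linear ?g" by (intro linear_intros lin_p)
    have g0: "?g a = \<zero>" if "a \<in> A" for a using p(2)[OF that] A'(6)[OF that] by simp
    have gC: "?g ` C \<subseteq> B" using p(3) AB CB CH Bcl(4) by blast
    have Cy: "comult H y \<in> tensor_span k H (carrier H) C"
      using C'(2)[of y] y tensor_span_mono[OF CH order_refl[of C]] by blast
    have "swH (\<lambda>u v. \<S> u \<otimes> ?g v) y \<in> B"
      using slice[OF y g g0] Suc.IH B'(3)
      by (intro swH_slice_mem[OF Sb g U'(1) B'(1) B'(1) yH CH Cy gC]) auto
    also have "swH (\<lambda>u v. \<S> u \<otimes> ?g v) y = swH (\<lambda>u v. \<S> u \<otimes> p v \<ominus> \<S> u \<otimes> v) y"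
      using g by (intro swH_cong[OF _ yH] linear_intros linear_comp[OF g]) (auto simp: a_minus_def H.r_distr H.r_minus)
    also have "\<dots> = J y \<ominus> \<epsilon> y \<odot> \<one>"
      unfolding J_def swH_antipode_left[OF yH, symmetric] by (rule swH_diff[OF Jb Sb yH])
    finally have "(J y \<ominus> \<epsilon> y \<odot> \<one>) \<oplus> \<epsilon> y \<odot> \<one> \<in> B"
      using Bcl(3,6) B'(2) yH by simp
    then show ?thesis using yH J by simp
  qed
  have xV: "x \<in> ?V" using Suc.prems .
  have x: "x \<in> carrier H" using V'(3)[OF xV] .
  define T where "T = (\<lambda>v. swH (\<lambda>c d. p c \<otimes> \<S> (p d)) v)"
  have Tb: "bilinear_op (\<lambda>c d. p c \<otimes> \<S> (p d))" by (intro linear_intros lin_p) auto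
  have T: "linear T" unfolding T_def by (intro linear_swH Tb linear_id)
  have TA: "T z \<in> A" if "z \<in> carrier H" for z
    unfolding T_def using that p(3) A'(7,9)
    by (intro swH_mem[OF Tb A'(2) order_refl order_refl]) (auto simp: tensor_span_carrier)
  have STb: "bilinear_op (\<lambda>u v. \<S> u \<otimes> T v)" using T by (intro linear_intros linear_comp[OF T]) auto
  have JSb: "bilinear_op (\<lambda>u v. J u \<otimes> \<S> (p v))" using J by (intro linear_intros lin_p linear_comp[OF J]) auto
  \<comment> \<open>This sum lies in \<open>B\<close> and regroups to
    \<open>\<Sum> S(x\<^sub>1) T(x\<^sub>2)\<close>. As \<open>T\<close> is the counit times the
    unit on \<open>A\<close>, it equals \<open>S(x)\<close> up to a sum whose first legs lie one
    degree lower.\<close>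
  have "swH (\<lambda>u v. J u \<otimes> \<S> (p v)) x \<in> B"
  proof (rule swH_mem[OF JSb B'(1) _ order_refl comult_left_stable[OF V xV]])
    show "?V \<subseteq> carrier H" using V'(3) by blast
    show "J u \<otimes> \<S> (p v) \<in> B" if "u \<in> ?V" "v \<in> carrier H" for u v
      using JV[OF that(1)] A'(9)[OF p(3)[OF that(2)]] AB B'(3) by blast
  qed
  also have "swH (\<lambda>u v. J u \<otimes> \<S> (p v)) x = swH (\<lambda>u v. swH (\<lambda>c d. (\<S> c \<otimes> p d) \<otimes> \<S> (p v)) u) x"
  proof (rule swH_cong[OF JSb x])
    fix u v assume "u \<in> carrier H" "v \<in> carrier H"
    then show "J u \<otimes> \<S> (p v) = swH (\<lambda>c d. (\<S> c \<otimes> p d) \<otimes> \<S> (p v)) u"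
      unfolding J_def by (intro linear_swH_comp[where f = "\<lambda>z. z \<otimes> \<S> (p v)"] linear_mult_right linear_id Jb) auto
  qed
  also have "\<dots> = swH (\<lambda>u v. swH (\<lambda>c d. (\<S> u \<otimes> p c) \<otimes> \<S> (p d)) v) x"
    using x by (intro swH_coassoc linear_intros lin_p) auto
  also have "\<dots> = swH (\<lambda>u v. \<S> u \<otimes> T v) x"
  proof (rule swH_cong[OF STb x, symmetric])
    fix u v assume "u \<in> carrier H" "v \<in> carrier H"
    then show "\<S> u \<otimes> T v = swH (\<lambda>c d. (\<S> u \<otimes> p c) \<otimes> \<S> (p d)) v"
      unfolding T_def
      by (intro linear_swH_apply[where p = "\<lambda>z. \<S> u \<otimes> z"] linear_intros lin_p) (auto simp: H.m_assoc)
  qed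
  finally have 1: "swH (\<lambda>u v. \<S> u \<otimes> T v) x \<in> B" .
  let ?g = "\<lambda>v. \<epsilon> v \<odot> \<one> \<ominus> T v"
  have g: "linear ?g" using T by (intro linear_intros counit_dual) auto
  have g0: "?g a = \<zero>" if a: "a \<in> A" for a
  proof -
    have "T a = swH (\<lambda>c d. c \<otimes> \<S> d) a"
      unfolding T_def using a AH p(2)
      by (intro swH_cong_on[OF Tb _ AH AH _ A'(10)[OF a]] linear_intros) auto
    then show ?thesis using a AH by (simp add: swH_antipode_right subset_iff)
  qed
  have gA: "?g ` carrier H \<subseteq> B" using TA AB Bcl(4,6) B'(2) by (auto simp: subset_iff)
  have cx: "comult H x \<in> tensor_span k H (carrier H) (carrier H)" using x by (simp add: tensor_span_carrier)
  have Seb: "bilinear_op (\<lambda>u v. \<epsilon> v \<odot> \<S> u)" by (intro linear_intros counit_dual) auto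
  have "swH (\<lambda>u v. \<S> u \<otimes> ?g v) x \<in> B"
    using slice[OF xV g g0] Suc.IH B'(3)
    by (intro swH_slice_mem[OF Sb g U'(1) B'(1) B'(1) x order_refl cx gA]) auto
  also have "swH (\<lambda>u v. \<S> u \<otimes> ?g v) x = swH (\<lambda>u v. \<epsilon> v \<odot> \<S> u \<ominus> \<S> u \<otimes> T v) x"
    using x T g by (intro swH_cong linear_intros linear_comp[OF g])
      (auto simp: a_minus_def H.r_distr H.r_minus smult_mult_right)
  also have "\<dots> = swH (\<lambda>u v. \<epsilon> v \<odot> \<S> u) x \<ominus> swH (\<lambda>u v. \<S> u \<otimes> T v) x"
    by (rule swH_diff[OF Seb STb x])
  also have "swH (\<lambda>u v. \<epsilon> v \<odot> \<S> u) x = \<S> x" by (rule swH_counit_right[OF antipode_linear x])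
  finally have "(\<S> x \<ominus> swH (\<lambda>u v. \<S> u \<otimes> T v) x) \<oplus> swH (\<lambda>u v. \<S> u \<otimes> T v) x \<in> B"
    using Bcl(3) 1 by blast
  then show ?case using x STb by simp
qed

text \<open>The fundamental theorem of coalgebras: right translation of a finitely spanned right
  coideal stays in a finite span, because each generator has finitely many second legs.\<close>

lemma ex_finite_subcoalgebra:
  assumes x: "x \<in> carrier H"
  obtains G where "finite G" "G \<subseteq> carrier H" "subcoalgebra k H (lspan G)" "x \<in> lspan G"
proof -
  obtain G where G: "finite G" "G \<subseteq> carrier H" "left_stable (lspan G)" "x \<in> lspan G"
    using ex_finite_left_stable[OF x] by blast
  have "\<forall>g \<in> G. \<exists>F. finite F \<and> F \<subseteq> carrier H \<and> (\<forall>f \<in> dual. rhit f g \<in> lspan F)"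
  proof
    fix g assume "g \<in> G"
    then have "g \<in> carrier H" using G(2) by blast
    from rhits_finite[OF this] show "\<exists>F. finite F \<and> F \<subseteq> carrier H \<and> (\<forall>f \<in> dual. rhit f g \<in> lspan F)" by metis
  qed
  then obtain F where F: "\<And>g. g \<in> G \<Longrightarrow> finite (F g) \<and> F g \<subseteq> carrier H \<and> (\<forall>f \<in> dual. rhit f g \<in> lspan (F g))"
    by metis
  let ?F = "\<Union>g \<in> G. F g"
  have FH: "finite ?F" "?F \<subseteq> carrier H" using G(1) F by auto
  note FS = lspan_submodule[OF FH(2)]
  have sub: "rhit f t \<in> lspan ?F" if f: "f \<in> dual" and t: "t \<in> lspan G" for f t
  proof -
    have "rhit f g \<in> lspan ?F" if g: "g \<in> G" for g
    proof -
      have "lspan (F g) \<subseteq> lspan ?F" using lspan_superset[of ?F] g by (intro lspan_least[OF FS]) blast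
      then show ?thesis using F[OF g] f by blast
    qed
    then have "lspan G \<subseteq> {v \<in> carrier H. rhit f v \<in> lspan ?F}"
      using G(2) by (intro lspan_least submodule_vimage[OF linear_rhit[OF f] carrier_is_submodule FS]) auto
    then show ?thesis using t by blast
  qed
  note C = right_translates[OF G(3)]
  have "right_translates (lspan G) \<subseteq> lspan ?F"
    unfolding right_translates_def using sub by (intro lspan_least[OF FS]) auto
  from submodule_of_finite_span[OF FH subcoalgebraD(1)[OF C(1)] this] obtain G'
    where "finite G'" "G' \<subseteq> carrier H" "lspan G' = right_translates (lspan G)" by blast
  then show ?thesis using that C G(4) by auto
qed

text \<open>Adjoin a finitely spanned subcoalgebra containing \<open>x\<close>. Adjoining the
  iterated antipodes of \<open>x\<close> might destroy finite generation;
  \<open>antipode_in_subalgebra\<close> shows that they are already present, as \<open>A\<close>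
  contains the coradical.\<close>

lemma extend_affine_hopf_subalgebra:
  assumes A: "hopf_subalgebra k H A" and cor: "coradical k H \<subseteq> A" and aff: "affine_subalgebra k H A"
    and x: "x \<in> carrier H"
  obtains B where "hopf_subalgebra k H B" "affine_subalgebra k H B" "A \<subseteq> B" "x \<in> B"
proof -
  note A' = hopf_subalgebraD[OF A]
  obtain S where S: "finite S" "S \<subseteq> A" "generated_subalgebra k H S = A"
    using aff by (auto simp: affine_subalgebra_def)
  obtain G where G: "finite G" "G \<subseteq> carrier H" "subcoalgebra k H (lspan G)" "x \<in> lspan G"
    using ex_finite_subcoalgebra[OF x] by blast
  have SG: "S \<union> G \<subseteq> carrier H" using S(2) A'(6) G(2) by blast
  let ?B = "generated_subalgebra k H (S \<union> G)"
  note B = generated_subalgebra_unital[OF SG]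
  note sup = generated_subalgebra_superset[of "S \<union> G"]
  have AB: "A \<subseteq> ?B" using generated_subalgebra_least[OF B, of S] sup S(3) by blast
  have CB: "lspan G \<subseteq> ?B" using sup by (intro lspan_least unital_subalgebraD(1)[OF B]) blast
  have "hopf_subalgebra k H ?B"
  proof (rule generated_subalgebra_hopf[OF SG])
    fix s assume s: "s \<in> S \<union> G"
    then have s': "s \<in> A \<or> s \<in> lspan G" using S(2) lspan_superset[of G] by blast
    then show "comult H s \<in> tensor_span k H ?B ?B"
      using A'(10)[of s] subcoalgebraD(2)[OF G(3), of s] tensor_span_mono[OF AB AB] tensor_span_mono[OF CB CB] by blast
    obtain n where "s \<in> fil A n" using fil_exhausts[OF A'(4) cor] s SG by blast
    then show "\<S> s \<in> ?B"
      using s' A'(9)[of s] AB antipode_in_subalgebra[OF A G(3) B AB CB, of s n] by blast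
  qed
  moreover have "affine_subalgebra k H ?B"
    unfolding affine_subalgebra_def using B sup S(1) G(1) by (intro conjI exI[of _ "S \<union> G"]) auto
  ultimately show ?thesis using that AB CB G(4) by blast
qed

text \<open>Otherwise dependent choice produces a strictly increasing chain of left ideals
  \<open>H K\<^sup>+\<close>. The family is kept abstract for its two uses: the affine Hopf
  subalgebras inside \<open>A\<close>, and those containing \<open>A\<close>.\<close>

lemma left_noetherian_augmentation:
  assumes noeth: "left_noetherian H" and ne: "\<K> \<noteq> {}" and sub: "\<And>K. K \<in> \<K> \<Longrightarrow> K \<subseteq> carrier H"
    and directed: "\<And>K x. K \<in> \<K> \<Longrightarrow> x \<in> D \<Longrightarrow> \<exists>L \<in> \<K>. K \<subseteq> L \<and> x \<in> L" and D: "D \<subseteq> carrier H"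
  shows "\<exists>K \<in> \<K>. augmentation D \<subseteq> mult_span (carrier H) (augmentation K)"
proof (rule ccontr)
  assume no: "\<not> ?thesis"
  define I where "I K = mult_span (carrier H) (augmentation K)" for K
  have aug: "augmentation K \<subseteq> carrier H" if "K \<in> \<K>" for K using sub[OF that] by (auto simp: augmentation_def)
  have "\<exists>L. L \<in> \<K> \<and> K \<subseteq> L \<and> I L \<noteq> I K" if K: "K \<in> \<K>" for K
  proof -
    obtain x where x: "x \<in> augmentation D" "x \<notin> I K" using no K by (auto simp: I_def)
    then obtain L where L: "L \<in> \<K>" "K \<subseteq> L" "x \<in> L" using directed[OF K] by (auto simp: augmentation_def)
    then have "\<one> \<otimes> x \<in> I L" unfolding I_def using x by (intro mult_span_mem) (auto simp: augmentation_def)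
    then have "x \<in> I L" using sub[OF L(1)] L(3) by auto
    then show ?thesis using L x by blast
  qed
  then have "\<exists>K. \<forall>n. K n \<in> \<K> \<and> K n \<subseteq> K (Suc n) \<and> I (K (Suc n)) \<noteq> I (K n)"
    using ne by (intro dependent_nat_choice) auto
  then obtain K where K: "\<And>n. K n \<in> \<K>" "\<And>n. K n \<subseteq> K (Suc n) \<and> I (K (Suc n)) \<noteq> I (K n)" by blast
  have "left_ideal (I (K n)) H" for n
  proof -
    have J: "submodule (I (K n)) k H" unfolding I_def by (intro mult_span_submodule aug K(1)) auto
    have "r \<otimes> y \<in> I (K n)" if r: "r \<in> carrier H" and y: "y \<in> I (K n)" for r y
    proof -
      have "I (K n) \<subseteq> {v \<in> carrier H. r \<otimes> v \<in> I (K n)}"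
        unfolding I_def[of "K n", THEN arg_cong[where f = "\<lambda>M. M \<subseteq> _"]]
      proof (rule mult_span_least)
        show "submodule {v \<in> carrier H. r \<otimes> v \<in> I (K n)} k H"
          using r by (intro submodule_vimage linear_mult_left linear_id carrier_is_submodule J)
        fix u v assume uv: "u \<in> carrier H" "v \<in> augmentation (K n)"
        then have "(r \<otimes> u) \<otimes> v \<in> I (K n)" unfolding I_def using r by (intro mult_span_mem) auto
        then show "u \<otimes> v \<in> {v \<in> carrier H. r \<otimes> v \<in> I (K n)}"
          using r uv aug[OF K(1)] by (auto simp: H.m_assoc subset_iff)
      qed
      then show ?thesis using y by blast
    qed
    then show ?thesis
      using submodule.axioms(1)[OF J] by (auto simp: left_ideal_def intro: additive_subgroup.intro)
  qed
  moreover have "I (K n) \<subseteq> I (K (Suc n))" for n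
  proof -
    have "augmentation (K n) \<subseteq> augmentation (K (Suc n))" using K(2)[of n] by (auto simp: augmentation_def)
    then show ?thesis unfolding I_def by (intro mult_span_mono aug K(1)) auto
  qed
  ultimately have "\<forall>n. left_ideal (I (K n)) H \<and> I (K n) \<subseteq> I (K (Suc n))" by simp
  then have "\<exists>n. \<forall>m \<ge> n. I (K m) = I (K n)"
    by (rule mp[OF spec[OF noeth[unfolded left_noetherian_def], of "\<lambda>n. I (K n)"]])
  then obtain n where n: "\<forall>m \<ge> n. I (K m) = I (K n)" by (elim exE)
  have "I (K (Suc n)) = I (K n)" by (rule n[rule_format]) simp
  then show False using K(2)[of n] by blast
qed

lemma left_noetherian_affine_hopf_subalgebra:
  assumes noeth: "left_noetherian H" and A: "hopf_subalgebra k H A" and cor: "coradical k H \<subseteq> A"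
    and loc: "locally_affine k H A"
  obtains K where "hopf_subalgebra k H K" "affine_subalgebra k H K" "K \<subseteq> A"
    "augmentation A \<subseteq> mult_span A (augmentation K)"
proof -
  note A' = hopf_subalgebraD[OF A]
  let ?K = "{K. hopf_subalgebra k H K \<and> affine_subalgebra k H K \<and> K \<subseteq> A}"
  have "\<exists>K \<in> ?K. augmentation A \<subseteq> mult_span (carrier H) (augmentation K)"
  proof (rule left_noetherian_augmentation[OF noeth])
    show "?K \<noteq> {}" using loc unfolding locally_affine_def by blast
    show "A \<subseteq> carrier H" using A'(6) by blast
    then show "K \<subseteq> carrier H" if "K \<in> ?K" for K using that by blast
    fix K x assume K: "K \<in> ?K" and x: "x \<in> A"
    then obtain S where S: "finite S" "S \<subseteq> K" "generated_subalgebra k H S = K"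
      by (auto simp: affine_subalgebra_def)
    then have "finite (insert x S) \<and> insert x S \<subseteq> A" using K x by auto
    from loc[unfolded locally_affine_def, rule_format, OF this] obtain L
      where L: "hopf_subalgebra k H L" "affine_subalgebra k H L" "insert x S \<subseteq> L" "L \<subseteq> A" by blast
    \<comment> \<open>Local affineness is applied to a finite set of generators of \<open>K\<close>
      together with \<open>x\<close>; this makes the affine Hopf subalgebras inside \<open>A\<close>
      directed.\<close>
    then have "K \<subseteq> L" using generated_subalgebra_least[of L S] S(3) by (auto simp: hopf_subalgebra_def)
    then show "\<exists>L \<in> ?K. K \<subseteq> L \<and> x \<in> L" using L by blast
  qed
  then obtain K where K: "hopf_subalgebra k H K" "affine_subalgebra k H K" "K \<subseteq> A"
    "augmentation A \<subseteq> mult_span (carrier H) (augmentation K)" by blast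
  \<comment> \<open>The degree \<open>Suc 0\<close> stands for \<open>A\<close>: the ideal generated
    in \<open>H\<close> is cut back to the one generated in \<open>A\<close>.\<close>
  have "y \<in> mult_span A (augmentation K)" if "y \<in> augmentation A" for y
    using mult_span_fil[OF A cor, of "augmentation K" y "Suc 0"] K that
    unfolding fil_one[OF A'(5)] by (auto simp: augmentation_def)
  then show ?thesis using that K by blast
qed

lemma left_noetherian_affine:
  assumes noeth: "left_noetherian H" and A: "hopf_subalgebra k H A" and cor: "coradical k H \<subseteq> A"
    and aff: "affine_subalgebra k H A"
  shows "affine_subalgebra k H (carrier H)"
proof -
  let ?K = "{K. hopf_subalgebra k H K \<and> affine_subalgebra k H K \<and> A \<subseteq> K}"
  have "\<exists>K \<in> ?K. augmentation (carrier H) \<subseteq> mult_span (carrier H) (augmentation K)"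
  proof (rule left_noetherian_augmentation[OF noeth])
    show "?K \<noteq> {}" using A aff by blast
    show "K \<subseteq> carrier H" if "K \<in> ?K" for K using that hopf_subalgebraD(6) by blast
    fix K x assume K: "K \<in> ?K" and x: "x \<in> carrier H"
    then obtain L where "hopf_subalgebra k H L" "affine_subalgebra k H L" "K \<subseteq> L" "x \<in> L"
      using extend_affine_hopf_subalgebra[of K x] cor by blast
    then show "\<exists>L \<in> ?K. K \<subseteq> L \<and> x \<in> L" using K by blast
  qed auto
  then obtain K where K: "hopf_subalgebra k H K" "affine_subalgebra k H K" "A \<subseteq> K"
    "augmentation (carrier H) \<subseteq> mult_span (carrier H) (augmentation K)" by blast
  then have "K = carrier H" using cor by (intro hopf_subalgebra_eq_carrier) auto
  then show ?thesis using K(2) by simp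
qed

subsection \<open>Ring epimorphisms between Hopf subalgebras\<close>

lemma sw_cong_on:
  assumes G: "comm_group G" and b: "bilinear G b" and b': "bilinear G b'"
    and C: "C \<subseteq> carrier H" "D \<subseteq> carrier H" and x: "x \<in> carrier H" "comult H x \<in> tensor_span k H C D"
    and eq: "\<And>u v. u \<in> C \<Longrightarrow> v \<in> D \<Longrightarrow> b u v = b' u v"
  shows "sw G b x = sw G b' x"
proof -
  interpret G: comm_group G by (rule G)
  let ?i = "\<lambda>u v. inv\<^bsub>G\<^esub> b' u v"
  have i: "bilinear G ?i" using b' by (auto simp: balanced_def G.inv_mult)
  have "sw G (\<lambda>u v. b u v \<otimes>\<^bsub>G\<^esub> ?i u v) x \<in> {\<one>\<^bsub>G\<^esub>}"
    using bilinearD(1)[OF b'] C eq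
    by (intro sw_mem[OF G HH.lift_mult(2)[OF G b i, of "comult H x"] G.triv_subgroup _ C x(2)]) (auto simp: x subset_iff)
  moreover have "sw G (\<lambda>u v. b' u v \<otimes>\<^bsub>G\<^esub> ?i u v) x \<in> {\<one>\<^bsub>G\<^esub>}"
    using bilinearD(1)[OF b'] C
    by (intro sw_mem[OF G HH.lift_mult(2)[OF G b' i, of "comult H x"] G.triv_subgroup _ C x(2)]) (auto simp: x subset_iff)
  ultimately have "sw G b x \<otimes>\<^bsub>G\<^esub> sw G ?i x = sw G b' x \<otimes>\<^bsub>G\<^esub> sw G ?i x"
    by (simp add: sw_op[OF G b i x(1)] sw_op[OF G b' i x(1)])
  then show ?thesis using sw_closed[OF G _ x(1)] b b' i by simp
qed

lemma bilinear_comp: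
  assumes "bilinear G b" "linear f" "linear g" shows "bilinear G (\<lambda>u v. b (f u) (g v))"
  using assms(1) linear_closed[OF assms(2)] linear_closed[OF assms(3)]
  by (auto simp: balanced_def linear_add[OF assms(2)] linear_add[OF assms(3)] linear_smult[OF assms(2)] linear_smult[OF assms(3)])

lemma bilinear_partial_hom:
  assumes "bilinear G b"
  shows "v \<in> carrier H \<Longrightarrow> (\<lambda>u. b u v) \<in> hom (add_monoid H) G" "u \<in> carrier H \<Longrightarrow> b u \<in> hom (add_monoid H) G"
  using bilinearD[OF assms] by (auto simp: hom_def)

context
  fixes A K :: "'h set"
  assumes A: "hopf_subalgebra k H A" and K: "hopf_subalgebra k H K" and KA: "K \<subseteq> A"
    and aug: "augmentation A \<subseteq> mult_span A (augmentation K)"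
begin

text \<open>Such maps correspond to homomorphisms from \<open>A \<otimes>\<^sub>K A\<close> to
  \<open>G\<close>. Identities in that tensor product are stated for all of them, which spares a
  construction of elements.\<close>

abbreviation "mid G b \<equiv> balanced (H\<lparr>carrier := K\<rparr>) (right_regular H A) (left_regular H A) G b"

lemma midD:
  assumes "mid G b" "x \<in> A" "y \<in> A"
  shows "b x y \<in> carrier G"
    "x' \<in> A \<Longrightarrow> b (x \<oplus> x') y = b x y \<otimes>\<^bsub>G\<^esub> b x' y"
    "y' \<in> A \<Longrightarrow> b x (y \<oplus> y') = b x y \<otimes>\<^bsub>G\<^esub> b x y'"
    "c \<in> K \<Longrightarrow> b (x \<otimes> c) y = b x (c \<otimes> y)"
  using assms by (auto simp: balanced_def right_regular_def left_regular_def)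

text \<open>\<open>b\<close> is controlled on \<open>A\<close> only, while Sweedler sums call for
  maps on \<open>H\<close>; \<open>p\<close> extends it. Scalars move across because multiples of
  the unit lie in \<open>K\<close>.\<close>

lemma mid_bilinear:
  assumes b: "mid G b" and p: "linear p" "\<And>h. h \<in> carrier H \<Longrightarrow> p h \<in> A"
  shows "bilinear G (\<lambda>u v. b (p u) (p v))"
proof -
  note A' = hopf_subalgebraD[OF A] and K' = hopf_subalgebraD[OF K]
  note m = midD[OF b]
  have "b (c \<odot> x) y = b x (c \<odot> y)" if "c \<in> carrier k" "x \<in> A" "y \<in> A" for c x y
  proof -
    have "c \<odot> \<one> \<in> K" using that submodule_closed(6)[OF K'(2)] K'(8) by simp
    then have "b (x \<otimes> (c \<odot> \<one>)) y = b x ((c \<odot> \<one>) \<otimes> y)" using m(4) that by simp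
    then show ?thesis using that A'(6) by (simp add: smult_mult_left smult_mult_right)
  qed
  then show ?thesis using p m by (auto simp: balanced_def linear_add linear_smult)
qed

text \<open>The map \<open>\<phi>(y) = \<Sum> b(y\<^sub>1, S(y\<^sub>2))\<close> kills
  \<open>A K\<^sup>+\<close>: in \<open>\<phi>(a c)\<close> the leg \<open>c\<^sub>1\<close> moves
  across to give \<open>b(a\<^sub>1, c\<^sub>1 S(c\<^sub>2) S(a\<^sub>2))\<close>, and the counit of
  \<open>c\<close> is zero. As \<open>x - \<epsilon>(x) 1\<close> lies in \<open>A\<^sup>+\<close>,
  only the multiple of the unit contributes.\<close>

lemma mid_counit:
  assumes G: "comm_group G" and b: "mid G b" and x: "x \<in> A"
    and p: "linear p" "\<And>a. a \<in> A \<Longrightarrow> p a = a" "\<And>h. h \<in> carrier H \<Longrightarrow> p h \<in> A"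
  shows "sw G (\<lambda>u v. b (p u) (\<S> (p v))) x = b (\<epsilon> x \<odot> \<one>) \<one>"
proof -
  interpret G: comm_group G by (rule G)
  note A' = hopf_subalgebraD[OF A] and K' = hopf_subalgebraD[OF K]
  have AH: "A \<subseteq> carrier H" and KH: "K \<subseteq> carrier H" using A'(6) K'(6) by blast+
  note Acl = submodule_closed[OF A'(2)]
  note m = midD[OF b]
  let ?b = "\<lambda>u v. b (p u) (p v)"
  have bb: "bilinear G ?b" by (rule mid_bilinear[OF b p(1,3)])
  have lin_p: "linear (\<lambda>x. p (f x))" if "linear f" for f by (rule linear_comp[OF p(1) that])
  have pc [simp]: "p h \<in> carrier H" if "h \<in> carrier H" for h using p(1) that by simp
  let ?s = "\<lambda>u v. ?b u (\<S> (p v))"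
  have sb: "bilinear G ?s" by (rule bilinear_comp[OF bb linear_id linear_antipode[OF lin_p[OF linear_id]]])
  define \<phi> where "\<phi> = sw G ?s"
  have \<phi>_eq: "sw G (\<lambda>u v. b (p u) (\<S> (p v))) y = \<phi> y" if "y \<in> carrier H" for y
    unfolding \<phi>_def using p(2) A'(9) p(3) by (intro sw_cong[OF G sb that, symmetric]) simp
  have kill: "\<phi> (a \<otimes> c) = \<one>\<^bsub>G\<^esub>" if a: "a \<in> A" and c: "c \<in> augmentation K" for a c
  proof -
    have cK: "c \<in> K" and c0: "\<epsilon> c = \<zero>\<^bsub>k\<^esub>" using c by (auto simp: augmentation_def)
    have aH: "a \<in> carrier H" and cH: "c \<in> carrier H" using a cK AH KH by auto
    have inner: "bilinear G (\<lambda>z d. ?s (u \<otimes> z) (v \<otimes> d))" if "u \<in> carrier H" "v \<in> carrier H" for u v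
      by (rule mult_bilinear_inner(1)[OF sb that])
    have "\<phi> (a \<otimes> c) = sw G (\<lambda>u v. sw G (\<lambda>z d. ?s (u \<otimes> z) (v \<otimes> d)) c) a"
      unfolding \<phi>_def by (rule sw_mult[OF G sb aH cH])
    also have "\<dots> \<in> {\<one>\<^bsub>G\<^esub>}"
    proof (rule sw_mem[OF G _ G.triv_subgroup _ AH AH A'(10)[OF a]])
      show "bilinear G (\<lambda>u v. sw G (\<lambda>z d. ?s (u \<otimes> z) (v \<otimes> d)) c)"
        using mult_bilinear_outer[OF G sb comult_closed[OF cH]] by (simp add: sw_def)
      fix u v assume uv: "u \<in> A" "v \<in> A"
      then have uvH: "u \<in> carrier H" "v \<in> carrier H" using AH by auto
      let ?f = "\<lambda>z. ?b u (z \<otimes> \<S> v)"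
      have f: "?f \<in> hom (add_monoid H) G"
        using bilinear_partial_hom(2)[OF bilinear_comp[OF bb linear_id linear_mult_right[OF _ linear_id]], of "\<S> v" u] uvH by simp
      have Sb: "bilinear_op (\<lambda>z d. z \<otimes> \<S> d)" by (intro linear_intros) auto
      have "sw G (\<lambda>z d. ?s (u \<otimes> z) (v \<otimes> d)) c = sw G (\<lambda>z d. ?f (z \<otimes> \<S> d)) c"
      proof (rule sw_cong_on[OF G inner[OF uvH] _ KH KH cH K'(10)[OF cK]])
        show "bilinear G (\<lambda>z d. ?f (z \<otimes> \<S> d))"
          by (rule HH.lift_hom_comp(2)[OF H.a_comm_group G bilinear_op_bilinear[OF Sb] f comult_closed[OF cH]])
        fix z d assume zd: "z \<in> K" "d \<in> K"
        then have zdH: "z \<in> carrier H" "d \<in> carrier H" "z \<in> A" "d \<in> A" using KH KA by auto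
        have mem: "u \<otimes> z \<in> A" "v \<otimes> d \<in> A" "\<S> d \<in> A" "\<S> v \<in> A" "\<S> d \<otimes> \<S> v \<in> A" "z \<otimes> \<S> d \<otimes> \<S> v \<in> A"
          using uv zdH A'(7,9) by simp_all
        have "?s (u \<otimes> z) (v \<otimes> d) = b (u \<otimes> z) (\<S> d \<otimes> \<S> v)"
          using mem uvH zdH by (simp add: p(2) antipode_mult)
        also have "\<dots> = b u (z \<otimes> (\<S> d \<otimes> \<S> v))" by (rule m(4)[OF uv(1) mem(5) zd(1)])
        also have "\<dots> = ?f (z \<otimes> \<S> d)" using mem uv uvH zdH by (simp add: p(2) H.m_assoc)
        finally show "?s (u \<otimes> z) (v \<otimes> d) = ?f (z \<otimes> \<S> d)" .
      qed
      also have "\<dots> = ?f (swH (\<lambda>z d. z \<otimes> \<S> d) c)"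
        by (rule sw_comp[OF H.a_comm_group G bilinear_op_bilinear[OF Sb] f cH, symmetric])
      also have "\<dots> = ?f \<zero>" using cH by (simp add: swH_antipode_right c0)
      also have "\<dots> = \<one>\<^bsub>G\<^esub>"
        using hom_one[OF f] H.a_comm_group G by (simp add: comm_group_def)
      finally show "sw G (\<lambda>z d. ?s (u \<otimes> z) (v \<otimes> d)) c \<in> {\<one>\<^bsub>G\<^esub>}" by simp
    qed
    finally show ?thesis by simp
  qed
  \<comment> \<open>\<open>G\<close> is merely an abelian group, so the kernel of
    \<open>\<phi>\<close> may fail to be a subspace; requiring the vanishing for all scalar
    multiples makes it one.\<close>
  let ?W = "{y \<in> carrier H. \<forall>c \<in> carrier k. \<phi> (c \<odot> y) = \<one>\<^bsub>G\<^esub>}"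
  have \<phi>_add: "\<phi> (y \<oplus> z) = \<phi> y \<otimes>\<^bsub>G\<^esub> \<phi> z" if "y \<in> carrier H" "z \<in> carrier H" for y z
    unfolding \<phi>_def by (rule sw_add[OF G sb that])
  have \<phi>_closed: "\<phi> y \<in> carrier G" if "y \<in> carrier H" for y
    unfolding \<phi>_def by (rule sw_closed[OF G sb that])
  have "\<phi> \<zero> = \<one>\<^bsub>G\<^esub>" using \<phi>_add[of "\<zero>" "\<zero>"] \<phi>_closed[of "\<zero>"] by simp
  then have "submodule ?W k H"
    by (intro submoduleI') (auto simp: smult_r_distr \<phi>_add simp flip: smult_assoc1)
  then have "mult_span A (augmentation K) \<subseteq> ?W"
  proof (rule mult_span_least)
    fix a c assume ac: "a \<in> A" "c \<in> augmentation K"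
    then have H: "a \<in> carrier H" "c \<in> carrier H" using AH KH by (auto simp: augmentation_def)
    have "\<phi> (r \<odot> (a \<otimes> c)) = \<one>\<^bsub>G\<^esub>" if "r \<in> carrier k" for r
      using kill[of "r \<odot> a" c] ac H that Acl(6) by (simp add: smult_mult_left)
    then show "a \<otimes> c \<in> ?W" using H by simp
  qed
  moreover have xH: "x \<in> carrier H" using x AH by blast
  let ?e = "\<epsilon> x \<odot> \<one>"
  have eA: "?e \<in> A" using Acl(6) A'(8) xH by simp
  have "\<epsilon> (x \<ominus> ?e) = \<zero>\<^bsub>k\<^esub>"
    using xH by (simp add: dual_minus[OF counit_dual] dual_smult[OF counit_dual] counit_one)
  then have "x \<ominus> ?e \<in> augmentation A" using Acl(4)[OF x eA] by (simp add: augmentation_def)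
  ultimately have "\<forall>c \<in> carrier k. \<phi> (c \<odot> (x \<ominus> ?e)) = \<one>\<^bsub>G\<^esub>" using aug by blast
  from bspec[OF this k.one_closed] have "\<phi> (x \<ominus> ?e) = \<one>\<^bsub>G\<^esub>" using xH by simp
  then have "\<phi> x = \<phi> ?e" using \<phi>_add[of "x \<ominus> ?e" ?e] \<phi>_closed[of ?e] xH by simp
  also have "\<phi> ?e = ?s ?e \<one>"
    unfolding \<phi>_def using xH sw_smult[OF G sb] sw_one[OF G scale_left_bilinear[OF sb]] by simp
  also have "\<dots> = b ?e \<one>" using eA A'(8) by (simp add: p(2) antipode_one)
  finally show ?thesis using \<phi>_eq[OF xH] by simp
qed

text \<open>
  Since \<open>\<phi>(x) = b(x\<^sub>1, S(x\<^sub>2))\<close> depends only on \<open>\<epsilon>(x)\<close>, evaluating \<open>b(x\<^sub>1, S(x\<^sub>2) x\<^sub>3)\<close> in two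
  ways shows that \<open>x \<otimes> 1 = 1 \<otimes> x\<close> in \<open>A \<otimes>\<^sub>K A\<close>: the inclusion of \<open>K\<close> in \<open>A\<close> is an epimorphism of rings.
\<close>

lemma mid_commute:
  assumes G: "comm_group G" and b: "mid G b" and x: "x \<in> A"
  shows "b x \<one> = b \<one> x"
proof -
  interpret G: comm_group G by (rule G)
  note A' = hopf_subalgebraD[OF A]
  have AH: "A \<subseteq> carrier H" using A'(6) by blast
  have xH: "x \<in> carrier H" using x AH by blast
  note Acl = submodule_closed[OF A'(2)]
  note m = midD[OF b]
  obtain p where p: "linear p" "\<And>a. a \<in> A \<Longrightarrow> p a = a" "\<And>h. h \<in> carrier H \<Longrightarrow> p h \<in> A"
    using ex_projection[OF A'(2)] by blast
  let ?b = "\<lambda>u v. b (p u) (p v)"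
  have bb: "bilinear G ?b" by (rule mid_bilinear[OF b p(1,3)])
  have lin_p: "linear (\<lambda>x. p (f x))" if "linear f" for f by (rule linear_comp[OF p(1) that])
  have pc [simp]: "p h \<in> carrier H" if "h \<in> carrier H" for h using p(1) that by simp
  let ?t = "\<lambda>u v w. ?b u (\<S> (p v) \<otimes> w)"
  have lin1: "linear (\<lambda>v. \<S> (p v) \<otimes> w)" if "w \<in> carrier H" for w
    using that by (intro linear_intros lin_p)
  have Sb: "bilinear_op (\<lambda>v w. \<S> (p v) \<otimes> w)" by (intro linear_intros lin_p) auto
  have t2: "bilinear G (?t u)" if "u \<in> carrier H" for u
    by (rule HH.lift_hom_comp(2)[OF H.a_comm_group G bilinear_op_bilinear[OF Sb] bilinear_partial_hom(2)[OF bb that] comult_closed[OF xH]])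
  have t1: "bilinear G (\<lambda>u v. ?t u v w)" if "w \<in> carrier H" for w
    by (rule bilinear_comp[OF bb linear_id lin1[OF that]])
  have tri: "trilinear G ?t" using t1 t2 by (simp add: trilinear_def)
  \<comment> \<open>Bracketed to the right, \<open>S(x\<^sub>2) x\<^sub>3\<close> collapses by the
    antipode axiom.\<close>
  have right: "sw G (\<lambda>a c. sw G (?t a) c) x = ?b x \<one>"
  proof -
    have bil: "bilinear G (\<lambda>a c. ?b (\<epsilon> c \<odot> a) \<one>)"
      by (rule HH.lift_hom_comp(2)[OF H.a_comm_group G bilinear_op_bilinear[OF bilinear_op_lhit[OF counit_dual]]
            bilinear_partial_hom(1)[OF bb H.one_closed] comult_closed[OF xH]])
    have "sw G (\<lambda>a c. sw G (?t a) c) x = sw G (\<lambda>a c. ?b (\<epsilon> c \<odot> a) \<one>) x"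
    proof (rule sw_cong_on[OF G bilinear_sw_right[OF G tri] bil AH AH xH A'(10)[OF x]])
      fix a c assume ac: "a \<in> A" "c \<in> A"
      then have acH: "a \<in> carrier H" "c \<in> carrier H" using AH by auto
      have "sw G (?t a) c = ?b a (swH (\<lambda>v w. \<S> (p v) \<otimes> w) c)"
        by (rule sw_comp[OF H.a_comm_group G bilinear_op_bilinear[OF Sb] bilinear_partial_hom(2)[OF bb acH(1)] acH(2), symmetric])
      also have "swH (\<lambda>v w. \<S> (p v) \<otimes> w) c = swH (\<lambda>v w. \<S> v \<otimes> w) c"
        using p(2) by (intro swH_cong_on[OF Sb _ AH AH acH(2) A'(10)[OF ac(2)]] linear_intros) auto
      also have "\<dots> = \<epsilon> c \<odot> \<one>" by (rule swH_antipode_left[OF acH(2)])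
      also have "?b a (\<epsilon> c \<odot> \<one>) = ?b (\<epsilon> c \<odot> a) \<one>"
        using acH bilinearD(4)[OF bb acH(1) H.one_closed] by simp
      finally show "sw G (?t a) c = ?b (\<epsilon> c \<odot> a) \<one>" .
    qed
    also have "\<dots> = ?b (swH (\<lambda>a c. \<epsilon> c \<odot> a) x) \<one>"
      by (rule sw_comp[OF H.a_comm_group G bilinear_op_bilinear[OF bilinear_op_lhit[OF counit_dual]]
            bilinear_partial_hom(1)[OF bb H.one_closed] xH, symmetric])
    also have "\<dots> = ?b x \<one>" using swH_counit_right[OF linear_id xH] by simp
    finally show ?thesis .
  qed
  \<comment> \<open>Bracketed to the left, \<open>mid_counit\<close> collapses
    \<open>x\<^sub>1\<close> and \<open>x\<^sub>2\<close>, with \<open>x\<^sub>3\<close> held fixed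
    as a right factor in the second argument.\<close>
  have left: "sw G (\<lambda>a c. sw G (\<lambda>u v. ?t u v c) a) x = ?b \<one> x"
  proof -
    have bil: "bilinear G (\<lambda>a c. ?b \<one> (\<epsilon> a \<odot> c))"
      by (rule HH.lift_hom_comp(2)[OF H.a_comm_group G bilinear_op_bilinear[OF bilinear_op_rhit[OF counit_dual]]
            bilinear_partial_hom(2)[OF bb H.one_closed] comult_closed[OF xH]])
    have "sw G (\<lambda>a c. sw G (\<lambda>u v. ?t u v c) a) x = sw G (\<lambda>a c. ?b \<one> (\<epsilon> a \<odot> c)) x"
    proof (rule sw_cong_on[OF G bilinear_sw_left[OF G tri] bil AH AH xH A'(10)[OF x]])
      fix a c assume ac: "a \<in> A" "c \<in> A"
      then have acH: "a \<in> carrier H" "c \<in> carrier H" using AH by auto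
      \<comment> \<open>Right multiplication in the second argument commutes with the left action of
        \<open>K\<close>, so it keeps the map balanced.\<close>
      have bc: "mid G (\<lambda>u v. b u (v \<otimes> c))"
        using m ac A'(7) AH KA hopf_subalgebraD(6)[OF K] unfolding balanced_def right_regular_def left_regular_def
        by (auto simp: H.l_distr H.m_assoc subset_iff)
      have "sw G (\<lambda>u v. ?t u v c) a = sw G (\<lambda>u v. b (p u) (\<S> (p v) \<otimes> c)) a"
        using p A'(7,9) ac by (intro sw_cong[OF G t1[OF acH(2)] acH(1)]) simp
      also have "\<dots> = b (\<epsilon> a \<odot> \<one>) (\<one> \<otimes> c)" by (rule mid_counit[OF G bc ac(1) p])
      also have "\<dots> = ?b (\<epsilon> a \<odot> \<one>) c"
        using ac acH Acl(6) A'(8) by (simp add: p(2))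
      also have "\<dots> = ?b \<one> (\<epsilon> a \<odot> c)"
        using acH bilinearD(4)[OF bb H.one_closed acH(2)] by simp
      finally show "sw G (\<lambda>u v. ?t u v c) a = ?b \<one> (\<epsilon> a \<odot> c)" .
    qed
    also have "\<dots> = ?b \<one> (swH (\<lambda>a c. \<epsilon> a \<odot> c) x)"
      by (rule sw_comp[OF H.a_comm_group G bilinear_op_bilinear[OF bilinear_op_rhit[OF counit_dual]]
            bilinear_partial_hom(2)[OF bb H.one_closed] xH, symmetric])
    also have "\<dots> = ?b \<one> x" using swH_counit_left[OF linear_id xH] by simp
    finally show ?thesis .
  qed
  have "?b x \<one> = ?b \<one> x" using sw_coassoc[OF G tri xH] left right by simp
  then show ?thesis using p(2) x A'(8) by simp
qed

end

subsection \<open>The opposite co-opposite Hopf algebra\<close>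

definition flip :: "('h \<times> 'h \<Rightarrow>\<^sub>0 int) set \<Rightarrow> ('h \<times> 'h \<Rightarrow>\<^sub>0 int) set"
  where "flip = tensor_lift (HH) (\<lambda>a b. pure b a)"

text \<open>Reversing multiplication and comultiplication together keeps the same antipode;
  reversing only one of them would call for its inverse.\<close>

definition opcop :: "('k, 'h, 'y) hopf_algebra_scheme"
  where "opcop = H\<lparr>monoid.mult := (\<lambda>x y. y \<otimes> x), comult := (\<lambda>x. flip (comult H x))\<rparr>"

lemma bilinear_flip: "bilinear G b \<Longrightarrow> bilinear G (\<lambda>x y. b y x)"
  by (auto simp: balanced_def)

lemma flip_hom: "flip \<in> hom (HH) (HH)"
  unfolding flip_def by (rule HH.lift_hom[OF HH.tensor_comm_group bilinear_flip[OF pure_bilinear]])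

lemma flip_closed [simp]: "t \<in> carrier (HH) \<Longrightarrow> flip t \<in> carrier (HH)"
  using flip_hom by (auto simp: hom_def)

lemma flip_pure: "x \<in> carrier H \<Longrightarrow> y \<in> carrier H \<Longrightarrow> flip (pure x y) = pure y x"
  unfolding flip_def by (rule HH.lift_pure[OF HH.tensor_comm_group bilinear_flip[OF pure_bilinear]])

lemma lift_flip:
  assumes G: "comm_group G" and b: "bilinear G b" and t: "t \<in> carrier (HH)"
  shows "tensor_lift G b (flip t) = tensor_lift G (\<lambda>x y. b y x) t"
  using HH.lift_unique[OF G bilinear_flip[OF b] hom_compose[OF flip_hom HH.lift_hom[OF G b]] _ t]
  by (simp add: flip_pure HH.lift_pure[OF G b])

lemma flip_flip: "t \<in> carrier (HH) \<Longrightarrow> flip (flip t) = t"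
  using HH.tensor_hom_eq[OF comm_group.axioms(2)[OF HH.tensor_comm_group] hom_compose[OF flip_hom flip_hom], of "\<lambda>t. t" t]
  by (auto simp: hom_def flip_pure)

lemma opcop_simps [simp]:
  "carrier opcop = carrier H" "\<one>\<^bsub>opcop\<^esub> = \<one>" "\<zero>\<^bsub>opcop\<^esub> = \<zero>"
  "ring.add opcop = ring.add H" "smult opcop = smult H" "x \<otimes>\<^bsub>opcop\<^esub> y = y \<otimes> x"
  "counit opcop = counit H" "antipode opcop = antipode H" "comult opcop x = flip (comult H x)"
  "add_monoid opcop = add_monoid H" "a_inv opcop = a_inv H"
  by (simp_all add: opcop_def a_inv_def[abs_def])

lemma tensor_opcop [simp]: "tensor k opcop opcop = HH"
  "pure_tensor k opcop opcop = pure"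
  by (simp_all add: tensor_def pure_tensor_def[abs_def] tensor_null_def tensor_relations_def)

text \<open>The product on the inner tensor square changes, but tensor products see only its
  additive group and scalars.\<close>

lemma tensor_algebra_opcop [simp]:
  "tensor k opcop (tensor_algebra k opcop opcop) = tensor k H (HH_algebra)"
  "pure_tensor k opcop (tensor_algebra k opcop opcop) = pure_tensor k H (HH_algebra)"
  by (simp_all add: tensor_def pure_tensor_def[abs_def] tensor_null_def tensor_relations_def tensor_algebra_def)

lemma opcop_ring: "ring opcop"
proof (rule ringI)
  show "abelian_group opcop"
    using H.is_abelian_group by (simp add: abelian_group_def abelian_monoid_def abelian_group_axioms_def)
  show "monoid opcop" by (rule monoidI) (auto simp: H.m_assoc)
qed (auto simp: H.r_distr H.l_distr)

lemma opcop_comult_hom: "comult opcop \<in> ring_hom opcop (tensor_algebra k opcop opcop)"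
proof -
  let ?T = "HH" let ?p = "pure"
  note T = HH.tensor_comm_group
  have mult: "flip (comult H (y \<otimes> x)) = flip (comult H x) \<otimes>\<^bsub>tensor_algebra k opcop opcop\<^esub> flip (comult H y)"
    if x: "x \<in> carrier H" and y: "y \<in> carrier H" for x y
  proof -
    note fp = bilinear_flip[OF pure_bilinear]
    have fy: "flip (comult H y) \<in> carrier ?T" using y by simp
    have out: "bilinear ?T (\<lambda>a b. tensor_lift ?T (\<lambda>c d. ?p (c \<otimes> a) (d \<otimes> b)) (flip (comult H y)))"
      by (rule mult_bilinear_outer'[OF T pure_bilinear fy])
    have "flip (comult H x) \<otimes>\<^bsub>tensor_algebra k opcop opcop\<^esub> flip (comult H y) =
       tensor_lift ?T (\<lambda>a b. tensor_lift ?T (\<lambda>c d. ?p (c \<otimes> a) (d \<otimes> b)) (flip (comult H y))) (flip (comult H x))"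
      by (simp add: tensor_algebra_def)
    also have "\<dots> = sw ?T (\<lambda>b a. tensor_lift ?T (\<lambda>c d. ?p (c \<otimes> a) (d \<otimes> b)) (flip (comult H y))) x"
      unfolding sw_def by (rule lift_flip[OF T out]) (use x in simp)
    also have "\<dots> = sw ?T (\<lambda>b a. sw ?T (\<lambda>d c. ?p (c \<otimes> a) (d \<otimes> b)) y) x"
    proof (rule sw_cong[OF T bilinear_flip[OF out] x])
      fix b a assume "b \<in> carrier H" "a \<in> carrier H"
      then show "tensor_lift ?T (\<lambda>c d. ?p (c \<otimes> a) (d \<otimes> b)) (flip (comult H y)) =
        sw ?T (\<lambda>d c. ?p (c \<otimes> a) (d \<otimes> b)) y"
        unfolding sw_def by (intro lift_flip[OF T mult_bilinear_inner(2)[OF pure_bilinear]] comult_closed y)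
    qed
    also have "\<dots> = sw ?T (\<lambda>u v. ?p v u) (y \<otimes> x)"
      unfolding sw_def comult_mult[OF y x]
      by (rule lift_mult_algebra'[OF T fp comult_closed[OF y] comult_closed[OF x], symmetric])
    finally show ?thesis by (simp add: flip_def sw_def)
  qed
  show ?thesis
  proof (rule ring_hom_memI)
    show "comult opcop x \<in> carrier (tensor_algebra k opcop opcop)" if "x \<in> carrier opcop" for x
      using that by (simp add: tensor_algebra_def)
    fix x y assume "x \<in> carrier opcop" "y \<in> carrier opcop"
    then have xy: "x \<in> carrier H" "y \<in> carrier H" by simp_all
    show "comult opcop (x \<otimes>\<^bsub>opcop\<^esub> y) = comult opcop x \<otimes>\<^bsub>tensor_algebra k opcop opcop\<^esub> comult opcop y"
      using mult[OF xy] by simp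
    show "comult opcop (x \<oplus>\<^bsub>opcop\<^esub> y) = comult opcop x \<oplus>\<^bsub>tensor_algebra k opcop opcop\<^esub> comult opcop y"
      using xy flip_hom by (simp add: comult_add hom_def tensor_algebra_def)
  next
    show "comult opcop \<one>\<^bsub>opcop\<^esub> = \<one>\<^bsub>tensor_algebra k opcop opcop\<^esub>"
      by (simp add: tensor_algebra_def comult_one flip_pure)
  qed
qed

lemma opcop_hopf_algebra: "hopf_algebra k opcop"
proof -
  let ?T = "HH" let ?p = "pure"
  let ?A = "HH_algebra" let ?T3 = "tensor k H ?A" let ?q = "pure_tensor k H ?A"
  note T = HH.tensor_comm_group and T3 = HHH.tensor_comm_group
  have mod: "module k opcop"
    by (rule moduleI)
      (auto simp: smult_l_distr smult_r_distr smult_assoc1 k.is_cring intro: ring.is_abelian_group opcop_ring)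
  show ?thesis
  proof (rule hopf_algebra.intro[OF k.field_axioms opcop_ring mod], unfold_locales, goal_cases)
    case (1 c x y) then show ?case by (simp add: smult_mult_right)
  next
    case (2 c x y) then show ?case by (simp add: smult_mult_left)
  next
    case 3 show ?case by (rule opcop_comult_hom)
  next
    case (4 c x)
    then have c: "c \<in> carrier k" and x: "x \<in> carrier H" by simp_all
    have "c \<odot>\<^bsub>tensor_algebra k opcop opcop\<^esub> flip (comult H x) = tensor_lift ?T (\<lambda>a b. ?p (c \<odot> a) b) (flip (comult H x))"
      by (simp add: tensor_algebra_def)
    also have "\<dots> = sw ?T (\<lambda>b a. ?p (c \<odot> a) b) x"
      unfolding sw_def by (rule lift_flip[OF T scale_left_bilinear[OF pure_bilinear c] comult_closed[OF x]])
    also have "\<dots> = sw ?T (\<lambda>b a. ?p a (c \<odot> b)) x"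
      using c bilinearD(4)[OF pure_bilinear]
      by (intro sw_cong[OF T bilinear_flip[OF scale_left_bilinear[OF pure_bilinear c]] x]) simp
    also have "\<dots> = flip (comult H (c \<odot> x))"
      using sw_smult[OF T bilinear_flip[OF pure_bilinear] x c] by (simp add: flip_def sw_def)
    finally show ?case by simp
  next
    case 5 show ?case using counit_hom by (auto simp: ring_hom_def k.m_comm)
  next
    case (6 c x) then show ?case by (simp add: counit_smult)
  next
    case 7 show ?case using antipode_hom by (simp add: module_hom_def)
  next
    case (8 x)
    then have x: "x \<in> carrier H" by simp
    \<comment> \<open>The universal trilinear map with its three legs reversed, so that the
      coassociativity of \<open>H\<close> is read backwards.\<close>
    let ?t = "\<lambda>a b c. ?q c (?p b a)"
    have tri: "trilinear ?T3 ?t"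
      using HHH.pure_balanced pure_bilinear
      by (auto simp: trilinear_def balanced_def add_tensor_algebra tensor_algebra_smult_pure)
    note t1 = trilinearD(1)[OF tri] and t2 = trilinearD(2)[OF tri]
    have qhom: "?q v \<in> hom ?T ?T3" if "v \<in> carrier H" for v
      using HHH.pure_balanced that by (auto simp: balanced_def hom_def add_tensor_algebra)
    have in1: "tensor_lift ?T3 (\<lambda>c d. ?q c (?p d b)) (flip (comult H a)) = sw ?T3 (\<lambda>d c. ?q c (?p d b)) a"
      if "a \<in> carrier H" "b \<in> carrier H" for a b
      unfolding sw_def using that
      by (intro lift_flip[OF T3 bilinear_flip[OF t1]] comult_closed)
    have in2: "?q b (flip (comult H a)) = sw ?T3 (\<lambda>c d. ?q b (?p d c)) a" if "a \<in> carrier H" "b \<in> carrier H" for a b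
      unfolding flip_def using sw_comp[OF T T3 bilinear_flip[OF pure_bilinear] qhom[OF that(2)] that(1)] by (simp add: sw_def)
    have out1: "bilinear ?T3 (\<lambda>a b. tensor_lift ?T3 (\<lambda>c d. ?q c (?p d a)) (flip (comult H b)))"
      using bilinear_sw_right[OF T3 tri] in1 by (auto simp: balanced_def)
    have out2: "bilinear ?T3 (\<lambda>a b. ?q b (flip (comult H a)))"
      using bilinear_sw_left[OF T3 tri] in2 by (auto simp: balanced_def)
    have "tensor_lift ?T3 (\<lambda>a b. tensor_lift ?T3 (\<lambda>c d. ?q c (?p d b)) (flip (comult H a))) (flip (comult H x)) =
      sw ?T3 (\<lambda>b a. tensor_lift ?T3 (\<lambda>c d. ?q c (?p d b)) (flip (comult H a))) x"
      unfolding sw_def by (rule lift_flip[OF T3 bilinear_flip[OF out1] comult_closed[OF x]])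
    also have "\<dots> = sw ?T3 (\<lambda>a b. sw ?T3 (?t a) b) x"
      by (rule sw_cong[OF T3 out1 x]) (simp add: in1)
    also have "\<dots> = sw ?T3 (\<lambda>a b. sw ?T3 (\<lambda>c d. ?t c d b) a) x"
      by (rule sw_coassoc[OF T3 tri x, symmetric])
    also have "\<dots> = sw ?T3 (\<lambda>a b. ?q b (flip (comult H a))) x"
      by (rule sw_cong[OF T3 bilinear_sw_left[OF T3 tri] x]) (simp add: in2)
    also have "\<dots> = tensor_lift ?T3 (\<lambda>b a. ?q b (flip (comult H a))) (flip (comult H x))"
      unfolding sw_def by (rule lift_flip[OF T3 bilinear_flip[OF out2] comult_closed[OF x], symmetric])
    finally show ?case by (simp add: tensor_map_def)
  next
    case (9 x)
    then have x: "x \<in> carrier H" by simp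
    show ?case using lift_flip[OF H.a_comm_group bilinear_op_bilinear[OF bilinear_op_rhit[OF counit_dual]] comult_closed[OF x]] counit_right[OF x]
      by simp
  next
    case (10 x)
    then have x: "x \<in> carrier H" by simp
    show ?case using lift_flip[OF H.a_comm_group bilinear_op_bilinear[OF bilinear_op_lhit[OF counit_dual]] comult_closed[OF x]] counit_left[OF x]
      by simp
  next
    \<comment> \<open>The two reversals together exchange the left and the right antipode
      axiom.\<close>
    case (11 x)
    then have x: "x \<in> carrier H" by simp
    have "bilinear_op (\<lambda>a b. b \<otimes> \<S> a)" by (intro linear_intros) auto
    from lift_flip[OF H.a_comm_group bilinear_op_bilinear[OF this] comult_closed[OF x]] show ?case
      using antipode_right[OF x] by simp
  next
    case (12 x)
    then have x: "x \<in> carrier H" by simp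
    have "bilinear_op (\<lambda>a b. \<S> b \<otimes> a)" by (intro linear_intros) auto
    from lift_flip[OF H.a_comm_group bilinear_op_bilinear[OF this] comult_closed[OF x]] show ?case
      using antipode_left[OF x] by simp
  qed
qed

lemma opcop_hopf: "hopf opcop k"
  by (rule hopf.intro[OF opcop_hopf_algebra])

section \<open>Transfer of notions to the opposite co-opposite algebra\<close>

lemma flip_tensor_span:
  assumes "C \<subseteq> carrier H" "t \<in> tensor_span k H C C" shows "flip t \<in> tensor_span k H C C"
  unfolding flip_def using assms
  by (intro HH.lift_mem[OF HH.tensor_comm_group bilinear_flip[OF pure_bilinear] tensor_span_subgroup _ assms(1,1)])
    (auto simp: tensor_span_def intro!: pure_in_tensor_span[unfolded tensor_span_def])

lemma opcop_submodule [simp]: "submodule C k opcop \<longleftrightarrow> submodule C k H"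
  by (simp add: submodule_def submodule_axioms_def)

lemma opcop_subcoalgebra [simp]: "subcoalgebra k opcop C \<longleftrightarrow> subcoalgebra k H C"
proof -
  have span: "tensor_span k opcop C C = tensor_span k H C C" by (simp add: tensor_span_def)
  have "flip (comult H x) \<in> tensor_span k H C C \<longleftrightarrow> comult H x \<in> tensor_span k H C C"
    if C: "submodule C k H" and x: "x \<in> C" for x
  proof -
    have CH: "C \<subseteq> carrier H" using submodule_closed(2)[OF C] by blast
    then have "comult H x \<in> carrier (HH)" using x by auto
    then show ?thesis using flip_tensor_span[OF CH] flip_flip by metis
  qed
  then show ?thesis by (auto simp: subcoalgebra_def span)
qed

lemma opcop_unital_subalgebra [simp]: "unital_subalgebra k opcop B \<longleftrightarrow> unital_subalgebra k H B"
proof -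
  interpret op: hopf opcop k by (rule opcop_hopf)
  show ?thesis
  proof
    assume B: "unital_subalgebra k opcop B"
    note B' = op.unital_subalgebraD[OF B] note cl = op.submodule_closed[OF B'(1)]
    show "unital_subalgebra k H B"
      using cl(2,3,6) B'(2,3) by (intro unital_subalgebraI) auto
  next
    assume B: "unital_subalgebra k H B"
    note B' = unital_subalgebraD[OF B] note cl = submodule_closed[OF B'(1)]
    show "unital_subalgebra k opcop B"
      using cl(2,3,6) B'(2,3) by (intro op.unital_subalgebraI) auto
  qed
qed

lemma opcop_coradical [simp]: "coradical k opcop = coradical k H"
  by (simp add: coradical_def simple_subcoalgebra_def)

lemma opcop_generated_subalgebra [simp]: "generated_subalgebra k opcop S = generated_subalgebra k H S"
  by (simp add: generated_subalgebra_def)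

lemma opcop_affine_subalgebra [simp]: "affine_subalgebra k opcop B \<longleftrightarrow> affine_subalgebra k H B"
  by (simp add: affine_subalgebra_def)

lemma opcop_hopf_subalgebra [simp]: "hopf_subalgebra k opcop B \<longleftrightarrow> hopf_subalgebra k H B"
  by (simp add: hopf_subalgebra_def)

lemma opcop_locally_affine [simp]: "locally_affine k opcop B \<longleftrightarrow> locally_affine k H B"
  by (simp add: locally_affine_def)

lemma opcop_noetherian: "left_noetherian opcop \<longleftrightarrow> right_noetherian H"
proof -
  have "left_ideal I opcop \<longleftrightarrow> right_ideal I H" for I
    by (simp add: left_ideal_def right_ideal_def additive_subgroup_def)
  then show ?thesis by (simp add: left_noetherian_def right_noetherian_def)
qed

lemma noetherian_affine:
  assumes noeth: "left_noetherian H \<or> right_noetherian H" and A: "hopf_subalgebra k H A" "coradical k H \<subseteq> A"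
    "affine_subalgebra k H A"
  shows "affine_subalgebra k H (carrier H)"
proof -
  interpret op: hopf opcop k by (rule opcop_hopf)
  show ?thesis
    using noeth left_noetherian_affine[OF _ A] op.left_noetherian_affine[of A] A opcop_noetherian by auto
qed

text \<open>The disjunction records the side of the Noetherian condition. Everything after
  \<open>hopf_subalgebra_epi\<close> is indifferent to it.\<close>

definition generated_by_augmentation :: "'h set \<Rightarrow> 'h set \<Rightarrow> bool"
  where "generated_by_augmentation A K \<longleftrightarrow>
    augmentation A \<subseteq> mult_span A (augmentation K) \<or> augmentation A \<subseteq> mult_span (augmentation K) A"

lemma opcop_augmentation: "hopf.augmentation opcop k A = augmentation A"
  by (simp add: augmentation_def hopf.augmentation_def[OF opcop_hopf])

lemma opcop_mult_span: "hopf.mult_span opcop k M I = mult_span I M"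
proof -
  interpret op: hopf opcop k by (rule opcop_hopf)
  have "{y \<otimes> x | x y. x \<in> M \<and> y \<in> I} = {x \<otimes> y | x y. x \<in> I \<and> y \<in> M}" by blast
  then show ?thesis by (simp add: op.mult_span_def mult_span_def op.lspan_def lspan_def)
qed

lemma noetherian_affine_hopf_subalgebra:
  assumes noeth: "left_noetherian H \<or> right_noetherian H" and A: "hopf_subalgebra k H A" "coradical k H \<subseteq> A"
    and loc: "locally_affine k H A"
  obtains K where "hopf_subalgebra k H K" "affine_subalgebra k H K" "K \<subseteq> A" "generated_by_augmentation A K"
proof -
  interpret op: hopf opcop k by (rule opcop_hopf)
  from noeth show ?thesis
  proof
    assume "left_noetherian H"
    then show ?thesis
    proof (rule left_noetherian_affine_hopf_subalgebra[OF _ A loc])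
      fix K assume K: "hopf_subalgebra k H K" "affine_subalgebra k H K" "K \<subseteq> A" "augmentation A \<subseteq> mult_span A (augmentation K)"
      then show ?thesis by (intro that[OF K(1-3)]) (simp add: generated_by_augmentation_def)
    qed
  next
    assume "right_noetherian H"
    then have "left_noetherian opcop" by (simp add: opcop_noetherian)
    then show ?thesis
    proof (rule op.left_noetherian_affine_hopf_subalgebra[of A])
      fix K assume K: "hopf_subalgebra k opcop K" "affine_subalgebra k opcop K" "K \<subseteq> A"
        "op.augmentation A \<subseteq> op.mult_span A (op.augmentation K)"
      then have "hopf_subalgebra k H K" "affine_subalgebra k H K" by simp_all
      then show ?thesis using K(4)
        by (intro that[OF _ _ K(3)]) (simp_all add: generated_by_augmentation_def opcop_augmentation opcop_mult_span)
    qed (use A loc in simp_all)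
  qed
qed

text \<open>Exchanging the arguments of \<open>b\<close> makes it balanced over the opposite algebra
  and leaves the shape of the claim unchanged, so one side of the disjunction settles the
  other.\<close>

lemma hopf_subalgebra_epi:
  assumes A: "hopf_subalgebra k H A" and K: "hopf_subalgebra k H K" and KA: "K \<subseteq> A"
    and aug: "generated_by_augmentation A K"
    and G: "comm_group G" and b: "balanced (H\<lparr>carrier := K\<rparr>) (right_regular H A) (left_regular H A) G b"
    and x: "x \<in> A"
  shows "b x \<one> = b \<one> x"
  using aug unfolding generated_by_augmentation_def
proof
  assume "augmentation A \<subseteq> mult_span A (augmentation K)"
  then show ?thesis using mid_commute[OF A K KA _ G b x] by simp
next
  interpret op: hopf opcop k by (rule opcop_hopf)
  assume "augmentation A \<subseteq> mult_span (augmentation K) A"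
  then have *: "op.augmentation A \<subseteq> op.mult_span A (op.augmentation K)"
    by (simp add: opcop_augmentation opcop_mult_span)
  have "balanced (opcop\<lparr>carrier := K\<rparr>) (right_regular opcop A) (left_regular opcop A) G (\<lambda>x y. b y x)"
    using b by (auto simp: balanced_def right_regular_def left_regular_def)
  then show ?thesis using op.mid_commute[of A K G "\<lambda>x y. b y x" x] A K KA G x * by simp
qed

subsection \<open>Faithful flatness\<close>

text \<open>
  The \<open>K\<close>-module \<open>A / K\<close>, carried by singletons: \<open>Q\<close> is a linear map with kernel \<open>K\<close>, and \<open>Q a\<close>
  represents the coset of \<open>a\<close>.
\<close>

definition quotient_module :: "('h \<Rightarrow> 'h) \<Rightarrow> ('h \<Rightarrow> 'h \<Rightarrow> 'h) \<Rightarrow> 'h set \<Rightarrow> ('h, 'h set) module"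
  where "quotient_module Q act A =
    \<lparr> carrier = (\<lambda>a. {Q a}) ` A, monoid.mult = (\<lambda>Y Z. Y), monoid.one = {},
      ring.zero = {\<zero>}, ring.add = (\<lambda>Y Z. {the_elem Y \<oplus> the_elem Z}),
      smult = (\<lambda>r Y. {Q (act r (the_elem Y))}) \<rparr>"

context
  fixes A K Q
  assumes A: "hopf_subalgebra k H A" and K: "hopf_subalgebra k H K" and KA: "K \<subseteq> A"
    and Q: "linear Q" "\<And>w. w \<in> K \<Longrightarrow> Q w = \<zero>" "\<And>v. v \<in> carrier H \<Longrightarrow> v \<ominus> Q v \<in> K"
begin

lemma K_ring: "ring (H\<lparr>carrier := K\<rparr>)"
  using H.subring_is_ring hopf_subalgebraD(1)[OF K] by blast

lemma A_carrier: "a \<in> A \<Longrightarrow> a \<in> carrier H" and K_carrier: "a \<in> K \<Longrightarrow> a \<in> carrier H"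
  using hopf_subalgebraD(6)[OF A] hopf_subalgebraD(6)[OF K] by auto

lemma Q_closed: "a \<in> A \<Longrightarrow> Q a \<in> carrier H"
  using A_carrier Q(1) by simp

lemma Q_cong:
  assumes "x \<ominus> y \<in> K" "x \<in> carrier H" "y \<in> carrier H" shows "Q x = Q y"
  using Q(2)[OF assms(1)] assms Q(1) by (simp add: linear_minus H.diff_eq_zero_iff)

lemma Q_in_A: assumes "a \<in> A" shows "Q a \<in> A"
proof -
  have "a \<ominus> (a \<ominus> Q a) \<in> A"
    using assms Q(3)[OF A_carrier] KA submodule_closed(4)[OF hopf_subalgebraD(2)[OF A]] by blast
  moreover have "a \<ominus> (a \<ominus> Q a) = Q a"
    using assms A_carrier Q_closed H.diff_diff_same[of a "\<zero>"] H.diff_diff_same[of a "a \<ominus> Q a" "\<zero>"]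
    by (simp add: a_minus_def H.minus_add H.r_neg1 H.r_neg2)
  ultimately show ?thesis by simp
qed

lemma quotient_abelian_group: "abelian_group (quotient_module Q act A)"
proof (rule abelian_groupI)
  note cl = submodule_closed[OF hopf_subalgebraD(2)[OF A]]
  note [simp] = A_carrier Q_closed and add = linear_add[OF Q(1), symmetric]
  fix x assume "x \<in> carrier (quotient_module Q act A)"
  then obtain a where a: "a \<in> A" "x = {Q a}" by (auto simp: quotient_module_def)
  show "\<zero>\<^bsub>quotient_module Q act A\<^esub> \<oplus>\<^bsub>quotient_module Q act A\<^esub> x = x"
    using a by (simp add: quotient_module_def)
  show "\<exists>y \<in> carrier (quotient_module Q act A). y \<oplus>\<^bsub>quotient_module Q act A\<^esub> x = \<zero>\<^bsub>quotient_module Q act A\<^esub>"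
    using a cl(5)[OF a(1)] linear_zero[OF Q(1)]
    by (intro bexI[of _ "{Q (\<ominus> a)}"]) (auto simp: quotient_module_def add H.l_neg)
  fix y assume "y \<in> carrier (quotient_module Q act A)"
  then obtain b where b: "b \<in> A" "y = {Q b}" by (auto simp: quotient_module_def)
  show "x \<oplus>\<^bsub>quotient_module Q act A\<^esub> y \<in> carrier (quotient_module Q act A)"
    "x \<oplus>\<^bsub>quotient_module Q act A\<^esub> y = y \<oplus>\<^bsub>quotient_module Q act A\<^esub> x"
    using a b cl(3) by (auto simp: quotient_module_def add H.a_comm)
  fix z assume "z \<in> carrier (quotient_module Q act A)"
  then obtain c where c: "c \<in> A" "z = {Q c}" by (auto simp: quotient_module_def)
  show "x \<oplus>\<^bsub>quotient_module Q act A\<^esub> y \<oplus>\<^bsub>quotient_module Q act A\<^esub> z =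
    x \<oplus>\<^bsub>quotient_module Q act A\<^esub> (y \<oplus>\<^bsub>quotient_module Q act A\<^esub> z)"
    using a b c by (simp add: quotient_module_def H.a_assoc)
next
  show "\<zero>\<^bsub>quotient_module Q act A\<^esub> \<in> carrier (quotient_module Q act A)"
    using submodule_closed(1)[OF hopf_subalgebraD(2)[OF A]] linear_zero[OF Q(1)] by (force simp: quotient_module_def)
qed

text \<open>\<open>a\<close> and \<open>Q a\<close> differ by an element of \<open>K\<close>, and
  \<open>K\<close> is closed under multiplication by \<open>r\<close>: the two actions of
  \<open>K\<close> descend to cosets.\<close>

lemma Q_mult:
  assumes "r \<in> K" "a \<in> carrier H"
  shows "Q (r \<otimes> Q a) = Q (r \<otimes> a)" "Q (Q a \<otimes> r) = Q (a \<otimes> r)"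
proof -
  note [simp] = K_carrier[OF assms(1)] assms(2) linear_closed[OF Q(1)]
  have "r \<otimes> (a \<ominus> Q a) \<in> K" "(a \<ominus> Q a) \<otimes> r \<in> K"
    using assms Q(3) hopf_subalgebraD(7)[OF K] by auto
  then have "r \<otimes> a \<ominus> r \<otimes> Q a \<in> K" "a \<otimes> r \<ominus> Q a \<otimes> r \<in> K"
    by (simp_all add: a_minus_def H.r_distr H.l_distr H.r_minus H.l_minus)
  then show "Q (r \<otimes> Q a) = Q (r \<otimes> a)" "Q (Q a \<otimes> r) = Q (a \<otimes> r)"
    by (auto intro: Q_cong[symmetric])
qed

lemma Q_Q: "a \<in> carrier H \<Longrightarrow> Q (Q a) = Q a"
  using Q_mult(1)[OF hopf_subalgebraD(8)[OF K], of a] Q(1) by simp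

lemma quotient_left_module: "left_module (H\<lparr>carrier := K\<rparr>) (quotient_module Q (\<lambda>r x. r \<otimes> x) A)"
proof (intro left_module.intro left_module_axioms.intro K_ring quotient_abelian_group)
  note A' = hopf_subalgebraD[OF A]
  note [simp] = A_carrier Q_closed K_carrier Q_in_A linear_closed[OF Q(1)] and add = linear_add[OF Q(1), symmetric]
  have KA': "r \<in> K \<Longrightarrow> r \<in> A" for r using KA by blast
  let ?N = "quotient_module Q (\<lambda>r x. r \<otimes> x) A"
  fix x assume "x \<in> carrier ?N"
  then obtain a where a: "a \<in> A" "x = {Q a}" by (auto simp: quotient_module_def)
  show "\<one>\<^bsub>H\<lparr>carrier := K\<rparr>\<^esub> \<odot>\<^bsub>?N\<^esub> x = x" using a by (simp add: quotient_module_def Q_Q)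
  fix r assume "r \<in> carrier (H\<lparr>carrier := K\<rparr>)"
  then have r: "r \<in> K" by simp
  have act: "r \<odot>\<^bsub>?N\<^esub> {Q b} = {Q (r \<otimes> b)}" if "r \<in> K" "b \<in> carrier H" for r b
    using that by (simp add: quotient_module_def Q_mult)
  have add': "{Q b} \<oplus>\<^bsub>?N\<^esub> {Q c} = {Q (b \<oplus> c)}" if "b \<in> carrier H" "c \<in> carrier H" for b c
    using that by (simp add: quotient_module_def add)
  show "r \<odot>\<^bsub>?N\<^esub> x \<in> carrier ?N" unfolding a(2) using a r A'(7)[OF KA'[OF r] a(1)] by (simp add: act) (simp add: quotient_module_def)
  show "r \<odot>\<^bsub>?N\<^esub> (x \<oplus>\<^bsub>?N\<^esub> y) = r \<odot>\<^bsub>?N\<^esub> x \<oplus>\<^bsub>?N\<^esub> r \<odot>\<^bsub>?N\<^esub> y" if "y \<in> carrier ?N" for y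
  proof -
    obtain b where b: "b \<in> A" "y = {Q b}" using \<open>y \<in> carrier ?N\<close> by (auto simp: quotient_module_def)
    then show ?thesis using a r by (simp add: act add' H.r_distr)
  qed
  fix s assume "s \<in> carrier (H\<lparr>carrier := K\<rparr>)"
  then have s: "s \<in> K" by simp
  have rs: "r \<oplus> s \<in> K" "r \<otimes> s \<in> K"
    using r s hopf_subalgebraD(7)[OF K] submodule_closed(3)[OF hopf_subalgebraD(2)[OF K]] by auto
  show "(r \<oplus>\<^bsub>H\<lparr>carrier := K\<rparr>\<^esub> s) \<odot>\<^bsub>?N\<^esub> x = r \<odot>\<^bsub>?N\<^esub> x \<oplus>\<^bsub>?N\<^esub> s \<odot>\<^bsub>?N\<^esub> x"
    using a r s rs by (simp add: act add' H.l_distr)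
  show "(r \<otimes>\<^bsub>H\<lparr>carrier := K\<rparr>\<^esub> s) \<odot>\<^bsub>?N\<^esub> x = r \<odot>\<^bsub>?N\<^esub> (s \<odot>\<^bsub>?N\<^esub> x)"
    using a r s rs by (simp add: act H.m_assoc)
qed

lemma quotient_right_module: "right_module (H\<lparr>carrier := K\<rparr>) (quotient_module Q (\<lambda>r x. x \<otimes> r) A)"
proof (intro right_module.intro right_module_axioms.intro K_ring quotient_abelian_group)
  note A' = hopf_subalgebraD[OF A]
  note [simp] = A_carrier Q_closed K_carrier Q_in_A linear_closed[OF Q(1)] and add = linear_add[OF Q(1), symmetric]
  have KA': "r \<in> K \<Longrightarrow> r \<in> A" for r using KA by blast
  let ?N = "quotient_module Q (\<lambda>r x. x \<otimes> r) A"
  fix x assume "x \<in> carrier ?N"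
  then obtain a where a: "a \<in> A" "x = {Q a}" by (auto simp: quotient_module_def)
  show "\<one>\<^bsub>H\<lparr>carrier := K\<rparr>\<^esub> \<odot>\<^bsub>?N\<^esub> x = x" using a by (simp add: quotient_module_def Q_Q)
  fix r assume "r \<in> carrier (H\<lparr>carrier := K\<rparr>)"
  then have r: "r \<in> K" by simp
  have act: "r \<odot>\<^bsub>?N\<^esub> {Q b} = {Q (b \<otimes> r)}" if "r \<in> K" "b \<in> carrier H" for r b
    using that by (simp add: quotient_module_def Q_mult)
  have add': "{Q b} \<oplus>\<^bsub>?N\<^esub> {Q c} = {Q (b \<oplus> c)}" if "b \<in> carrier H" "c \<in> carrier H" for b c
    using that by (simp add: quotient_module_def add)
  show "r \<odot>\<^bsub>?N\<^esub> x \<in> carrier ?N" unfolding a(2) using a r A'(7)[OF a(1) KA'[OF r]] by (simp add: act) (simp add: quotient_module_def)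
  show "r \<odot>\<^bsub>?N\<^esub> (x \<oplus>\<^bsub>?N\<^esub> y) = r \<odot>\<^bsub>?N\<^esub> x \<oplus>\<^bsub>?N\<^esub> r \<odot>\<^bsub>?N\<^esub> y" if "y \<in> carrier ?N" for y
  proof -
    obtain b where b: "b \<in> A" "y = {Q b}" using \<open>y \<in> carrier ?N\<close> by (auto simp: quotient_module_def)
    then show ?thesis using a r by (simp add: act add' H.l_distr)
  qed
  fix s assume "s \<in> carrier (H\<lparr>carrier := K\<rparr>)"
  then have s: "s \<in> K" by simp
  have rs: "r \<oplus> s \<in> K" "r \<otimes> s \<in> K"
    using r s hopf_subalgebraD(7)[OF K] submodule_closed(3)[OF hopf_subalgebraD(2)[OF K]] by auto
  show "(r \<oplus>\<^bsub>H\<lparr>carrier := K\<rparr>\<^esub> s) \<odot>\<^bsub>?N\<^esub> x = r \<odot>\<^bsub>?N\<^esub> x \<oplus>\<^bsub>?N\<^esub> s \<odot>\<^bsub>?N\<^esub> x"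
    using a r s rs by (simp add: act add' H.r_distr)
  show "(r \<otimes>\<^bsub>H\<lparr>carrier := K\<rparr>\<^esub> s) \<odot>\<^bsub>?N\<^esub> x = s \<odot>\<^bsub>?N\<^esub> (r \<odot>\<^bsub>?N\<^esub> x)"
    using a r s rs by (simp add: act H.m_assoc)
qed

end

context
  fixes A K Q
  assumes A: "hopf_subalgebra k H A" and K: "hopf_subalgebra k H K" and KA: "K \<subseteq> A"
    and Q: "linear Q" "\<And>w. w \<in> K \<Longrightarrow> Q w = \<zero>" "\<And>v. v \<in> carrier H \<Longrightarrow> v \<ominus> Q v \<in> K"
begin

lemma regular_abelian_group: "abelian_group (right_regular H A)" "abelian_group (left_regular H A)"
proof -
  note cl = submodule_closed[OF hopf_subalgebraD(2)[OF A]]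
  have "\<exists>y \<in> A. x \<oplus> y = \<zero>" if "x \<in> A" for x
    using cl(2,5)[OF that] H.r_neg by blast
  then show "abelian_group (right_regular H A)" "abelian_group (left_regular H A)"
    using cl(1,2,3) by (auto simp: right_regular_def left_regular_def H.a_ac intro!: abelian_groupI)
qed

lemma quotient_zero_in: "{\<zero>} \<in> carrier (quotient_module Q act A)"
  using abelian_group.axioms(1)[OF quotient_abelian_group[OF A K KA Q], of act]
    abelian_monoid.zero_closed by (fastforce simp: quotient_module_def)

text \<open>Zero maps form an exact sequence only at a zero module. A vanishing \<open>A / K\<close>
  means that \<open>Q\<close> is zero on \<open>A\<close>, so \<open>A\<close> lies in the kernel
  \<open>K\<close> of \<open>Q\<close>.\<close>

lemma quotient_exact_zero:
  assumes "exact_at (add_monoid (quotient_module Q act A)) (\<lambda>_. {\<zero>}) (add_monoid (quotient_module Q act A))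
    (\<lambda>_. {\<zero>}) (add_monoid (quotient_module Q act A))"
  shows "A = K"
proof -
  have "carrier (quotient_module Q act A) = {{\<zero>}}"
    using assms quotient_zero_in[of act] by (auto simp: exact_at_def kernel_def quotient_module_def)
  then have "Q a = \<zero>" if "a \<in> A" for a using that by (auto simp: quotient_module_def)
  then have "a \<in> K" if "a \<in> A" for a
    using that Q(3)[of a] hopf_subalgebraD(6)[OF A that] by simp
  then show ?thesis using KA by blast
qed

lemma quotient_zero_hom:
  assumes "\<And>r. r \<in> K \<Longrightarrow> act r \<zero> = \<zero>"
  shows "(\<lambda>_. {\<zero>}) \<in> module_hom (H\<lparr>carrier := K\<rparr>) (quotient_module Q act A) (quotient_module Q act A)"
  using quotient_zero_in[of act] assms linear_zero[OF Q(1)]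
  by (simp add: module_hom_def hom_def) (simp add: quotient_module_def)

text \<open>The tensor product of \<open>A\<close> with \<open>A / K\<close> vanishes: for fixed
  \<open>x\<close>, the map sending \<open>(u, v)\<close> to the tensor of \<open>x u\<close> with
  the class of \<open>v\<close> is balanced. The epimorphism property replaces \<open>(1, a)\<close>
  by \<open>(a, 1)\<close>, and the class of the unit is zero. Faithfulness then reflects exactness
  of the zero sequence on \<open>A / K\<close>.\<close>

lemma faithfully_flat_right_imp_eq:
  assumes ff: "faithfully_flat_right TYPE('h set) (H\<lparr>carrier := K\<rparr>) (right_regular H A)"
    and aug: "generated_by_augmentation A K"
  shows "A = K"
proof -
  note A' = hopf_subalgebraD[OF A] and K' = hopf_subalgebraD[OF K]
  let ?R = "H\<lparr>carrier := K\<rparr>" let ?M = "right_regular H A"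
  let ?act = "\<lambda>r x. r \<otimes> x"
  let ?N = "quotient_module Q ?act A"
  have N: "left_module ?R ?N" by (rule quotient_left_module[OF A K KA Q])
  interpret tf: tensor_factors ?R ?M ?N
  proof (rule tensor_factors.intro[OF regular_abelian_group(1) quotient_abelian_group[OF A K KA Q]])
    show "r \<odot>\<^bsub>?M\<^esub> x \<in> carrier ?M" if "r \<in> carrier ?R" "x \<in> carrier ?M" for r x
      using that A'(7) KA by (auto simp: right_regular_def)
    show "r \<odot>\<^bsub>?N\<^esub> y \<in> carrier ?N" if "r \<in> carrier ?R" "y \<in> carrier ?N" for r y
      by (rule left_module.act_closed[OF N that])
  qed
  let ?T = "tensor ?R ?M ?N" let ?p = "pure_tensor ?R ?M ?N"
  interpret T: comm_group ?T by (rule tf.tensor_comm_group)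
  have QN: "{Q a} \<in> carrier ?N" if "a \<in> A" for a using that by (simp add: quotient_module_def)
  have add: "{Q (a \<oplus> b)} = {Q a} \<oplus>\<^bsub>?N\<^esub> {Q b}" if "a \<in> A" "b \<in> A" for a b
    using that A'(6) by (simp add: quotient_module_def linear_add[OF Q(1)])
  have act: "{Q (r \<otimes> a)} = r \<odot>\<^bsub>?N\<^esub> {Q a}" if "r \<in> K" "a \<in> A" for r a
    using that A'(6) Q_mult(1)[OF A K KA Q] by (simp add: quotient_module_def)
  note pb = tf.pure_balanced[unfolded balanced_def]
  have triv: "?p x y = \<one>\<^bsub>?T\<^esub>" if "x \<in> carrier ?M" "y \<in> carrier ?N" for x y
  proof -
    obtain a where a: "a \<in> A" "y = {Q a}" using \<open>y \<in> carrier ?N\<close> by (auto simp: quotient_module_def)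
    have x: "x \<in> A" using that(1) by (simp add: right_regular_def)
    have "balanced ?R ?M (left_regular H A) ?T (\<lambda>u v. ?p (x \<otimes> u) {Q v})"
      unfolding balanced_def
    proof (intro conjI ballI)
      fix u v assume uv: "u \<in> carrier ?M" "v \<in> carrier (left_regular H A)"
      then have uv': "u \<in> A" "v \<in> A" by (simp_all add: right_regular_def left_regular_def)
      then have xu: "x \<otimes> u \<in> carrier ?M" using A'(7)[OF x] by (simp add: right_regular_def)
      show "?p (x \<otimes> u) {Q v} \<in> carrier ?T" using xu QN uv' by blast
      show "?p (x \<otimes> (u \<oplus>\<^bsub>?M\<^esub> u')) {Q v} = ?p (x \<otimes> u) {Q v} \<otimes>\<^bsub>?T\<^esub> ?p (x \<otimes> u') {Q v}" if "u' \<in> carrier ?M" for u'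
      proof -
        have u': "u' \<in> A" using that by (simp add: right_regular_def)
        have "x \<otimes> (u \<oplus>\<^bsub>?M\<^esub> u') = x \<otimes> u \<oplus>\<^bsub>?M\<^esub> x \<otimes> u'"
          using x uv' u' A'(6) by (simp add: right_regular_def H.r_distr)
        moreover have "x \<otimes> u' \<in> carrier ?M" using A'(7)[OF x u'] by (simp add: right_regular_def)
        ultimately show ?thesis using pb xu QN[OF uv'(2)] by simp
      qed
      show "?p (x \<otimes> u) {Q (v \<oplus>\<^bsub>left_regular H A\<^esub> v')} = ?p (x \<otimes> u) {Q v} \<otimes>\<^bsub>?T\<^esub> ?p (x \<otimes> u) {Q v'}"
        if "v' \<in> carrier (left_regular H A)" for v'
      proof -
        have v': "v' \<in> A" using that by (simp add: left_regular_def)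
        have "{Q (v \<oplus>\<^bsub>left_regular H A\<^esub> v')} = {Q v} \<oplus>\<^bsub>?N\<^esub> {Q v'}" using add uv' v' by (simp add: left_regular_def)
        then show ?thesis using pb xu QN[OF uv'(2)] QN[OF v'] by simp
      qed
    next
      fix r u v assume r: "r \<in> carrier ?R" and uv: "u \<in> carrier ?M" "v \<in> carrier (left_regular H A)"
      then have uv': "u \<in> A" "v \<in> A" "r \<in> K" "r \<in> A" using KA by (auto simp: right_regular_def left_regular_def)
      have xu: "x \<otimes> u \<in> carrier ?M" using A'(7)[OF x uv'(1)] by (simp add: right_regular_def)
      have "x \<otimes> (r \<odot>\<^bsub>?M\<^esub> u) = r \<odot>\<^bsub>?M\<^esub> (x \<otimes> u)"
        using x uv' A'(6) by (simp add: right_regular_def H.m_assoc)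
      moreover have "{Q (r \<odot>\<^bsub>left_regular H A\<^esub> v)} = r \<odot>\<^bsub>?N\<^esub> {Q v}" using act uv' by (simp add: left_regular_def)
      ultimately show "?p (x \<otimes> (r \<odot>\<^bsub>?M\<^esub> u)) {Q v} = ?p (x \<otimes> u) {Q (r \<odot>\<^bsub>left_regular H A\<^esub> v)}"
        using pb xu QN[OF uv'(2)] r by simp
    qed
    from hopf_subalgebra_epi[OF A K KA aug tf.tensor_comm_group this a(1)]
    have "?p (x \<otimes> \<one>) {Q a} = ?p (x \<otimes> a) {Q \<one>}" by simp
    also have "Q \<one> = \<zero>" using Q(2) K'(8) by blast
    also have "?p (x \<otimes> a) {\<zero>} = \<one>\<^bsub>?T\<^esub>"
    proof -
      have xa: "x \<otimes> a \<in> carrier ?M" using A'(7)[OF x a(1)] by (simp add: right_regular_def)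
      have "{\<zero>} \<oplus>\<^bsub>?N\<^esub> {\<zero>} = {\<zero>}" by (simp add: quotient_module_def)
      then have "?p (x \<otimes> a) {\<zero>} = ?p (x \<otimes> a) {\<zero>} \<otimes>\<^bsub>?T\<^esub> ?p (x \<otimes> a) {\<zero>}"
        using pb xa quotient_zero_in[of ?act] by metis
      then show ?thesis using tf.pure_closed[OF xa quotient_zero_in] by simp
    qed
    finally show ?thesis using a(2) A'(6)[OF x] by simp
  qed
  have "exact_at ?T (tensor_map ?R ?M ?N id (\<lambda>_. {\<zero>})) ?T (tensor_map ?R ?M ?N id (\<lambda>_. {\<zero>})) ?T"
    using quotient_zero_in by (intro tf.trivial_tensor_exact triv) auto
  then have "exact_at (add_monoid ?N) (\<lambda>_. {\<zero>}) (add_monoid ?N) (\<lambda>_. {\<zero>}) (add_monoid ?N)"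
    using ff N quotient_zero_hom[of ?act] K'(6) unfolding faithfully_flat_right_def by simp
  then show ?thesis by (rule quotient_exact_zero)
qed

text \<open>The mirror image: \<open>A / K\<close> is a right module, the fixed element multiplies
  from the right, and \<open>(a, 1)\<close> is replaced by \<open>(1, a)\<close>.\<close>

lemma faithfully_flat_left_imp_eq:
  assumes ff: "faithfully_flat_left TYPE('h set) (H\<lparr>carrier := K\<rparr>) (left_regular H A)"
    and aug: "generated_by_augmentation A K"
  shows "A = K"
proof -
  note A' = hopf_subalgebraD[OF A] and K' = hopf_subalgebraD[OF K]
  let ?R = "H\<lparr>carrier := K\<rparr>" let ?M = "left_regular H A"
  let ?act = "\<lambda>r x. x \<otimes> r"
  let ?N = "quotient_module Q ?act A"
  have N: "right_module ?R ?N" by (rule quotient_right_module[OF A K KA Q])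
  interpret tf: tensor_factors ?R ?N ?M
  proof (rule tensor_factors.intro[OF quotient_abelian_group[OF A K KA Q] regular_abelian_group(2)])
    show "r \<odot>\<^bsub>?M\<^esub> x \<in> carrier ?M" if "r \<in> carrier ?R" "x \<in> carrier ?M" for r x
      using that A'(7) KA by (auto simp: left_regular_def)
    show "r \<odot>\<^bsub>?N\<^esub> y \<in> carrier ?N" if "r \<in> carrier ?R" "y \<in> carrier ?N" for r y
      by (rule right_module.act_closed[OF N that])
  qed
  let ?T = "tensor ?R ?N ?M" let ?p = "pure_tensor ?R ?N ?M"
  interpret T: comm_group ?T by (rule tf.tensor_comm_group)
  have QN: "{Q a} \<in> carrier ?N" if "a \<in> A" for a using that by (simp add: quotient_module_def)
  have add: "{Q (a \<oplus> b)} = {Q a} \<oplus>\<^bsub>?N\<^esub> {Q b}" if "a \<in> A" "b \<in> A" for a b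
    using that A'(6) by (simp add: quotient_module_def linear_add[OF Q(1)])
  have act: "{Q (a \<otimes> r)} = r \<odot>\<^bsub>?N\<^esub> {Q a}" if "r \<in> K" "a \<in> A" for r a
    using that A'(6) Q_mult(2)[OF A K KA Q] by (simp add: quotient_module_def)
  note pb = tf.pure_balanced[unfolded balanced_def]
  have triv: "?p y x = \<one>\<^bsub>?T\<^esub>" if "y \<in> carrier ?N" "x \<in> carrier ?M" for x y
  proof -
    obtain a where a: "a \<in> A" "y = {Q a}" using \<open>y \<in> carrier ?N\<close> by (auto simp: quotient_module_def)
    have x: "x \<in> A" using that(2) by (simp add: left_regular_def)
    have "balanced ?R (right_regular H A) ?M ?T (\<lambda>u v. ?p {Q u} (v \<otimes> x))"
      unfolding balanced_def
    proof (intro conjI ballI)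
      fix u v assume uv: "u \<in> carrier (right_regular H A)" "v \<in> carrier ?M"
      then have uv': "u \<in> A" "v \<in> A" by (simp_all add: right_regular_def left_regular_def)
      then have vx: "v \<otimes> x \<in> carrier ?M" using A'(7)[OF _ x] by (simp add: left_regular_def)
      show "?p {Q u} (v \<otimes> x) \<in> carrier ?T" using vx QN uv' by blast
      show "?p {Q (u \<oplus>\<^bsub>right_regular H A\<^esub> u')} (v \<otimes> x) = ?p {Q u} (v \<otimes> x) \<otimes>\<^bsub>?T\<^esub> ?p {Q u'} (v \<otimes> x)"
        if "u' \<in> carrier (right_regular H A)" for u'
      proof -
        have u': "u' \<in> A" using that by (simp add: right_regular_def)
        have "{Q (u \<oplus>\<^bsub>right_regular H A\<^esub> u')} = {Q u} \<oplus>\<^bsub>?N\<^esub> {Q u'}" using add uv' u' by (simp add: right_regular_def)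
        then show ?thesis using pb vx QN[OF uv'(1)] QN[OF u'] by simp
      qed
      show "?p {Q u} ((v \<oplus>\<^bsub>?M\<^esub> v') \<otimes> x) = ?p {Q u} (v \<otimes> x) \<otimes>\<^bsub>?T\<^esub> ?p {Q u} (v' \<otimes> x)" if "v' \<in> carrier ?M" for v'
      proof -
        have v': "v' \<in> A" using that by (simp add: left_regular_def)
        have "(v \<oplus>\<^bsub>?M\<^esub> v') \<otimes> x = v \<otimes> x \<oplus>\<^bsub>?M\<^esub> v' \<otimes> x"
          using x uv' v' A'(6) by (simp add: left_regular_def H.l_distr)
        moreover have "v' \<otimes> x \<in> carrier ?M" using A'(7)[OF v' x] by (simp add: left_regular_def)
        ultimately show ?thesis using pb vx QN[OF uv'(1)] by simp
      qed
    next
      fix r u v assume r: "r \<in> carrier ?R" and uv: "u \<in> carrier (right_regular H A)" "v \<in> carrier ?M"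
      then have uv': "u \<in> A" "v \<in> A" "r \<in> K" "r \<in> A" using KA by (auto simp: right_regular_def left_regular_def)
      have vx: "v \<otimes> x \<in> carrier ?M" using A'(7)[OF uv'(2) x] by (simp add: left_regular_def)
      have "(r \<odot>\<^bsub>?M\<^esub> v) \<otimes> x = r \<odot>\<^bsub>?M\<^esub> (v \<otimes> x)"
        using x uv' A'(6) by (simp add: left_regular_def H.m_assoc)
      moreover have "{Q (r \<odot>\<^bsub>right_regular H A\<^esub> u)} = r \<odot>\<^bsub>?N\<^esub> {Q u}" using act uv' by (simp add: right_regular_def)
      ultimately show "?p {Q (r \<odot>\<^bsub>right_regular H A\<^esub> u)} (v \<otimes> x) = ?p {Q u} ((r \<odot>\<^bsub>?M\<^esub> v) \<otimes> x)"
        using pb vx QN[OF uv'(1)] r by simp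
    qed
    from hopf_subalgebra_epi[OF A K KA aug tf.tensor_comm_group this a(1)]
    have "?p {Q a} (\<one> \<otimes> x) = ?p {Q \<one>} (a \<otimes> x)" by simp
    also have "Q \<one> = \<zero>" using Q(2) K'(8) by blast
    also have "?p {\<zero>} (a \<otimes> x) = \<one>\<^bsub>?T\<^esub>"
    proof -
      have ax: "a \<otimes> x \<in> carrier ?M" using A'(7)[OF a(1) x] by (simp add: left_regular_def)
      have "{\<zero>} \<oplus>\<^bsub>?N\<^esub> {\<zero>} = {\<zero>}" by (simp add: quotient_module_def)
      then have "?p {\<zero>} (a \<otimes> x) = ?p {\<zero>} (a \<otimes> x) \<otimes>\<^bsub>?T\<^esub> ?p {\<zero>} (a \<otimes> x)"
        using pb ax quotient_zero_in[of ?act] by metis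
      then show ?thesis using tf.pure_closed[OF quotient_zero_in ax] by simp
    qed
    finally show ?thesis using a(2) A'(6)[OF x] by simp
  qed
  have "exact_at ?T (tensor_map ?R ?N ?M (\<lambda>_. {\<zero>}) id) ?T (tensor_map ?R ?N ?M (\<lambda>_. {\<zero>}) id) ?T"
    using quotient_zero_in by (intro tf.trivial_tensor_exact triv) auto
  then have "exact_at (add_monoid ?N) (\<lambda>_. {\<zero>}) (add_monoid ?N) (\<lambda>_. {\<zero>}) (add_monoid ?N)"
    using ff N quotient_zero_hom[of ?act] K'(6) unfolding faithfully_flat_left_def by simp
  then show ?thesis by (rule quotient_exact_zero)
qed

end

section \<open>The Hopf coradical\<close>

lemma hopf_coradical_superset: "coradical k H \<subseteq> hopf_coradical k H"
  unfolding hopf_coradical_def by (rule generated_subalgebra_superset)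

lemma coradical_carrier: "coradical k H \<subseteq> carrier H"
proof -
  have "\<Union>{C. simple_subcoalgebra k H C} \<subseteq> carrier H"
    using subcoalgebraD(3) by (auto simp: simple_subcoalgebra_def)
  then show ?thesis
    unfolding coradical_def using H.add.generate_incl by simp
qed

text \<open>Closure under coproduct and antipode is a condition on single elements, and each element
  of \<open>A\<close> lies in a Hopf subalgebra inside \<open>A\<close>.\<close>

lemma locally_affine_hopf_subalgebra:
  assumes A: "unital_subalgebra k H A" and loc: "locally_affine k H A"
  shows "hopf_subalgebra k H A"
proof -
  note A' = unital_subalgebraD[OF A]
  have ex: "\<exists>K. hopf_subalgebra k H K \<and> x \<in> K \<and> K \<subseteq> A" if x: "x \<in> A" for x
  proof -
    have "finite {x} \<and> {x} \<subseteq> A" using x by simp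
    from loc[unfolded locally_affine_def, rule_format, OF this] show ?thesis by blast
  qed
  have "comult H x \<in> tensor_span k H A A" if "x \<in> A" for x
    using ex[OF that] hopf_subalgebraD(10) tensor_span_mono by blast
  moreover have "\<S> x \<in> A" if "x \<in> A" for x
    using ex[OF that] hopf_subalgebraD(9) by blast
  ultimately show ?thesis
    unfolding hopf_subalgebra_def subcoalgebra_def using A A'(1) by blast
qed

end

theorem theoremC:
  fixes k :: "('k, 'x) ring_scheme"
    and H :: "('k, 'h, 'y) hopf_algebra_scheme"
  assumes "hopf_algebra k H"
    and "left_noetherian H \<or> right_noetherian H"
    and "locally_affine k H (hopf_coradical k H)"
    and "left_faithfully_flat_over_hopf_subalgebras k H (hopf_coradical k H) \<or>
      right_faithfully_flat_over_hopf_subalgebras k H (hopf_coradical k H)"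
  shows "affine_subalgebra k H (hopf_coradical k H) \<and> affine_subalgebra k H (carrier H)"
proof -
  interpret hopf H k by (rule hopf.intro[OF assms(1)])
  let ?A = "hopf_coradical k H"
  have A: "hopf_subalgebra k H ?A"
    using generated_subalgebra_unital[OF coradical_carrier] assms(3)
    by (intro locally_affine_hopf_subalgebra) (simp_all add: hopf_coradical_def)
  obtain K where K: "hopf_subalgebra k H K" "affine_subalgebra k H K" "K \<subseteq> ?A" "generated_by_augmentation ?A K"
    using noetherian_affine_hopf_subalgebra[OF assms(2) A hopf_coradical_superset assms(3)] by blast
  obtain Q where Q: "linear Q" "\<And>w. w \<in> K \<Longrightarrow> Q w = \<zero>\<^bsub>H\<^esub>" "\<And>v. v \<in> carrier H \<Longrightarrow> v \<ominus>\<^bsub>H\<^esub> Q v \<in> K"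
    using ex_complement_projection[OF hopf_subalgebraD(2)[OF K(1)]] by blast
  \<comment> \<open>The epimorphism property annihilates the quotient by \<open>K\<close> from
    either side, so flatness on one side suffices, whichever side produced \<open>K\<close>.\<close>
  from assms(4) have "?A = K"
  proof
    assume "left_faithfully_flat_over_hopf_subalgebras k H ?A"
    then have ff: "faithfully_flat_left TYPE('h set) (H\<lparr>carrier := K\<rparr>) (left_regular H ?A)"
      using K(1,3) by (simp add: left_faithfully_flat_over_hopf_subalgebras_def)
    show ?thesis by (rule faithfully_flat_left_imp_eq[where Q = Q, OF A K(1,3) _ _ _ ff K(4)]) (use Q in auto)
  next
    assume "right_faithfully_flat_over_hopf_subalgebras k H ?A"
    then have ff: "faithfully_flat_right TYPE('h set) (H\<lparr>carrier := K\<rparr>) (right_regular H ?A)"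
      using K(1,3) by (simp add: right_faithfully_flat_over_hopf_subalgebras_def)
    show ?thesis by (rule faithfully_flat_right_imp_eq[where Q = Q, OF A K(1,3) _ _ _ ff K(4)]) (use Q in auto)
  qed
  then have "affine_subalgebra k H ?A" using K(2) by simp
  then show ?thesis using noetherian_affine[OF assms(2) A hopf_coradical_superset] by blast
qed

end
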